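(* Let $q$ be an odd prime power, $d\ge 2$, $\phi:\mathbb{F}_q^d\times\mathbb{F}_q^d\to\mathbb{F}_q$ a distance type function, $t\in\mathbb{F}_q^*$, and $E\subseteq\mathbb{F}_q^d$ nonempty. Let $$\gamma=\begin{cases}-1 & \text{if } d=2,\\ -\frac{d-2}{2} & \text{if } d\ge 3.\end{cases}$$ Let $n\ge 4$ be an integer such that $$12q^{\gamma}+8\frac{q^{d+2}}{|E|^2}+\left(24+12\left\lfloor \frac{n}{2}\right\rfloor\right)\frac{q^{\frac{d+1}{2}}}{|E|}\ \le\ 1.$$ If $n\ge 6$, then $$\left|C_n-\frac{|E|^n}{q^n}\right|\ \le\ \frac{|E|^n}{q^n}\left(12q^{\gamma}+8\frac{q^{d+1}}{|E|^2}+\left(24+12\left\lfloor \frac{n}{2}\right\rfloor\right)\frac{q^{\frac{d+1}{2}}}{|E|}\right).$$ Moreover, if $n=4$, then $$\left|C_4-\frac{|E|^4}{q^4}\right|\ \le\ \frac{|E|^4}{q^4}\left(12q^{\gamma}+8\frac{q^{d+2}}{|E|^2}+28\frac{q^{\frac{d+1}{2}}}{|E|}\right),$$ and if $n=5$, then $$\left|C_5-\frac{|E|^5}{q^5}\right|\ \le\ \frac{|E|^5}{q^5}\left(12q^{\gamma}+8\frac{q^{\frac{2d+3}{2}}}{|E|^2}+32\frac{q^{\frac{d+1}{2}}}{|E|}\right).$$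
   Context: A distance type function is a function $\phi:\mathbb{F}_q^d\times\mathbb{F}_q^d\to\mathbb{F}_q$ that is either a non-degenerate bilinear form, or of the form $\phi(x,y)=Q(x-y)$ for a non-degenerate quadratic form $Q$ on $\mathbb{F}_q^d$. For a fixed nonzero $t\in\mathbb{F}_q^*$, $C_n$ denotes the number of embeddings of an $n$-cycle into $E$: the number of tuples $(x_1,\dots,x_n)\in E^n$ (entries not required to be distinct) with $\phi(x_i,x_{i+1})=t$ for $1\le i\le n$, where $x_{n+1}=x_1$. *)

theory Defs
  imports "HOL-Analysis.Analysis"
begin

text \<open>
  The field of order \<open>q\<close> is an arbitrary type of class \<open>{field, finite}\<close>, and \<open>d\<close> is the
  cardinality of the index type. The library's \<open>bilinear\<close> is restricted to real vector spaces,
  so bilinearity is stated through \<open>Vector_Spaces.linear\<close>, with the scalars acting on themselves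
  by multiplication.
\<close>

definition bilinear_form :: "('a::field ^ 'd \<Rightarrow> 'a ^ 'd \<Rightarrow> 'a) \<Rightarrow> bool" where
  "bilinear_form B \<longleftrightarrow>
     (\<forall>x. Vector_Spaces.linear (*s) (*) (\<lambda>y. B x y)) \<and>
     (\<forall>y. Vector_Spaces.linear (*s) (*) (\<lambda>x. B x y))"

text \<open>Bilinear forms are not assumed symmetric, so both radicals are required to vanish.\<close>

definition nondegenerate_bilinear_form :: "('a::field ^ 'd \<Rightarrow> 'a ^ 'd \<Rightarrow> 'a) \<Rightarrow> bool" where
  "nondegenerate_bilinear_form B \<longleftrightarrow>
     bilinear_form B \<and>
     (\<forall>x. (\<forall>y. B x y = 0) \<longrightarrow> x = 0) \<and>
     (\<forall>y. (\<forall>x. B x y = 0) \<longrightarrow> y = 0)"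

definition polar_form :: "('a::field ^ 'd \<Rightarrow> 'a) \<Rightarrow> 'a ^ 'd \<Rightarrow> 'a ^ 'd \<Rightarrow> 'a" where
  "polar_form Q x y = Q (x + y) - Q x - Q y"

definition quadratic_form :: "('a::field ^ 'd \<Rightarrow> 'a) \<Rightarrow> bool" where
  "quadratic_form Q \<longleftrightarrow> (\<forall>c x. Q (c *s x) = c\<^sup>2 * Q x) \<and> bilinear_form (polar_form Q)"

text \<open>
  In odd characteristic the polar form is twice the symmetric bilinear form of \<open>Q\<close>, so this is
  the usual notion (invertible Gram matrix).
\<close>

definition nondegenerate_quadratic_form :: "('a::field ^ 'd \<Rightarrow> 'a) \<Rightarrow> bool" where
  "nondegenerate_quadratic_form Q \<longleftrightarrow>
     quadratic_form Q \<and> nondegenerate_bilinear_form (polar_form Q)"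

definition distance_type :: "('a::field ^ 'd \<Rightarrow> 'a ^ 'd \<Rightarrow> 'a) \<Rightarrow> bool" where
  "distance_type \<phi> \<longleftrightarrow>
     nondegenerate_bilinear_form \<phi> \<or>
     (\<exists>Q. nondegenerate_quadratic_form Q \<and> (\<forall>x y. \<phi> x y = Q (x - y)))"

text \<open>A tuple \<open>(x\<^sub>1, \<dots>, x\<^sub>n)\<close> is a list of length \<open>n\<close>; entries may repeat.\<close>

definition cycle_embeddings ::
    "('a::field ^ 'd \<Rightarrow> 'a ^ 'd \<Rightarrow> 'a) \<Rightarrow> 'a \<Rightarrow> ('a ^ 'd) set \<Rightarrow> nat \<Rightarrow> ('a ^ 'd) list set" where
  "cycle_embeddings \<phi> t E n =
     {xs. length xs = n \<and> set xs \<subseteq> E \<and> (\<forall>i<n. \<phi> (xs ! i) (xs ! (Suc i mod n)) = t)}"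

definition cycle_count ::
    "('a::field ^ 'd \<Rightarrow> 'a ^ 'd \<Rightarrow> 'a) \<Rightarrow> 'a \<Rightarrow> ('a ^ 'd) set \<Rightarrow> nat \<Rightarrow> nat" where
  "cycle_count \<phi> t E n = card (cycle_embeddings \<phi> t E n)"

definition gamma_exponent :: "nat \<Rightarrow> real" where
  "gamma_exponent d = (if d = 2 then - 1 else - ((real d - 2) / 2))"

end

theory Submission
  imports "HOL-Algebra.Algebraic_Closure_Type" Defs "HOL-Computational_Algebra.Computational_Algebra"
    "HOL-Number_Theory.Cong"
begin

text \<open>
  Let \<open>M\<close> be the matrix of the relation \<open>\<phi>(x, y) = t\<close> restricted to \<open>E\<close>. Then \<open>C\<^sub>n\<close> is the trace of
  \<open>M\<^sup>n\<close>, and \<open>M = (1/q) 1\<^sub>E 1\<^sub>E\<^sup>T + R\<close> with a remainder of operator norm at most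
  \<open>\<rho> = 2 q\<^bsup>(d-1)/2\<^esup>\<close>. With \<open>a = \<bar>E\<bar>/q\<close>, telescoping \<open>M\<^sup>n - R\<^sup>n\<close> gives
  \<open>\<bar>tr M\<^sup>n - tr R\<^sup>n - a\<^sup>n\<bar> \<le> (a + \<rho>)\<^sup>n - \<rho>\<^sup>n - a\<^sup>n\<close>, and
  \<open>\<bar>tr R\<^sup>n\<bar> \<le> \<rho>\<^bsup>n-2\<^esup> \<parallel>R\<parallel>\<^sup>2\<close> in the Hilbert-Schmidt norm; the rest is arithmetic.

  The norm bound is Fourier analysis for a bilinear form. For a quadratic form the Fourier
  coefficients are Gauss sums times Salie sums, which are elementary, or Kloosterman sums, for which
  the Weil bound is needed. Along the tower of quadratic extensions of the base field the Kloosterman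
  sums satisfy \<open>K' = 2 Q - K\<^sup>2\<close>, where \<open>Q\<close> is the size of the smaller field, so \<open>\<bar>K\<bar> > 2 \<surd>q\<close> would
  force \<open>K / \<surd>Q\<close> to \<open>-\<infinity>\<close>. This contradicts the lower bound for the number of points of
  \<open>y\<^sup>q - y = x + a/x\<close> over the extensions, which follows from Stepanov's method for the
  discriminant \<open>(Y\<^sup>q - Y)\<^sup>2 - 4 a\<close>.
\<close>

section \<open>Stepanov's method\<close>

text \<open>A bilinear form may fail to be symmetric, so M has no spectral theorem behind it; norms,
  traces and Cauchy-Schwarz take the place of eigenvalues. In the quadratic case the triangle
  inequality over the nonzero s would lose a factor of order \<surd>q in each Fourier coefficient;
  square-root cancellation in s is what produces the exponent (d+1)/2. This is where the 2 in \<rho>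
  comes from. A one-sided point count suffices for the cancellation. The recursion K' = 2 Q - K^2
  caps every later sum of the tower at 2 Q from above, and it turns an excess of either sign into a
  large negative value. In the sum over all characters the trivial one cancels the main term of the
  count, and the capped ones cannot compensate for one sum that drifts to minus infinity. The tower
  has degrees 2^j. From degree 4 on, the fields have R^2 elements, where R is a power of q with R
  \<ge> 2 q. This is the shape in which Stepanov's method works without derivatives: the R-power map
  is an involution on such a field.\<close>

definition bounded_polys :: "'a::comm_ring_1 set \<Rightarrow> nat \<Rightarrow> 'a poly set" where
  "bounded_polys F n = {p. (\<forall>i. coeff p i \<in> F) \<and> (\<forall>i\<ge>n. coeff p i = 0)}"

lemma bounded_polys_Suc:
  fixes F :: "'a::comm_ring_1 set"
  assumes "0 \<in> F"
  shows "bounded_polys F (Suc n) = (\<lambda>(c, p). pCons c p) ` (F \<times> bounded_polys F n)"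
proof (intro equalityI subsetI)
  fix p assume p: "p \<in> bounded_polys F (Suc n)"
  obtain c r where cr: "p = pCons c r" by (cases p)
  have "coeff p (Suc i) = coeff r i" for i using cr by simp
  then have "r \<in> bounded_polys F n"
    using p by (simp add: bounded_polys_def) (metis Suc_le_mono)
  moreover have "c \<in> F" using p cr by (auto simp: bounded_polys_def) (metis coeff_pCons_0)
  ultimately show "p \<in> (\<lambda>(c, p). pCons c p) ` (F \<times> bounded_polys F n)" using cr by auto
qed (use assms in \<open>auto simp: bounded_polys_def coeff_pCons split: nat.splits\<close>)

lemma card_bounded_polys:
  fixes F :: "'a::comm_ring_1 set"
  assumes "0 \<in> F" "finite F"
  shows "finite (bounded_polys F n) \<and> card (bounded_polys F n) = card F ^ n"
proof (induction n)
  case 0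
  have "bounded_polys F 0 = {0}"
    using assms by (auto simp: bounded_polys_def intro: poly_eqI)
  then show ?case by simp
next
  case (Suc n)
  have "inj_on (\<lambda>(c, p). pCons c p) (F \<times> bounded_polys F n)" by (auto simp: inj_on_def)
  then show ?case
    unfolding bounded_polys_Suc[OF assms(1)] using Suc assms by (simp add: card_image card_cartesian_product)
qed

lemma bounded_polys_degree:
  assumes "p \<in> bounded_polys F n" "n > 0" shows "degree p < n"
  by (metis (mono_tags, lifting) assms bounded_polys_def leading_coeff_0_iff degree_0 linorder_not_le mem_Collect_eq)

definition subring_set :: "'a::comm_ring_1 set \<Rightarrow> bool" where
  "subring_set F \<longleftrightarrow> 0 \<in> F \<and> 1 \<in> F \<and> (\<forall>x\<in>F. \<forall>y\<in>F. x + y \<in> F \<and> x - y \<in> F \<and> x * y \<in> F)"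

lemma subring_set_sum: "subring_set F \<Longrightarrow> (\<And>i. i \<in> A \<Longrightarrow> f i \<in> F) \<Longrightarrow> sum f A \<in> F"
  by (induction A rule: infinite_finite_induct) (auto simp: subring_set_def)

lemma subring_set_polys:
  assumes F: "subring_set F"
  shows "subring_set {p. \<forall>i. coeff p i \<in> F}"
proof -
  have "coeff (p * r) i \<in> F" if "\<forall>i. coeff p i \<in> F" "\<forall>i. coeff r i \<in> F" for p r i
    unfolding coeff_mult using that F by (intro subring_set_sum[OF F]) (auto simp: subring_set_def)
  then show ?thesis using F by (auto simp: subring_set_def coeff_1)
qed

lemma subring_set_power: "subring_set F \<Longrightarrow> x \<in> F \<Longrightarrow> x ^ n \<in> F"
  by (induction n) (auto simp: subring_set_def)

lemma freshman_power:
  fixes x y :: "'a::comm_semiring_1"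
  assumes "prime CHAR('a)" "R = CHAR('a) ^ j"
  shows "(x + y) ^ R = x ^ R + y ^ R"
  using freshmans_dream'[OF assms] .

lemma freshman_power_diff:
  fixes x y :: "'a::comm_ring_1"
  assumes "prime CHAR('a)" "R = CHAR('a) ^ j"
  shows "(x - y) ^ R = x ^ R - y ^ R"
  using freshman_power[OF assms, of "x - y" y] by (simp add: algebra_simps)

lemma freshman_power_sum:
  fixes f :: "'b \<Rightarrow> 'a::comm_semiring_1"
  assumes "prime CHAR('a)" "R = CHAR('a) ^ j"
  shows "sum f A ^ R = (\<Sum>i\<in>A. f i ^ R)"
  using freshmans_dream_sum'[OF assms] .

text \<open>The power D^((R+1)/2) has no simple form modulo X^R, but its square is D^R * D, and D^R
  reduces to the nonzero constant D(0)^R. Isolating the lowest block and squaring gives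
  (\<open>al 0\<close>)^2 = c D (\<open>de 0\<close>)^2 modulo X^R. The degree bounds make this an
  equality, \<open>sqf\<close> forces both polynomials to vanish, and division by X^R exposes the
  next block.\<close>

lemma stepanov_nonzero:
  fixes D :: "'l::field poly"
  assumes p: "prime CHAR('l)" and R: "R = CHAR('l) ^ j" "odd R"
    and D0: "coeff D 0 \<noteq> 0" and degD: "degree D \<le> 2 * g"
    and sqf: "\<And>c u v. c \<noteq> 0 \<Longrightarrow> u\<^sup>2 = smult c (D * v\<^sup>2) \<Longrightarrow> u = 0 \<and> v = 0"
    and deg: "\<And>i. i < m \<Longrightarrow> 2 * degree (al i) < R"
             "\<And>i. i < m \<Longrightarrow> 2 * degree (de i) + 2 * g < R"
    and z: "(\<Sum>i<m. monom 1 (i * R) * (al i + D ^ ((R + 1) div 2) * de i)) = 0"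
  shows "\<forall>i<m. al i = 0 \<and> de i = 0"
  using deg z
proof (induction m arbitrary: al de)
  case 0 then show ?case by simp
next
  case (Suc m)
  have pp: "prime CHAR('l poly)" "R = CHAR('l poly) ^ j" using p R by auto
  define e where "e = D ^ ((R + 1) div 2)"
  define T where "T = monom (1::'l) R"
  have shift: "(\<Sum>i<Suc m. monom 1 (i * R) * f i) = f 0 + T * (\<Sum>i<m. monom 1 (i * R) * f (Suc i))"
    for f :: "nat \<Rightarrow> 'l poly"
    by (subst sum.lessThan_Suc_shift)
       (simp add: T_def sum_distrib_left mult_monom monom_0 one_pCons[symmetric] flip: mult.assoc)
  define h0 where "h0 = (\<Sum>i<m. monom 1 (i * R) * al (Suc i))"
  define h1 where "h1 = (\<Sum>i<m. monom 1 (i * R) * de (Suc i))"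
  have eq: "al 0 + T * h0 = - (e * (de 0 + T * h1))"
  proof -
    have "(\<Sum>i<Suc m. monom 1 (i * R) * (al i + e * de i)) = (al 0 + T * h0) + e * (de 0 + T * h1)"
      unfolding shift by (simp add: h0_def h1_def algebra_simps sum.distrib sum_distrib_left)
    with Suc.prems(3) show ?thesis by (simp add: e_def add_eq_0_iff)
  qed
  have ee: "e\<^sup>2 = D ^ R * D"
  proof -
    have "(R + 1) div 2 * 2 = Suc R" using R(2) by presburger
    then show ?thesis unfolding e_def power_mult[symmetric] by simp
  qed
  have "T dvd D ^ R - [:coeff D 0 ^ R:]"
  proof -
    have "monom 1 1 dvd D - [:coeff D 0:]"
      by (auto simp: monom_1_dvd_iff' coeff_pCons)
    then have "monom 1 1 ^ R dvd (D - [:coeff D 0:]) ^ R" by (rule dvd_power_same)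
    then show ?thesis
      by (simp add: T_def monom_power freshman_power_diff[OF pp] poly_const_pow)
  qed
  then obtain w where "D ^ R - [:coeff D 0 ^ R:] = T * w" by (elim dvdE)
  then have w: "D ^ R = [:coeff D 0 ^ R:] + T * w" by (simp add: diff_eq_eq add.commute)
  define c where "c = coeff D 0 ^ R"
  have c: "c \<noteq> 0" using D0 by (simp add: c_def)
  have "(al 0 + T * h0)\<^sup>2 = ([:c:] + T * w) * D * (de 0 + T * h1)\<^sup>2"
    unfolding eq power2_minus power_mult_distrib ee w c_def ..
  then have "(al 0)\<^sup>2 - smult c (D * (de 0)\<^sup>2) =
      T * (w * D * (de 0 + T * h1)\<^sup>2 + [:c:] * D * (2 * de 0 * h1 + T * h1\<^sup>2) - (2 * al 0 * h0 + T * h0\<^sup>2))"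
    by (simp add: algebra_simps power2_eq_square)
  then have dv: "T dvd (al 0)\<^sup>2 - smult c (D * (de 0)\<^sup>2)" by auto
  have "degree ((al 0)\<^sup>2 - smult c (D * (de 0)\<^sup>2)) < R"
  proof (rule degree_diff_less)
    show "degree ((al 0)\<^sup>2) < R" using Suc.prems(1)[of 0] degree_power_le[of "al 0" 2] by simp
    have "degree (smult c (D * (de 0)\<^sup>2)) \<le> degree D + degree ((de 0)\<^sup>2)"
      using degree_smult_le degree_mult_le order_trans by blast
    then show "degree (smult c (D * (de 0)\<^sup>2)) < R"
      using Suc.prems(2)[of 0] degree_power_le[of "de 0" 2] degD by simp
  qed
  then have "(al 0)\<^sup>2 - smult c (D * (de 0)\<^sup>2) = 0"
    using dvd_imp_degree_le[OF dv] by (auto simp: T_def degree_monom_eq)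
  then have 0: "al 0 = 0" "de 0 = 0" using sqf[OF c] by auto
  have "T * (\<Sum>i<m. monom 1 (i * R) * (al (Suc i) + e * de (Suc i))) = 0"
    using Suc.prems(3) unfolding shift e_def[symmetric] by (simp add: 0)
  then have "(\<Sum>i<m. monom 1 (i * R) * (al (Suc i) + e * de (Suc i))) = 0"
    by (simp add: T_def)
  from Suc.IH[OF _ _ this[unfolded e_def]] have "\<forall>i<m. al (Suc i) = 0 \<and> de (Suc i) = 0"
    using Suc.prems by auto
  with 0 show ?case by (metis less_Suc_eq_0_disj)
qed

lemma subring_set_closed:
  assumes "subring_set F" "x \<in> F" "y \<in> F"
  shows "x - y \<in> F" "x * y \<in> F"
  using assms by (auto simp: subring_set_def)

lemma degree_power_le_mult:
  fixes p :: "'a::comm_semiring_1 poly"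
  assumes "degree p \<le> n" shows "degree (p ^ k) \<le> k * n"
  by (rule order_trans[OF degree_power_le]) (use mult_le_mono2[OF assms, of k] in \<open>simp only: mult.commute\<close>)

text \<open>On the given set the R-th power of U(y) equals V(y), a polynomial expression of much
  lower degree than U^R. V has fewer coefficients in F than the data \<open>al\<close>,
  \<open>de\<close> have, so the pigeonhole principle makes V vanish for nonzero data. Then U is a
  nonzero polynomial of degree about R^2 / 2 that vanishes on the set.\<close>

lemma stepanov_count:
  fixes D :: "'l::field poly"
  assumes p: "prime CHAR('l)" and R: "R = CHAR('l) ^ j" "odd R" "2 * g \<le> R"
    and F: "subring_set F" "finite F" and DF: "\<And>i. coeff D i \<in> F"
    and D0: "coeff D 0 \<noteq> 0" and degD: "degree D \<le> 2 * g"
    and sqf: "\<And>c u v. c \<noteq> 0 \<Longrightarrow> u\<^sup>2 = smult c (D * v\<^sup>2) \<Longrightarrow> u = 0 \<and> v = 0"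
  shows "2 * card {y. y ^ (R * R) = y \<and> poly D y ^ ((R * R - 1) div 2) = -1} \<le> R * R + 4 * g * R"
    (is "2 * card ?Z \<le> _")
proof -
  have pp: "prime CHAR('l poly)" "R = CHAR('l poly) ^ j" using p R by auto
  obtain r where r: "R = 2 * r + 1" using R(2) by (elim oddE)
  \<comment> \<open>A and B are the largest numbers of coefficients that the degree hypotheses of
    \<open>stepanov_nonzero\<close> allow. With m = A + g blocks, the m (A + B) free coefficients
    outnumber the N coefficients of V.\<close>
  define A where "A = r + 1"
  define B where "B = A - g"
  have B: "B + g = A" "B \<ge> 1" using R(3) r by (auto simp: A_def B_def)
  have A: "(R + 1) div 2 = A" "A \<ge> 1" using r by (auto simp: A_def)
  define m where "m = A + g"
  define N where "N = m + R * (A - 1) + g"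
  define e where "e = D ^ A"
  have dege: "degree e \<le> g * (R + 1)"
    using degree_power_le_mult[OF degD, of A] r by (simp add: e_def A_def algebra_simps)
  define V where "V = (\<lambda>(al, de). \<Sum>i<m. monom 1 i * (al i ^ R - e * de i ^ R))"
  define S where "S = (PiE {..<m} (\<lambda>_. bounded_polys F A)) \<times> (PiE {..<m} (\<lambda>_. bounded_polys F B))"
  have F0: "0 \<in> F" using F by (simp add: subring_set_def)
  note cb = card_bounded_polys[OF F0 F(2)]
  note PF = subring_set_polys[OF F(1)]
  have DinF: "D \<in> {p. \<forall>i. coeff p i \<in> F}" using DF by simp
  have V_in: "V ad \<in> bounded_polys F N" if ad: "ad \<in> S" for ad
  proof -
    obtain al de where ad': "ad = (al, de)" by force
    have al: "al i \<in> bounded_polys F A" and de: "de i \<in> bounded_polys F B" if "i < m" for i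
      using ad that by (auto simp: ad' S_def)
    have "V ad \<in> {p. \<forall>i. coeff p i \<in> F}"
      unfolding V_def ad' prod.case
    proof (rule subring_set_sum[OF PF])
      fix i assume "i \<in> {..<m}"
      then have 1: "al i \<in> {p. \<forall>i. coeff p i \<in> F}" "de i \<in> {p. \<forall>i. coeff p i \<in> F}"
        using al de by (auto simp: bounded_polys_def)
      have 2: "monom 1 i \<in> {p. \<forall>i. coeff p i \<in> F}"
        using F by (auto simp: subring_set_def)
      show "monom 1 i * (al i ^ R - e * de i ^ R) \<in> {p. \<forall>i. coeff p i \<in> F}"
        unfolding e_def
        by (intro subring_set_closed[OF PF] subring_set_power[OF PF] 1 2 DinF)
    qed
    moreover have "degree (V ad) \<le> N - 1"
      unfolding V_def ad' prod.case
    proof (rule degree_sum_le)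
      fix i assume i: "i \<in> {..<m}"
      have a: "degree (al i) \<le> A - 1" using bounded_polys_degree[OF al] A i by fastforce
      have d: "degree (de i) \<le> B - 1" using bounded_polys_degree[OF de] B i by fastforce
      have "degree (al i ^ R) \<le> R * (A - 1)"
        by (rule degree_power_le_mult[OF a])
      moreover have "degree (e * de i ^ R) \<le> g * (R + 1) + R * (B - 1)"
        using degree_mult_le[of e "de i ^ R"] dege degree_power_le_mult[OF d, of R] by linarith
      moreover have "g * (R + 1) + R * (B - 1) = g + R * (A - 1)"
      proof -
        have "A - 1 = g + (B - 1)" using B by simp
        then show ?thesis by (simp add: algebra_simps)
      qed
      ultimately have "degree (al i ^ R - e * de i ^ R) \<le> g + R * (A - 1)"
        by (intro degree_diff_le) auto
      then have "degree (monom (1::'l) i * (al i ^ R - e * de i ^ R)) \<le> i + (g + R * (A - 1))"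
        using degree_mult_le[of "monom (1::'l) i" "al i ^ R - e * de i ^ R"] by (simp add: degree_monom_eq)
      then show "degree (monom 1 i * (al i ^ R - e * de i ^ R)) \<le> N - 1"
        using i by (simp add: N_def)
    qed auto
    moreover have "N \<ge> 1" using A by (simp add: N_def m_def)
    ultimately show ?thesis by (auto simp: bounded_polys_def intro!: coeff_eq_0)
  qed
  have cF: "card F \<ge> 2"
  proof -
    have "{0, 1} \<subseteq> F" using F by (auto simp: subring_set_def)
    from card_mono[OF F(2) this] show ?thesis by simp
  qed
  have cS: "finite S" "card S = card F ^ (m * (A + B))"
    using cb by (auto simp: S_def card_cartesian_product card_PiE finite_PiE algebra_simps
        simp flip: power_mult power_add)
  have "N < m * (A + B)"
  proof -
    have "g \<le> r" using R(3) r by linarith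
    then obtain s where s: "r = g + s" using le_iff_add by blast
    have AB: "A + B = R + 1 - g" "A = g + s + 1" "B = s + 1" "R = 2 * g + 2 * s + 1"
      using B r s by (auto simp: A_def)
    show ?thesis unfolding N_def m_def AB by (simp add: algebra_simps)
  qed
  then have "card (bounded_polys F N) < card S"
    using cb cS cF by (simp add: power_strict_increasing)
  then have "\<not> inj_on V S"
    using V_in cb card_inj_on_le[of V S "bounded_polys F N"] by (metis image_subsetI not_le)
  then obtain a1 d1 a2 d2 where ne: "(a1, d1) \<noteq> (a2, d2)" "(a1, d1) \<in> S" "(a2, d2) \<in> S"
    and V12: "V (a1, d1) = V (a2, d2)" unfolding inj_on_def by (metis surj_pair)
  define al where "al = (\<lambda>i. a1 i - a2 i)"
  define de where "de = (\<lambda>i. d1 i - d2 i)"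
  \<comment> \<open>V is additive in the data because R is a power of the characteristic, so a
    collision passes to the difference.\<close>
  have Vz: "(\<Sum>i<m. monom 1 i * (al i ^ R - e * de i ^ R)) = 0"
    using V12 by (simp add: V_def al_def de_def freshman_power_diff[OF pp] algebra_simps sum.distrib sum_subtractf)
  have al: "degree (al i) < A" and de: "degree (de i) < B" if "i < m" for i
  proof -
    have "a1 i \<in> bounded_polys F A" "a2 i \<in> bounded_polys F A"
      "d1 i \<in> bounded_polys F B" "d2 i \<in> bounded_polys F B"
      using ne(2,3) that by (auto simp: S_def)
    then show "degree (al i) < A" "degree (de i) < B"
      unfolding al_def de_def using A B
      by (metis bounded_polys_degree degree_diff_less less_le_trans zero_less_one)+
  qed
  define U where "U = (\<Sum>i<m. monom 1 (i * R) * (al i + e * de i))"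
  have "U \<noteq> 0"
  proof
    assume "U = 0"
    then have "\<forall>i<m. al i = 0 \<and> de i = 0"
    proof (intro stepanov_nonzero[where D = D, OF p R(1,2) D0 degD sqf])
      show "(\<Sum>i<m. monom 1 (i * R) * (al i + D ^ ((R + 1) div 2) * de i)) = 0"
        using \<open>U = 0\<close> by (simp only: U_def e_def A)
      fix i assume "i < m"
      then show "2 * degree (al i) < R" "2 * degree (de i) + 2 * g < R"
        using al[of i] de[of i] r B(1) by (auto simp: A_def)
    qed
    then have i: "a1 i = a2 i" "d1 i = d2 i" if "i \<in> {..<m}" for i
      using that by (auto simp: al_def de_def)
    have S: "a1 \<in> {..<m} \<rightarrow>\<^sub>E bounded_polys F A" "a2 \<in> {..<m} \<rightarrow>\<^sub>E bounded_polys F A"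
      "d1 \<in> {..<m} \<rightarrow>\<^sub>E bounded_polys F B" "d2 \<in> {..<m} \<rightarrow>\<^sub>E bounded_polys F B"
      using ne(2,3) by (auto simp: S_def)
    have "a1 = a2" "d1 = d2"
      using PiE_ext[OF S(1,2) i(1)] PiE_ext[OF S(3,4) i(2)] by auto
    then show False using ne(1) by simp
  qed
  have Uz: "poly U y = 0" if y: "y \<in> ?Z" for y
  proof -
    define z where "z = poly D y"
    have y1: "y ^ (R * R) = y" and y2: "z ^ ((R * R - 1) div 2) = -1" using y by (auto simp: z_def)
    \<comment> \<open>Both sides are (R^2 + R) / 2. Hence the R-th power of z^A splits off the
      factor -1 given by \<open>y2\<close>.\<close>
    have "A * R = (R * R - 1) div 2 + A" by (simp add: r A_def algebra_simps)
    then have z: "(z ^ A) ^ R = - (z ^ A)" using y2 by (metis mult_minus1 power_add power_mult)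
    have yi: "(y ^ (i * R)) ^ R = y ^ i" for i
      using y1 by (metis mult.assoc mult.commute power_mult)
    have "poly U y ^ R = (\<Sum>i<m. (y ^ (i * R)) ^ R * (poly (al i) y ^ R + (z ^ A) ^ R * poly (de i) y ^ R))"
      by (simp add: U_def e_def poly_sum poly_monom poly_power z_def freshman_power_sum[OF p R(1)]
          power_mult_distrib freshman_power[OF p R(1)])
    also have "\<dots> = poly (\<Sum>i<m. monom 1 i * (al i ^ R - e * de i ^ R)) y"
      unfolding yi z by (simp add: poly_sum poly_monom poly_power e_def z_def)
    finally show ?thesis using Vz R by simp
  qed
  have "card ?Z \<le> card {y. poly U y = 0}"
    using Uz poly_roots_finite[OF \<open>U \<noteq> 0\<close>] by (intro card_mono) auto
  also have "\<dots> \<le> degree U" by (rule card_poly_roots_bound[OF \<open>U \<noteq> 0\<close>])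
  also have "\<dots> \<le> (m - 1) * R + (g * R + (A - 1))"
    unfolding U_def
  proof (rule degree_sum_le)
    fix i assume i: "i \<in> {..<m}"
    have "degree (e * de i) \<le> g * (R + 1) + (B - 1)"
      using degree_mult_le[of e "de i"] dege de[of i] i by fastforce
    also have "\<dots> = g * R + (A - 1)" using B by (simp flip: B(1))
    finally have "degree (al i + e * de i) \<le> g * R + (A - 1)"
      using al[of i] i by (intro degree_add_le) (auto simp: trans_le_add2)
    moreover have "i * R \<le> (m - 1) * R" using i by (intro mult_right_mono) auto
    moreover have "degree (monom (1::'l) (i * R) * (al i + e * de i)) \<le> i * R + degree (al i + e * de i)"
      using degree_mult_le[of "monom (1::'l) (i * R)" "al i + e * de i"] by (simp add: degree_monom_eq)
    ultimately show "degree (monom (1::'l) (i * R) * (al i + e * de i)) \<le> (m - 1) * R + (g * R + (A - 1))"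
      by linarith
  qed auto
  finally have "2 * card ?Z \<le> 2 * ((m - 1) * R + (g * R + (A - 1)))" by simp
  also have "\<dots> \<le> R * R + 4 * g * R" by (simp add: m_def A_def r algebra_simps)
  finally show ?thesis .
qed

section \<open>Additive characters of finite fields\<close>

definition add_subgroup :: "'a::ab_group_add set \<Rightarrow> bool" where
  "add_subgroup H \<longleftrightarrow> 0 \<in> H \<and> (\<forall>x\<in>H. \<forall>y\<in>H. x + y \<in> H \<and> x - y \<in> H)"

lemma add_subgroup_of_nat_mult:
  fixes H :: "'a::comm_ring_1 set"
  assumes "add_subgroup H" "x \<in> H" shows "of_nat n * x \<in> H"
  using assms by (induction n) (auto simp: add_subgroup_def algebra_simps)

lemma CHAR_finite_field_prime: "prime CHAR('a::{field,finite})"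
  using prime_CHAR_semidom[where ?'a = 'a] finite_imp_CHAR_pos[where ?'a = 'a] by auto

lemma of_nat_mod_CHAR: "of_nat (n mod CHAR('a)) = (of_nat n :: 'a::comm_ring_1)"
  by (metis (no_types, lifting) add.right_neutral mod_mult_div_eq mult_zero_left of_nat_CHAR of_nat_add of_nat_mult)

text \<open>For i < j the difference puts (j - i) g into H; as j - i is invertible modulo the prime
  characteristic, g itself would lie in H.\<close>

lemma add_subgroup_coset_unique:
  fixes H :: "'a::{field,finite} set"
  assumes H: "add_subgroup H" and g: "g \<notin> H" and ij: "i < CHAR('a)" "j < CHAR('a)"
    and mem: "x - of_nat i * g \<in> H" "x - of_nat j * g \<in> H"
  shows "i = j"
proof -
  have False if ij: "i < j" "j < CHAR('a)"
    and mem: "x - of_nat i * g \<in> H" "x - of_nat j * g \<in> H" for i j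
  proof -
    have "(x - of_nat i * g) - (x - of_nat j * g) \<in> H" using H mem unfolding add_subgroup_def by blast
    then have d: "of_nat (j - i) * g \<in> H" using ij by (simp add: of_nat_diff algebra_simps)
    have "coprime (j - i) CHAR('a)"
      using ij CHAR_finite_field_prime[where ?'a = 'a]
      by (metis coprime_commute diff_le_self dual_order.strict_trans2 linorder_not_le nat_dvd_not_less
          prime_imp_coprime zero_less_diff)
    then obtain u where "[(j - i) * u = 1] (mod CHAR('a))" using cong_solve_coprime_nat[of "j - i" "CHAR('a)"] by auto
    then have "of_nat ((j - i) * u) = (1::'a)"
      by (metis cong_def of_nat_1 of_nat_mod_CHAR)
    then have "of_nat u * (of_nat (j - i) * g) = g"
      by (metis mult.assoc mult.commute mult_1 of_nat_mult)
    then show False using add_subgroup_of_nat_mult[OF H d, of u] g by (simp only: not_True_eq_False)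
  qed
  then show ?thesis using ij mem by (meson linorder_neqE_nat)
qed

definition adjoin :: "'a::comm_ring_1 set \<Rightarrow> 'a \<Rightarrow> 'a set" where
  "adjoin H g = {x. \<exists>i<CHAR('a). x - of_nat i * g \<in> H}"

lemma adjoinI:
  fixes g :: "'a::{field,finite}"
  assumes "x - of_nat n * g \<in> H" shows "x \<in> adjoin H g"
  unfolding adjoin_def using assms finite_imp_CHAR_pos[where ?'a = 'a]
  by (auto intro!: exI[of _ "n mod CHAR('a)"] simp: of_nat_mod_CHAR)

lemma add_subgroup_adjoin:
  fixes H :: "'a::{field,finite} set"
  assumes H: "add_subgroup H"
  shows "add_subgroup (adjoin H g)" "H \<subseteq> adjoin H g" "g \<in> adjoin H g"
proof -
  let ?p = "CHAR('a)"
  have "0 \<in> adjoin H g" by (rule adjoinI[of _ 0]) (use H in \<open>simp add: add_subgroup_def\<close>)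
  moreover have "x + y \<in> adjoin H g \<and> x - y \<in> adjoin H g" if xy: "x \<in> adjoin H g" "y \<in> adjoin H g" for x y
  proof -
    obtain i j where ij: "x - of_nat i * g \<in> H" "y - of_nat j * g \<in> H" "j < ?p"
      using xy unfolding adjoin_def by blast
    have "(x - of_nat i * g) + (y - of_nat j * g) \<in> H" "(x - of_nat i * g) - (y - of_nat j * g) \<in> H"
      using ij H by (auto simp: add_subgroup_def)
    then have "x + y - of_nat (i + j) * g \<in> H" "x - y - of_nat (i + (?p - j)) * g \<in> H"
      using ij(3) by (simp_all add: algebra_simps of_nat_diff)
    then show ?thesis using adjoinI by blast
  qed
  ultimately show "add_subgroup (adjoin H g)" by (simp add: add_subgroup_def)
  show "H \<subseteq> adjoin H g" by (auto intro!: adjoinI[of _ 0])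
  show "g \<in> adjoin H g" by (rule adjoinI[of _ 1]) (use H in \<open>simp add: add_subgroup_def\<close>)
qed

lemma card_adjoin:
  fixes H :: "'a::{field,finite} set"
  assumes H: "add_subgroup H" and g: "g \<notin> H"
  shows "card (adjoin H g) = CHAR('a) * card H"
proof -
  have "bij_betw (\<lambda>(i, h). h + of_nat i * g) ({..<CHAR('a)} \<times> H) (adjoin H g)"
  proof (rule bij_betwI')
    fix a b assume "a \<in> {..<CHAR('a)} \<times> H" "b \<in> {..<CHAR('a)} \<times> H"
    then obtain i h j k where ab: "a = (i, h)" "b = (j, k)" "i < CHAR('a)" "j < CHAR('a)" "h \<in> H" "k \<in> H"
      by auto
    have "i = j" if "h + of_nat i * g = k + of_nat j * g"
      using add_subgroup_coset_unique[OF H g ab(3,4), of "h + of_nat i * g"] that ab by (metis add_diff_cancel_right')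
    then show "((case a of (i, h) \<Rightarrow> h + of_nat i * g) = (case b of (i, h) \<Rightarrow> h + of_nat i * g)) = (a = b)"
      using ab by auto
  next
    fix y assume "y \<in> adjoin H g"
    then show "\<exists>x\<in>{..<CHAR('a)} \<times> H. y = (case x of (i, h) \<Rightarrow> h + of_nat i * g)"
      by (force simp: adjoin_def intro: bexI[of _ "(i, y - of_nat i * g)" for i])
  next
    fix a assume "a \<in> {..<CHAR('a)} \<times> H"
    then show "(case a of (i, h) \<Rightarrow> h + of_nat i * g) \<in> adjoin H g"
      by (auto intro!: adjoinI[of "h + of_nat i * g" i for h i])
  qed
  then show ?thesis by (simp add: bij_betw_same_card[symmetric] card_cartesian_product)
qed

text \<open>Starting from {0}, adjoining an outside element multiplies the order by the
  characteristic until the field is exhausted. The result makes each power of q a power of the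
  characteristic, so that the corresponding power maps are additive.\<close>

lemma card_finite_field_prime_power:
  "\<exists>r. CARD('a::{field,finite}) = CHAR('a) ^ r"
proof -
  have *: "\<exists>r. CARD('a) = CHAR('a) ^ r" if "add_subgroup H" "\<exists>i. card H = CHAR('a) ^ i" for H :: "'a set"
    using that
  proof (induction "CARD('a) - card H" arbitrary: H rule: less_induct)
    case less
    show ?case
    proof (cases "H = UNIV")
      case False
      then obtain g where g: "g \<notin> H" by auto
      obtain i where i: "card H = CHAR('a) ^ i" using less.prems by auto
      have "card (adjoin H g) = CHAR('a) ^ Suc i" using card_adjoin[OF less.prems(1) g] i by simp
      moreover have "H \<subset> adjoin H g" using add_subgroup_adjoin[OF less.prems(1), of g] g by blast
      then have "card H < card (adjoin H g)" by (intro psubset_card_mono) auto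
      moreover have "card (adjoin H g) \<le> CARD('a)" by (intro card_mono) auto
      ultimately show ?thesis
        using less.hyps[of "adjoin H g"] add_subgroup_adjoin(1)[OF less.prems(1)] by (metis diff_less_mono2 less_le_trans)
    qed (use less in auto)
  qed
  have "add_subgroup {0::'a}" by (simp add: add_subgroup_def)
  moreover have "card {0::'a} = CHAR('a) ^ 0" by simp
  ultimately show ?thesis by (meson *)
qed

section \<open>Nontrivial additive characters and orthogonality\<close>

definition additive_character :: "('a::ab_group_add \<Rightarrow> complex) \<Rightarrow> bool" where
  "additive_character \<psi> \<longleftrightarrow> (\<forall>x y. \<psi> (x + y) = \<psi> x * \<psi> y) \<and> (\<forall>x. norm (\<psi> x) = 1) \<and> (\<exists>x. \<psi> x \<noteq> 1)"

text \<open>A proper subgroup H of largest order has \<open>adjoin H g\<close> = \<open>UNIV\<close>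
  for any g outside it. Every element then has a coset index modulo p relative to g, and
  exponentiating this index gives a character that is trivial on H but not at g.\<close>

lemma additive_character_exists: "\<exists>\<psi> :: 'a::{field,finite} \<Rightarrow> complex. additive_character \<psi>"
proof -
  let ?p = "CHAR('a)"
  have p: "prime ?p" by (rule CHAR_finite_field_prime)
  define S where "S = {H :: 'a set. add_subgroup H \<and> H \<noteq> UNIV}"
  have "(1::'a) \<notin> {0}" by simp
  then have "{0::'a} \<noteq> UNIV" by blast
  then have "{0} \<in> S" by (simp add: S_def add_subgroup_def)
  then have S: "finite S" "S \<noteq> {}" by auto
  have "Max (card ` S) \<in> card ` S" using S by (intro Max_in) auto
  then obtain H where HS: "H \<in> S" and "card H = Max (card ` S)" by auto
  then have Hmax: "\<And>H'. H' \<in> S \<Longrightarrow> card H' \<le> card H" using S by simp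
  have H: "add_subgroup H" using HS by (simp add: S_def)
  obtain g where g: "g \<notin> H" using HS by (auto simp: S_def)
  have "adjoin H g = UNIV"
  proof (rule ccontr)
    assume "adjoin H g \<noteq> UNIV"
    then have "adjoin H g \<in> S" using add_subgroup_adjoin(1)[OF H] by (simp add: S_def)
    moreover have "H \<subset> adjoin H g" using add_subgroup_adjoin[OF H, of g] g by blast
    then have "card H < card (adjoin H g)" by (intro psubset_card_mono) auto
    ultimately show False using Hmax by fastforce
  qed
  then have ex: "\<exists>i<?p. x - of_nat i * g \<in> H" for x by (auto simp: adjoin_def)
  define ix where "ix = (\<lambda>x. SOME i. i < ?p \<and> x - of_nat i * g \<in> H)"
  have ix: "ix x < ?p" "x - of_nat (ix x) * g \<in> H" for x
    using someI_ex[OF ex[of x]] by (auto simp: ix_def)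
  have ixI: "ix x = n mod ?p" if "x - of_nat n * g \<in> H" for x n
    using add_subgroup_coset_unique[OF H g ix(1)[of x] _ ix(2)[of x], of "n mod ?p"] that p prime_gt_0_nat[OF p]
    by (auto simp: of_nat_mod_CHAR)
  define e where "e = (\<lambda>n::nat. cis (2 * pi * real n / real ?p))"
  have e_add: "e (m + n) = e m * e n" for m n
    by (simp add: e_def cis_mult add_divide_distrib distrib_left)
  have "e ?p = 1" using prime_gt_0_nat[OF p] by (simp add: e_def)
  then have e_mult: "e (?p * k) = 1" for k
  proof (induction k)
    case 0 then show ?case by (simp add: e_def)
  next
    case (Suc k) then show ?case by (simp add: e_add)
  qed
  have e_mod: "e (n mod ?p) = e n" for n
    using e_add[of "?p * (n div ?p)" "n mod ?p"] e_mult[of "n div ?p"] by simp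
  have "ix (x + y) = (ix x + ix y) mod ?p" for x y
  proof (rule ixI)
    have "(x - of_nat (ix x) * g) + (y - of_nat (ix y) * g) \<in> H"
      using ix H by (auto simp: add_subgroup_def)
    then show "x + y - of_nat (ix x + ix y) * g \<in> H" by (simp add: algebra_simps)
  qed
  then have "e (ix (x + y)) = e (ix x) * e (ix y)" for x y by (simp add: e_mod e_add)
  moreover have "norm (e n) = 1" for n by (simp add: e_def)
  moreover have "e (ix g) \<noteq> 1"
  proof -
    have p1: "?p > 1" using prime_gt_1_nat[OF p] .
    have "ix g = 1" using ixI[of g 1] H p1 by (simp add: add_subgroup_def)
    moreover have "e 1 \<noteq> 1"
    proof
      assume "e 1 = 1"
      then have "cos (2 * pi / real ?p) = 1" by (simp add: e_def complex_eq_iff)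
      then obtain k :: int where "2 * pi / real ?p = of_int k * (2 * pi)" 
        by (auto simp: cos_one_2pi_int)
      then have "1 = of_int k * real ?p" using p1 by (simp add: field_simps)
      then have "1 = k * int ?p" by (metis of_int_1 of_int_eq_iff of_int_mult of_int_of_nat_eq)
      then have "int ?p dvd 1" by (metis dvd_triv_right)
      then show False using p1 by simp
    qed
    ultimately show ?thesis by simp
  qed
  ultimately have "additive_character (\<lambda>x. e (ix x))" unfolding additive_character_def by blast
  then show ?thesis by blast
qed

lemma additive_character_add: "additive_character \<psi> \<Longrightarrow> \<psi> (x + y) = \<psi> x * \<psi> y"
  by (simp add: additive_character_def)

lemma additive_character_norm: "additive_character \<psi> \<Longrightarrow> norm (\<psi> x) = 1"
  by (simp add: additive_character_def)

lemma additive_character_0: "additive_character \<psi> \<Longrightarrow> \<psi> 0 = 1"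
  using additive_character_add[of \<psi> 0 0] additive_character_norm[of \<psi> 0] by auto

lemma additive_character_cnj: "additive_character \<psi> \<Longrightarrow> cnj (\<psi> x) = \<psi> (- x)"
proof -
  assume psi: "additive_character \<psi>"
  have "\<psi> x * \<psi> (- x) = 1"
    using additive_character_add[OF psi, of x "- x"] additive_character_0[OF psi] by simp
  moreover have "\<psi> x * cnj (\<psi> x) = 1"
    using additive_character_norm[OF psi, of x] by (simp add: complex_norm_square[symmetric])
  ultimately show ?thesis by (metis mult_cancel_left mult_zero_left zero_neq_one)
qed

lemma additive_character_scale:
  fixes \<psi> :: "'a::field \<Rightarrow> complex"
  assumes "additive_character \<psi>" "c \<noteq> 0"
  shows "additive_character (\<lambda>x. \<psi> (c * x))"
proof -
  obtain x where x: "\<psi> x \<noteq> 1" using assms by (auto simp: additive_character_def)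
  have "\<psi> (c * (x / c)) \<noteq> 1" using x assms by simp
  then show ?thesis using assms(1) unfolding additive_character_def by (metis distrib_left)
qed

text \<open>Translating by a witness of nontriviality multiplies the sum by a number other than one.\<close>

lemma character_sum_eq_0:
  fixes f :: "'b::ab_group_add \<Rightarrow> complex"
  assumes G: "add_subgroup G"
    and add: "\<And>x y. x \<in> G \<Longrightarrow> y \<in> G \<Longrightarrow> f (x + y) = f x * f y" and x0: "x0 \<in> G" "f x0 \<noteq> 1"
  shows "sum f G = 0"
proof -
  have "sum f G = (\<Sum>x\<in>G. f (x + x0))"
    by (rule sum.reindex_bij_witness[of _ "\<lambda>x. x + x0" "\<lambda>x. x - x0"]) (use G x0 in \<open>auto simp: add_subgroup_def\<close>)
  also have "\<dots> = sum f G * f x0"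
    using add x0 by (simp add: sum_distrib_right)
  finally show ?thesis using x0 by simp
qed

lemma sum_additive_character:
  fixes \<psi> :: "'a::{field,finite} \<Rightarrow> complex"
  assumes "additive_character \<psi>"
  shows "(\<Sum>x\<in>UNIV. \<psi> (c * x)) = (if c = 0 then of_nat CARD('a) else 0)"
proof (cases "c = 0")
  case False
  obtain x where "\<psi> (c * x) \<noteq> 1"
    using additive_character_scale[OF assms False] by (auto simp: additive_character_def)
  then have "(\<Sum>x\<in>UNIV. \<psi> (c * x)) = 0"
    by (intro character_sum_eq_0)
      (auto simp: add_subgroup_def distrib_left additive_character_add[OF assms])
  then show ?thesis using False by simp
qed (use additive_character_0[OF assms] in simp)

section \<open>The tower of finite fields inside the algebraic closure\<close>

lemma card_roots_separable:
  fixes p :: "'l::alg_closed_field poly"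
  assumes "p \<noteq> 0" "\<And>x. poly p x = 0 \<Longrightarrow> poly (pderiv p) x \<noteq> 0"
  shows "card {x. poly p x = 0} = degree p"
  using assms
proof (induction "degree p" arbitrary: p)
  case 0
  then show ?case by (metis card_poly_roots_bound le_zero_eq)
next
  case (Suc n)
  then obtain z where z: "poly p z = 0" using alg_closed_imp_poly_has_root[of p] by auto
  then obtain r where r: "p = [:-z, 1:] * r" unfolding poly_eq_0_iff_dvd by (elim dvdE)
  have r0: "r \<noteq> 0" using r Suc.prems by auto
  then have deg: "degree p = Suc (degree r)" unfolding r by (subst degree_mult_eq) auto
  have pd: "poly (pderiv p) x = (x - z) * poly (pderiv r) x + poly r x" for x
    by (simp only: r pderiv_mult) (simp add: pderiv_pCons algebra_simps)
  have rz: "poly r z \<noteq> 0" using Suc.prems(2)[OF z] pd[of z] by simp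
  have "card {x. poly r x = 0} = degree r"
  proof (rule Suc.hyps(1))
    show "n = degree r" using Suc.hyps(2) deg by simp
    show "r \<noteq> 0" by (rule r0)
    fix x assume x: "poly r x = 0"
    then have "poly p x = 0" by (simp add: r)
    from Suc.prems(2)[OF this] show "poly (pderiv r) x \<noteq> 0" using pd[of x] x by auto
  qed
  moreover have "{x. poly p x = 0} = insert z {x. poly r x = 0}" by (auto simp: r)
  ultimately show ?case using rz deg poly_roots_finite[OF r0] by simp
qed

lemma finite_field_power_card:
  fixes x :: "'a::{field,finite}"
  shows "x ^ CARD('a) = x"
proof (cases "x = 0")
  case False
  have "(\<Prod>y\<in>UNIV-{0}. y) = (\<Prod>y\<in>UNIV-{0}. x * y)"
    by (rule prod.reindex_bij_witness[of _ "\<lambda>y. x * y" "\<lambda>y. y / x"]) (use False in auto)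
  also have "\<dots> = x ^ (CARD('a) - 1) * (\<Prod>y\<in>UNIV-{0}. y)"
    by (simp add: prod.distrib card_Diff_singleton)
  finally have "x ^ (CARD('a) - 1) = 1" by simp
  moreover have "CARD('a) = Suc (CARD('a) - 1)" by simp
  ultimately show ?thesis by (metis mult.right_neutral power_Suc)
qed simp

lemma CARD_field_ge_2: "CARD('a::{field,finite}) \<ge> 2"
proof -
  have "card {0, 1::'a} \<le> CARD('a)" by (intro card_mono) auto
  then show ?thesis by simp
qed

lemma alg_closure_frobenius:
  fixes x y :: "'a::{field,finite} alg_closure"
  shows "prime CHAR('a alg_closure)" "\<exists>j. CARD('a) ^ n = CHAR('a alg_closure) ^ j"
    "(x + y) ^ (CARD('a) ^ n) = x ^ (CARD('a) ^ n) + y ^ (CARD('a) ^ n)"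
    "(x - y) ^ (CARD('a) ^ n) = x ^ (CARD('a) ^ n) - y ^ (CARD('a) ^ n)"
    "sum f A ^ (CARD('a) ^ n) = (\<Sum>i\<in>A. (f i :: 'a alg_closure) ^ (CARD('a) ^ n))"
proof -
  show p: "prime CHAR('a alg_closure)" using CHAR_finite_field_prime[where ?'a = 'a] by simp
  show j: "\<exists>j. CARD('a) ^ n = CHAR('a alg_closure) ^ j"
    using card_finite_field_prime_power[where ?'a = 'a] by (auto simp flip: power_mult)
  then obtain j where j: "CARD('a) ^ n = CHAR('a alg_closure) ^ j" ..
  show "(x + y) ^ (CARD('a) ^ n) = x ^ (CARD('a) ^ n) + y ^ (CARD('a) ^ n)"
    by (rule freshman_power[OF p j])
  show "(x - y) ^ (CARD('a) ^ n) = x ^ (CARD('a) ^ n) - y ^ (CARD('a) ^ n)"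
    by (rule freshman_power_diff[OF p j])
  show "sum f A ^ (CARD('a) ^ n) = (\<Sum>i\<in>A. (f i :: 'a alg_closure) ^ (CARD('a) ^ n))"
    by (rule freshman_power_sum[OF p j])
qed

text \<open>For n \<ge> 1 this is the field with q^n elements, always inside the same algebraic
  closure, so that all levels of the tower share one type. For n = 0 it is the whole
  closure.\<close>

definition fixed_field :: "nat \<Rightarrow> 'a::{field,finite} alg_closure set" where
  "fixed_field n = {x. x ^ (CARD('a) ^ n) = x}"

lemma fixed_field_closed:
  fixes x y :: "'a::{field,finite} alg_closure"
  assumes "x \<in> fixed_field n" "y \<in> fixed_field n"
  shows "x + y \<in> fixed_field n" "x - y \<in> fixed_field n" "x * y \<in> fixed_field n" "x / y \<in> fixed_field n"
    "- x \<in> fixed_field n" "x ^ k \<in> fixed_field n"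
proof -
  show *: "x + y \<in> fixed_field n" "x - y \<in> fixed_field n" "x * y \<in> fixed_field n" "x / y \<in> fixed_field n"
    using assms by (auto simp: fixed_field_def alg_closure_frobenius power_mult_distrib power_divide)
  have "(0::'a alg_closure) ^ (CARD('a) ^ n) = 0" by simp
  then show "- x \<in> fixed_field n"
    using alg_closure_frobenius(4)[of 0 x n] assms(1) by (simp add: fixed_field_def)
  show "x ^ k \<in> fixed_field n"
    using assms(1) by (simp add: fixed_field_def) (metis mult.commute power_mult)
qed

lemma fixed_field_to_ac: "to_ac c \<in> fixed_field n"
proof -
  have "c ^ (CARD('a) ^ n) = c" for c :: 'a
    by (induction n) (simp_all add: power_mult finite_field_power_card)
  then show ?thesis by (simp add: fixed_field_def flip: to_ac_power)
qed

lemma fixed_field_0_1: "0 \<in> fixed_field n" "1 \<in> fixed_field n"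
  by (auto simp: fixed_field_def)

lemma fixed_field_add_subgroup: "add_subgroup (fixed_field n)"
  by (auto simp: add_subgroup_def fixed_field_closed fixed_field_0_1)

lemma fixed_field_subring: "subring_set (fixed_field n)"
  by (auto simp: subring_set_def fixed_field_closed fixed_field_0_1)

lemma card_fixed_field:
  assumes n: "n \<ge> 1"
  shows "card (fixed_field n :: 'a::{field,finite} alg_closure set) = CARD('a) ^ n"
    "finite (fixed_field n :: 'a alg_closure set)"
proof -
  define Q where "Q = CARD('a) ^ n"
  have Q: "Q \<ge> 2" using n CARD_field_ge_2[where ?'a = 'a] self_le_power[of "CARD('a)" n] by (simp add: Q_def)
  define P where "P = monom (1 :: 'a alg_closure) Q - monom 1 1"
  have dP: "degree P = Q"
    using degree_add_eq_left[of "- monom (1 :: 'a alg_closure) 1" "monom 1 Q"] Q by (simp add: P_def degree_monom_eq)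
  then have P0: "P \<noteq> 0" using Q by auto
  have rP: "{x. poly P x = 0} = fixed_field n" by (auto simp: P_def fixed_field_def Q_def poly_monom)
  obtain j where j: "Q = CHAR('a alg_closure) ^ j" using alg_closure_frobenius(2)[of n] by (auto simp: Q_def)
  then have "j > 0" using Q by (cases j) auto
  then have "CHAR('a alg_closure) dvd Q" unfolding j by (simp add: dvd_power)
  then have "of_nat Q = (0 :: 'a alg_closure)" using of_nat_eq_0_iff_char_dvd by blast
  then have "pderiv P = - 1" by (simp add: P_def pderiv_diff pderiv_monom monom_0 one_pCons)
  then show "card (fixed_field n :: 'a alg_closure set) = CARD('a) ^ n"
    using card_roots_separable[OF P0] by (simp add: rP dP Q_def)
  show "finite (fixed_field n :: 'a alg_closure set)"
    unfolding rP[symmetric] by (rule poly_roots_finite[OF P0])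
qed

lemma fixed_field_1: "fixed_field 1 = range (to_ac :: 'a::{field,finite} \<Rightarrow> _)"
proof (rule sym, rule card_subset_eq)
  show "card (range (to_ac :: 'a \<Rightarrow> _)) = card (fixed_field 1 :: 'a alg_closure set)"
    using card_fixed_field(1)[of 1, where ?'a = 'a] by (simp add: card_image inj_to_ac)
qed (use card_fixed_field(2)[of 1, where ?'a = 'a] fixed_field_to_ac in auto)

section \<open>Trace to the base field and lifted characters\<close>

definition ac_trace :: "nat \<Rightarrow> 'a::{field,finite} alg_closure \<Rightarrow> 'a alg_closure" where
  "ac_trace n x = (\<Sum>i<n. x ^ (CARD('a) ^ i))"

lemma ac_trace_add: "ac_trace n (x + y) = ac_trace n x + ac_trace n y"
  and ac_trace_diff: "ac_trace n (x - y) = ac_trace n x - ac_trace n y"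
  by (simp_all add: ac_trace_def alg_closure_frobenius sum.distrib sum_subtractf)

lemma ac_trace_scale: "ac_trace n (to_ac c * x) = to_ac c * ac_trace n x"
  using fixed_field_to_ac[of c] by (simp add: ac_trace_def power_mult_distrib sum_distrib_left fixed_field_def)

lemma ac_trace_frobenius:
  fixes x :: "'a::{field,finite} alg_closure"
  assumes "x \<in> fixed_field n"
  shows "ac_trace n (x ^ CARD('a)) = ac_trace n x"
proof -
  have "ac_trace n (x ^ CARD('a)) = (\<Sum>i<n. x ^ (CARD('a) ^ Suc i))"
    by (simp add: ac_trace_def flip: power_mult)
  also have "\<dots> + x ^ (CARD('a) ^ 0) = (\<Sum>i<Suc n. x ^ (CARD('a) ^ i))"
    by (subst sum.lessThan_Suc_shift) simp
  also have "\<dots> = ac_trace n x + x" using assms by (simp add: ac_trace_def fixed_field_def)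
  finally show ?thesis by simp
qed

lemma ac_trace_range:
  fixes x :: "'a::{field,finite} alg_closure"
  assumes "x \<in> fixed_field n"
  shows "ac_trace n x \<in> range to_ac"
proof -
  have "ac_trace n x ^ (CARD('a) ^ 1) = (\<Sum>i<n. (x ^ (CARD('a) ^ i)) ^ (CARD('a) ^ 1))"
    unfolding ac_trace_def by (rule alg_closure_frobenius)
  also have "\<dots> = ac_trace n (x ^ CARD('a))"
    by (simp add: ac_trace_def mult.commute flip: power_mult)
  finally show ?thesis
    unfolding ac_trace_frobenius[OF assms] fixed_field_1[symmetric] by (simp add: fixed_field_def)
qed

text \<open>Transitivity of the trace: x + x^(q^n) is the relative trace of the quadratic
  extension.\<close>

lemma ac_trace_double:
  fixes x :: "'a::{field,finite} alg_closure"
  shows "ac_trace (2 * n) x = ac_trace n (x + x ^ (CARD('a) ^ n))"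
proof -
  have "ac_trace (2 * n) x = (\<Sum>i<n. x ^ (CARD('a) ^ i)) + (\<Sum>i=n..<2*n. x ^ (CARD('a) ^ i))"
    unfolding ac_trace_def lessThan_atLeast0 by (rule sum.atLeastLessThan_concat[symmetric]) auto
  also have "(\<Sum>i=n..<2*n. x ^ (CARD('a) ^ i)) = (\<Sum>i<n. x ^ (CARD('a) ^ (i + n)))"
    using sum.shift_bounds_nat_ivl[of "\<lambda>i. x ^ (CARD('a) ^ i)" 0 n n] by (simp add: lessThan_atLeast0 mult_2)
  also have "\<dots> = ac_trace n (x ^ (CARD('a) ^ n))"
    by (simp add: ac_trace_def power_add mult.commute flip: power_mult)
  finally show ?thesis by (simp only: ac_trace_add) (simp add: ac_trace_def)
qed

text \<open>As a polynomial the trace is nonzero of degree at most q^(n-1), so it cannot vanish at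
  all q^n points.\<close>

lemma ac_trace_nonzero:
  assumes n: "n \<ge> 1"
  shows "\<exists>x :: 'a::{field,finite} alg_closure. x \<in> fixed_field n \<and> ac_trace n x \<noteq> 0"
proof (rule ccontr)
  assume neg: "\<not> ?thesis"
  have q: "CARD('a) \<ge> 2" by (rule CARD_field_ge_2)
  define P where "P = (\<Sum>i<n. monom (1 :: 'a alg_closure) (CARD('a) ^ i))"
  have "coeff P 1 = (\<Sum>i<n. if i = 0 then 1 else 0)"
    unfolding P_def coeff_sum using q by (intro sum.cong) (auto simp: power_eq_1_iff)
  then have "coeff P 1 \<noteq> 0" using n by simp
  then have P0: "P \<noteq> 0" by auto
  have "degree P \<le> CARD('a) ^ (n - 1)"
    unfolding P_def using q by (intro degree_sum_le) (auto simp: degree_monom_eq intro!: power_increasing)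
  also have "\<dots> < CARD('a) ^ n" using q n by (intro power_strict_increasing) auto
  also have "\<dots> = card (fixed_field n :: 'a alg_closure set)" using card_fixed_field(1)[OF n, where ?'a = 'a] by simp
  also have "\<dots> \<le> card {x. poly P x = 0}"
    using neg by (intro card_mono poly_roots_finite[OF P0]) (auto simp: P_def poly_sum poly_monom ac_trace_def)
  also have "\<dots> \<le> degree P" by (rule card_poly_roots_bound[OF P0])
  finally show False by simp
qed

text \<open>The trace of an element of \<open>fixed_field n\<close> lies in the image of
  \<open>to_ac\<close>, where \<open>of_ac\<close> is a true inverse; the properties below are
  therefore restricted to such arguments.\<close>

definition lift_char :: "('a::{field,finite} \<Rightarrow> complex) \<Rightarrow> nat \<Rightarrow> 'a alg_closure \<Rightarrow> complex" where
  "lift_char \<psi> n x = \<psi> (of_ac (ac_trace n x))"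

lemma lift_char_add:
  fixes x y :: "'a::{field,finite} alg_closure"
  assumes "additive_character \<psi>" "x \<in> fixed_field n" "y \<in> fixed_field n"
  shows "lift_char \<psi> n (x + y) = lift_char \<psi> n x * lift_char \<psi> n y"
proof -
  obtain a b where "ac_trace n x = to_ac a" "ac_trace n y = to_ac b"
    using ac_trace_range assms by blast
  then show ?thesis
    by (simp add: lift_char_def ac_trace_add additive_character_add[OF assms(1)] flip: to_ac_add)
qed

lemma lift_char_0:
  fixes \<psi> :: "'a::{field,finite} \<Rightarrow> complex"
  shows "additive_character \<psi> \<Longrightarrow> lift_char \<psi> n 0 = 1"
  using ac_trace_diff[of n "0 :: 'a alg_closure" 0] by (simp add: lift_char_def additive_character_0)

lemma sum_lift_char:
  fixes \<psi> :: "'a::{field,finite} \<Rightarrow> complex" and w :: "'a::{field,finite} alg_closure"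
  assumes psi: "additive_character \<psi>" and n: "n \<ge> 1" and w: "w \<in> fixed_field n"
  shows "(\<Sum>x\<in>fixed_field n. lift_char \<psi> n (x * w)) = (if w = 0 then of_nat (CARD('a) ^ n) else 0)"
proof (cases "w = 0")
  case False
  obtain x :: "'a alg_closure" where x: "x \<in> fixed_field n" "ac_trace n x \<noteq> 0"
    using ac_trace_nonzero[OF n] by blast
  obtain b where b: "ac_trace n x = to_ac b" using ac_trace_range[OF x(1)] by blast
  then have b0: "b \<noteq> 0" using x by auto
  obtain c where c: "\<psi> c \<noteq> 1" using psi by (auto simp: additive_character_def)
  define x0 where "x0 = to_ac (c / b) * x / w"
  have x0: "x0 \<in> fixed_field n"
    unfolding x0_def by (intro fixed_field_closed fixed_field_to_ac x w)
  have "lift_char \<psi> n (x0 * w) = \<psi> c"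
    using False b b0 by (simp add: x0_def lift_char_def ac_trace_scale del: to_ac_divide flip: to_ac_mult)
  then have "(\<Sum>x\<in>fixed_field n. lift_char \<psi> n (x * w)) = 0"
    using c x0 w by (intro character_sum_eq_0[OF fixed_field_add_subgroup _ x0])
      (auto simp: distrib_right lift_char_add[OF psi] fixed_field_closed)
  then show ?thesis using False by simp
qed (use card_fixed_field(1)[OF n, where ?'a = 'a] lift_char_0[OF psi] in simp)

text \<open>Both sets consist of the roots u, v of X^2 - s X + m, which the Q-power map permutes. If
  it fixes two distinct roots, the two ordered pairs in the small field are counted; if it swaps
  them, the two conjugates in the extension are. A double root is counted once in each set.\<close>

lemma card_quadratic_pairs:
  fixes s m :: "'a::{field,finite} alg_closure"
  assumes s: "s \<in> fixed_field n" and m: "m \<in> fixed_field n"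
  shows "card {(x, y) \<in> fixed_field n \<times> fixed_field n. x + y = s \<and> x * y = m}
    + card {x \<in> fixed_field (2 * n). x + x ^ (CARD('a) ^ n) = s \<and> x * x ^ (CARD('a) ^ n) = m} = 2"
    (is "card ?A + card ?B = 2")
proof -
  define Q where "Q = CARD('a) ^ n"
  have fadd: "(x + y) ^ Q = x ^ Q + y ^ Q" for x y :: "'a alg_closure"
    unfolding Q_def by (rule alg_closure_frobenius)
  have QQ: "CARD('a) ^ (2 * n) = Q * Q" by (simp add: Q_def mult_2 power_add)
  have sm: "s ^ Q = s" "m ^ Q = m" using s m by (auto simp: fixed_field_def Q_def)
  obtain u where u: "poly [:m, - s, 1:] u = 0"
    using alg_closed_imp_poly_has_root[of "[:m, - s, 1:]"] by auto
  define v where "v = s - u"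
  have uv: "u + v = s" "u * v = m" using u by (auto simp: v_def algebra_simps)
  have pair: "x + y = s \<and> x * y = m \<longleftrightarrow> (x = u \<and> y = v) \<or> (x = v \<and> y = u)" for x y
  proof
    assume xy: "x + y = s \<and> x * y = m"
    have "(x - u) * (x - v) = x * x - (u + v) * x + u * v" by (simp add: algebra_simps)
    also have "\<dots> = x * x - (x + y) * x + x * y" using xy uv by simp
    also have "\<dots> = 0" by (simp add: algebra_simps)
    finally have "x = u \<or> x = v" by simp
    then show "(x = u \<and> y = v) \<or> (x = v \<and> y = u)" using xy uv by (auto simp: algebra_simps)
  qed (use uv in \<open>auto simp: algebra_simps\<close>)
  have "u ^ Q + v ^ Q = s \<and> u ^ Q * v ^ Q = m"
    using uv sm fadd[of u v] by (metis power_mult_distrib)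
  then have cases: "(u ^ Q = u \<and> v ^ Q = v) \<or> (u ^ Q = v \<and> v ^ Q = u)" by (simp add: pair)
  have "?A = {(x, y) \<in> fixed_field n \<times> fixed_field n. (x = u \<and> y = v) \<or> (x = v \<and> y = u)}"
    by (simp only: pair)
  also have "\<dots> = {p \<in> {(u, v), (v, u)}. fst p ^ Q = fst p \<and> snd p ^ Q = snd p}"
    by (auto simp: fixed_field_def Q_def)
  finally have A: "?A = \<dots>" .
  have "?B = {x. x ^ (Q * Q) = x \<and> ((x = u \<and> x ^ Q = v) \<or> (x = v \<and> x ^ Q = u))}"
    unfolding fixed_field_def QQ by (simp only: Q_def[symmetric] pair mem_Collect_eq)
  also have "\<dots> = {x \<in> {u, v}. (x = u \<and> x ^ Q = v) \<or> (x = v \<and> x ^ Q = u)}"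
    using cases by (auto simp: power_mult)
  finally have B: "?B = \<dots>" .
  show ?thesis
  proof (cases "u = v")
    case True
    then have e: "?A = {(u, u)}" "?B = {u}" using cases unfolding A B by auto
    show ?thesis unfolding e by simp
  next
    case False
    show ?thesis
    proof (cases "u ^ Q = u")
      case True
      then have e: "?A = {(u, v), (v, u)}" "?B = {}" using cases False unfolding A B by auto
      show ?thesis unfolding e using False by simp
    next
      case F: False
      then have e: "?A = {}" "?B = {u, v}" using cases unfolding A B by auto
      show ?thesis unfolding e using False by simp
    qed
  qed
qed

section \<open>Kloosterman sums\<close>

definition kloosterman :: "nat \<Rightarrow> ('a::{field,finite} \<Rightarrow> complex) \<Rightarrow> 'a \<Rightarrow> complex" where
  "kloosterman n \<psi> a = (\<Sum>x\<in>fixed_field n - {0}. lift_char \<psi> n (x + to_ac a / x))"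

lemma add_frac_common:
  fixes b x y :: "'a::field"
  assumes "x \<noteq> 0" "y \<noteq> 0"
  shows "(x + y) + b * (x + y) / (x * y) = (x + b / x) + (y + b / y)"
  using assms by (simp add: distrib_left add_divide_distrib)

lemma sum_over_fibres:
  fixes f :: "'c \<Rightarrow> complex"
  assumes "finite S" "finite T" "g ` S \<subseteq> T"
  shows "(\<Sum>p\<in>S. f (g p)) = (\<Sum>t\<in>T. of_nat (card {p \<in> S. g p = t}) * f t)"
proof -
  have "(\<Sum>p\<in>S. f (g p)) = (\<Sum>t\<in>T. \<Sum>p\<in>{p \<in> S. g p = t}. f (g p))"
    by (rule sum.group[OF assms, symmetric])
  also have "\<dots> = (\<Sum>t\<in>T. of_nat (card {p \<in> S. g p = t}) * f t)"
    by (intro sum.cong) auto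
  finally show ?thesis .
qed

text \<open>
  Elements \<open>x\<close> of the quadratic extension and pairs of elements of the base field are both sorted
  by trace and norm \<open>(s, m)\<close>; each \<open>(s, m)\<close> is hit exactly twice in total.
\<close>

lemma kloosterman_double:
  fixes \<psi> :: "'a::{field,finite} \<Rightarrow> complex"
  assumes psi: "additive_character \<psi>" and a: "a \<noteq> 0" and n: "n \<ge> 1"
  shows "kloosterman (2 * n) \<psi> a = 2 * of_nat (CARD('a) ^ n) - (kloosterman n \<psi> a)\<^sup>2"
proof -
  define Q where "Q = CARD('a) ^ n"
  define K where "K = (fixed_field n :: 'a alg_closure set)"
  define L where "L = (fixed_field (2 * n) :: 'a alg_closure set)"
  define b where "b = to_ac a"
  have b: "b \<noteq> 0" "b \<in> K" using a fixed_field_to_ac by (auto simp: b_def K_def)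
  have bQ: "b ^ Q = b" using b by (simp add: K_def fixed_field_def Q_def)
  have fin: "finite K" "finite L"
    using card_fixed_field(2)[of n, where ?'a = 'a] card_fixed_field(2)[of "2 * n", where ?'a = 'a] n
    by (auto simp: K_def L_def)
  define f where "f = (\<lambda>(s, m). lift_char \<psi> n (s + b * s / m))"
  define T where "T = K \<times> (K - {0})"
  define g where "g = (\<lambda>(x, y). (x + y, x * y :: 'a alg_closure))"
  define h where "h = (\<lambda>x. (x + x ^ Q, x * x ^ Q :: 'a alg_closure))"
  have K: "x + y \<in> K" "x * y \<in> K" "x / y \<in> K" if "x \<in> K" "y \<in> K" for x y
    using that fixed_field_closed by (auto simp: K_def)
  have LQ: "(x ^ Q) ^ Q = x" if "x \<in> L" for x
    using that by (simp add: L_def fixed_field_def Q_def mult_2 power_add power_mult)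
  have LK: "x + x ^ Q \<in> K" "x * x ^ Q \<in> K" if "x \<in> L" for x
    using LQ[OF that] alg_closure_frobenius(3)[of x "x ^ Q" n] 
    by (auto simp: K_def fixed_field_def Q_def[symmetric] power_mult_distrib)
  have "(kloosterman n \<psi> a)\<^sup>2 = (\<Sum>p\<in>(K - {0}) \<times> (K - {0}). f (g p))"
  proof -
    have "lift_char \<psi> n (x + b / x) * lift_char \<psi> n (y + b / y) = f (g (x, y))"
      if "x \<in> K - {0}" "y \<in> K - {0}" for x y
    proof -
      have "f (g (x, y)) = lift_char \<psi> n ((x + b / x) + (y + b / y))"
        using that by (simp only: f_def g_def prod.case) (subst add_frac_common, auto)
      also have "\<dots> = lift_char \<psi> n (x + b / x) * lift_char \<psi> n (y + b / y)"
        using that K b by (intro lift_char_add[OF psi]) (auto simp: K_def)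
      finally show ?thesis by simp
    qed
    then show ?thesis
      unfolding kloosterman_def power2_eq_square sum_product K_def[symmetric] b_def[symmetric] sum.cartesian_product
      by (intro sum.cong) auto
  qed
  also have "\<dots> = (\<Sum>t\<in>T. of_nat (card {p \<in> (K - {0}) \<times> (K - {0}). g p = t}) * f t)"
    using fin K by (intro sum_over_fibres) (auto simp: T_def g_def)
  finally have 1: "(kloosterman n \<psi> a)\<^sup>2 = \<dots>" .
  have "kloosterman (2 * n) \<psi> a = (\<Sum>x\<in>L - {0}. f (h x))"
    unfolding kloosterman_def L_def[symmetric] b_def[symmetric]
  proof (intro sum.cong refl)
    fix x assume x: "x \<in> L - {0}"
    have "(x + b / x) ^ Q = x ^ Q + b / x ^ Q"
      using alg_closure_frobenius(3)[of x "b / x" n] bQ by (simp add: Q_def power_divide)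
    then have "(x + b / x) + (x + b / x) ^ Q = (x + x ^ Q) + b * (x + x ^ Q) / (x * x ^ Q)"
      using x add_frac_common[of x "x ^ Q" b] by simp
    then show "lift_char \<psi> (2 * n) (x + b / x) = f (h x)"
      by (simp only: lift_char_def ac_trace_double f_def h_def Q_def[symmetric] prod.case)
  qed
  also have "\<dots> = (\<Sum>t\<in>T. of_nat (card {x \<in> L - {0}. h x = t}) * f t)"
    using fin LK by (intro sum_over_fibres) (auto simp: T_def h_def)
  finally have 2: "kloosterman (2 * n) \<psi> a = \<dots>" .
  have two: "card {p \<in> (K - {0}) \<times> (K - {0}). g p = t} + card {x \<in> L - {0}. h x = t} = 2" if tT: "t \<in> T" for t
  proof -
    obtain s m where t: "t = (s, m)" "s \<in> K" "m \<in> K" "m \<noteq> 0" using tT by (auto simp: T_def)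
    have "{p \<in> (K - {0}) \<times> (K - {0}). g p = t} = {(x, y) \<in> K \<times> K. x + y = s \<and> x * y = m}"
      using t by (auto simp: g_def)
    moreover have "{x \<in> L - {0}. h x = t} = {x \<in> L. x + x ^ Q = s \<and> x * x ^ Q = m}"
      using t by (auto simp: h_def)
    ultimately show ?thesis
      using card_quadratic_pairs[of s n m] t by (simp add: K_def L_def Q_def)
  qed
  have "(kloosterman n \<psi> a)\<^sup>2 + kloosterman (2 * n) \<psi> a = (\<Sum>t\<in>T. 2 * f t)"
    unfolding 1 2 sum.distrib[symmetric] distrib_right[symmetric] of_nat_add[symmetric]
    using two by (intro sum.cong) auto
  also have "\<dots> = 2 * (\<Sum>m\<in>K - {0}. \<Sum>s\<in>K. f (s, m))"
    unfolding sum_distrib_left[symmetric] T_def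
    by (subst sum.swap) (simp add: sum.cartesian_product)
  \<comment> \<open>For fixed m the argument s (1 + b/m) is linear in s, so orthogonality leaves
    only m = -b.\<close>
  also have "(\<Sum>m\<in>K - {0}. \<Sum>s\<in>K. f (s, m)) = (\<Sum>m\<in>K - {0}. if m = - b then of_nat Q else 0)"
  proof (intro sum.cong refl)
    fix m assume m: "m \<in> K - {0}"
    have w: "1 + b / m \<in> K" using m b(2) unfolding K_def by (auto intro!: fixed_field_closed fixed_field_0_1)
    have "(\<Sum>s\<in>K. f (s, m)) = (\<Sum>s\<in>K. lift_char \<psi> n (s * (1 + b / m)))"
      by (simp add: f_def algebra_simps)
    also have "\<dots> = (if 1 + b / m = 0 then of_nat Q else 0)"
      using sum_lift_char[OF psi n w[unfolded K_def]] by (simp add: K_def Q_def)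
    also have "1 + b / m = 0 \<longleftrightarrow> m = - b" using m by (auto simp: field_simps add_eq_0_iff)
    finally show "(\<Sum>s\<in>K. f (s, m)) = (if m = - b then of_nat Q else 0)" .
  qed
  also have "\<dots> = of_nat Q"
    using b fin fixed_field_closed(5)[of b n] by (simp add: sum.delta' K_def)
  finally show ?thesis by (simp add: Q_def algebra_simps)
qed

lemma kloosterman_real:
  fixes \<psi> :: "'a::{field,finite} \<Rightarrow> complex"
  assumes psi: "additive_character \<psi>"
  shows "kloosterman n \<psi> a = of_real (Re (kloosterman n \<psi> a))"
proof -
  have neg: "cnj (lift_char \<psi> n x) = lift_char \<psi> n (- x)" if x: "x \<in> fixed_field n" for x
  proof -
    obtain c where "ac_trace n x = to_ac c" using ac_trace_range[OF x] by blast
    moreover have "ac_trace n (- x) = - ac_trace n x"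
      using ac_trace_diff[of n 0 x] ac_trace_diff[of n x x] by simp
    ultimately show ?thesis
      by (simp add: lift_char_def additive_character_cnj[OF psi] flip: to_ac_minus)
  qed
  have "cnj (kloosterman n \<psi> a) = (\<Sum>x\<in>fixed_field n - {0}. lift_char \<psi> n (- x + to_ac a / (- x)))"
    unfolding kloosterman_def cnj_sum
    by (intro sum.cong refl, subst neg) (auto intro!: fixed_field_closed fixed_field_to_ac)
  also have "\<dots> = kloosterman n \<psi> a"
    unfolding kloosterman_def
    by (rule sum.reindex_bij_witness[of _ uminus uminus]) (auto dest: fixed_field_closed(5))
  finally show ?thesis by (simp add: complex_eq_iff)
qed

section \<open>Points of the curve y^q - y = x + a/x\<close>

definition trace_zero_set :: "nat \<Rightarrow> 'a::{field,finite} \<Rightarrow> 'a alg_closure set" where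
  "trace_zero_set n a = {x \<in> fixed_field n - {0}. ac_trace n (x + to_ac a / x) = 0}"

text \<open>Orthogonality over the base field in the variable c detects a vanishing trace. The term
  c = 0 is the degenerate sum, of value q^n - 1, and will cancel the main term of the point
  count.\<close>

lemma sum_kloosterman:
  fixes \<psi> :: "'a::{field,finite} \<Rightarrow> complex"
  assumes psi: "additive_character \<psi>" and n: "n \<ge> 1"
  shows "(\<Sum>c\<in>UNIV. kloosterman n (\<lambda>x. \<psi> (c * x)) a) = of_nat (CARD('a) * card (trace_zero_set n a))"
proof -
  have fin: "finite (fixed_field n - {0} :: 'a alg_closure set)" using card_fixed_field(2)[OF n] by simp
  have "(\<Sum>c\<in>UNIV. kloosterman n (\<lambda>x. \<psi> (c * x)) a)
     = (\<Sum>x\<in>fixed_field n - {0}. \<Sum>c\<in>UNIV. \<psi> (of_ac (ac_trace n (x + to_ac a / x)) * c))"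
    unfolding kloosterman_def lift_char_def by (subst sum.swap) (simp add: mult.commute)
  also have "\<dots> = (\<Sum>x\<in>fixed_field n - {0}. if ac_trace n (x + to_ac a / x) = 0 then of_nat CARD('a) else 0)"
  proof (intro sum.cong refl)
    fix x :: "'a alg_closure" assume "x \<in> fixed_field n - {0}"
    then have "x + to_ac a / x \<in> fixed_field n" by (auto intro!: fixed_field_closed fixed_field_to_ac)
    then obtain c where c: "ac_trace n (x + to_ac a / x) = to_ac c" using ac_trace_range by blast
    show "(\<Sum>c\<in>UNIV. \<psi> (of_ac (ac_trace n (x + to_ac a / x)) * c))
        = (if ac_trace n (x + to_ac a / x) = 0 then of_nat CARD('a) else 0)"
      unfolding c by (simp add: sum_additive_character[OF psi])
  qed
  also have "\<dots> = of_nat (CARD('a) * card (trace_zero_set n a))"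
    using fin by (simp add: trace_zero_set_def sum.If_cases mult.commute Int_def)
  finally show ?thesis .
qed

text \<open>The trace of y^q - y vanishes for every y in the field, which is the easy half of
  additive Hilbert 90, and each x comes from at most q values of y. A lower bound for the points
  thus becomes one for the trace zero set.\<close>

lemma card_artin_schreier_le:
  fixes a :: "'a::{field,finite}"
  assumes n: "n \<ge> 1"
  shows "card {(x, y) \<in> (fixed_field n - {0}) \<times> fixed_field n. y ^ CARD('a) - y = x + to_ac a / x}
     \<le> CARD('a) * card (trace_zero_set n a)" (is "card ?S \<le> _")
proof -
  have q: "CARD('a) \<ge> 2" by (rule CARD_field_ge_2)
  define Y where "Y = (\<lambda>x. {y. y ^ CARD('a) - y = x + to_ac a / x})"
  have Y: "finite (Y x) \<and> card (Y x) \<le> CARD('a)" for x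
  proof -
    define P where "P = monom (1 :: 'a alg_closure) (CARD('a)) - [:x + to_ac a / x, 1:]"
    have dP: "degree P = CARD('a)"
      using degree_add_eq_left[of "- [:x + to_ac a / x, 1:]" "monom 1 (CARD('a))"] q
      by (simp add: P_def degree_monom_eq del: minus_pCons)
    then have "P \<noteq> 0" using q by auto
    moreover have "Y x = {y. poly P y = 0}" by (auto simp: Y_def P_def poly_monom algebra_simps)
    ultimately show ?thesis using card_poly_roots_bound[of P] poly_roots_finite[of P] dP by auto
  qed
  have fin: "finite (trace_zero_set n a)"
    using card_fixed_field(2)[OF n, where ?'a = 'a] by (simp add: trace_zero_set_def)
  have "?S \<subseteq> Sigma (trace_zero_set n a) Y"
  proof (clarsimp simp: Y_def trace_zero_set_def)
    fix x y :: "'a alg_closure"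
    assume y: "y \<in> fixed_field n" "y ^ CARD('a) - y = x + to_ac a / x"
    show "ac_trace n (x + to_ac a / x) = 0"
      unfolding y(2)[symmetric] ac_trace_diff ac_trace_frobenius[OF y(1)] by simp
  qed
  then have "card ?S \<le> card (Sigma (trace_zero_set n a) Y)"
    using fin Y by (intro card_mono) auto
  also have "\<dots> = (\<Sum>x\<in>trace_zero_set n a. card (Y x))" using fin Y by (simp add: card_SigmaI)
  also have "\<dots> \<le> (\<Sum>x\<in>trace_zero_set n a. CARD('a))" using Y by (intro sum_mono) auto
  finally show ?thesis by (simp add: mult.commute)
qed

text \<open>For fixed y and w = y^q - y, the equation x + a/x = w reads x^2 - w x + a = 0; this is
  its discriminant as a polynomial in y.\<close>

definition artin_schreier_disc :: "'a::{field,finite} \<Rightarrow> 'a alg_closure poly" where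
  "artin_schreier_disc a = (monom 1 (CARD('a)) - monom 1 1)\<^sup>2 - [:4 * to_ac a:]"

lemma poly_artin_schreier_disc:
  "poly (artin_schreier_disc a) y = (y ^ CARD('a::{field,finite}) - y)\<^sup>2 - 4 * to_ac (a::'a)"
  by (simp add: artin_schreier_disc_def poly_monom)

lemma CHAR_dvd_card_finite_field: "CHAR('a::{field,finite}) dvd CARD('a)"
  using card_finite_field_prime_power[where ?'a = 'a] CARD_field_ge_2[where ?'a = 'a]
  by (metis One_nat_def Suc_1 Suc_n_not_le_n dvd_power gr0I power_0)

lemma two_neq_0_finite_field:
  assumes "odd CARD('a::{field,finite})"
  shows "(2::'a) \<noteq> 0" "(2::'a alg_closure) \<noteq> 0"
proof -
  have "odd CHAR('a)" using assms CHAR_dvd_card_finite_field[where ?'a = 'a] by (meson dvd_trans)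
  then have "\<not> CHAR('a) dvd 2"
    using CHAR_finite_field_prime[where ?'a = 'a] by (metis prime_nat_iff primes_dvd_imp_eq two_is_prime_nat even_numeral dvd_refl)
  then show "(2::'a) \<noteq> 0" using of_nat_eq_0_iff_char_dvd[of 2, where ?'a = 'a] by simp
  then show "(2::'a alg_closure) \<noteq> 0" by (metis to_ac_eq_0_iff to_ac_numeral)
qed

text \<open>Since Y^q - Y has derivative -1, D' = -2 (Y^q - Y). At a root of D this is nonzero, as
  otherwise 4 a = 0. So D has a simple root, where u^2 has even order and c D v^2 odd order.\<close>

lemma artin_schreier_disc_not_square:
  fixes a :: "'a::{field,finite}"
  assumes "odd CARD('a)" and a: "a \<noteq> 0" and c: "c \<noteq> 0"
    and uv: "u\<^sup>2 = smult c (artin_schreier_disc a * v\<^sup>2)"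
  shows "u = 0 \<and> v = 0"
proof (cases "v = 0")
  case False
  let ?D = "artin_schreier_disc a"
  let ?q = "CARD('a)"
  have q: "?q \<ge> 2" by (rule CARD_field_ge_2)
  note two = two_neq_0_finite_field(2)[OF assms(1)]
  have "degree (monom (1::'a alg_closure) ?q - monom 1 1) = ?q"
    using degree_add_eq_left[of "- monom (1 :: 'a alg_closure) 1" "monom 1 ?q"] q by (simp add: degree_monom_eq)
  then have "degree ((monom (1::'a alg_closure) ?q - monom 1 1)\<^sup>2) = 2 * ?q"
    by (simp add: degree_power_eq) (metis degree_0 degree_power_eq mult.commute not_numeral_le_zero q)
  then have deg: "degree ?D = 2 * ?q"
    using degree_add_eq_left[of "- [:4 * to_ac a:]" "(monom (1::'a alg_closure) ?q - monom 1 1)\<^sup>2"] q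
    by (simp add: artin_schreier_disc_def del: minus_pCons)
  then have D0: "?D \<noteq> 0" using q by auto
  obtain z where z: "poly ?D z = 0" using alg_closed_imp_poly_has_root[of ?D] deg q by auto
  have "of_nat ?q = (0 :: 'a alg_closure)"
    using CHAR_dvd_card_finite_field[where ?'a = 'a] 
    by (subst of_nat_eq_0_iff_char_dvd) simp
  then have pd: "poly (pderiv ?D) z = - 2 * (z ^ ?q - z)"
    by (simp add: artin_schreier_disc_def pderiv_diff pderiv_monom pderiv_power poly_monom pderiv_pCons power2_eq_square pderiv_mult)
  have "z ^ ?q - z \<noteq> 0"
  proof
    assume zq: "z ^ ?q - z = 0"
    have "(z ^ ?q - z)\<^sup>2 - 4 * to_ac a = 0" using z by (simp only: poly_artin_schreier_disc)
    then have "4 * to_ac a = 0" unfolding zq by (simp only: right_minus_eq zero_power2)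
    moreover have "(4::'a alg_closure) = 2 * 2" by simp
    ultimately show False using two a by (metis mult_eq_0_iff to_ac_eq_0_iff)
  qed
  then have pd0: "poly (pderiv ?D) z \<noteq> 0" using pd two by simp
  have "order z ?D = 1"
  proof -
    have "order z ?D \<noteq> 0" using z D0 by (simp add: order_root)
    moreover have "\<not> 2 \<le> order z ?D"
    proof
      assume "2 \<le> order z ?D"
      then have "[:- z, 1:]\<^sup>2 dvd ?D" by (simp add: order_divides)
      then obtain w where "?D = [:- z, 1:] * ([:- z, 1:] * w)" by (metis dvdE mult.assoc power2_eq_square)
      then have "poly (pderiv ?D) z = 0" by (simp only: pderiv_mult) simp
      then show False using pd0 by simp
    qed
    ultimately show ?thesis by linarith
  qed
  moreover have "u \<noteq> 0" using uv False D0 c by auto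
  then have "order z (u\<^sup>2) = order z u + order z u" by (simp add: power2_eq_square order_mult)
  moreover have "order z (smult c (?D * v\<^sup>2)) = order z ?D + (order z v + order z v)"
    using False D0 c by (simp add: order_smult order_mult power2_eq_square)
  ultimately have "order z u + order z u = 1 + (order z v + order z v)" using uv by simp
  then have False by presburger
  then show ?thesis ..
qed (use uv in auto)

text \<open>In the field K of R^2 elements each y for which D(y) is a nonzero square yields two
  values of x, and Stepanov's method limits the y with D(y) a nonsquare to about half of K. It is
  applied with g = q, so it asks for 2 q \<le> q^h; this is where h \<ge> 2 enters.\<close>

lemma card_trace_zero_lower:
  fixes a :: "'a::{field,finite}"
  assumes odd: "odd CARD('a)" and a: "a \<noteq> 0" and h: "h \<ge> 2"
  shows "CARD('a) ^ h * CARD('a) ^ h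
    \<le> CARD('a) * card (trace_zero_set (2 * h) a) + 4 * CARD('a) * CARD('a) ^ h + 4 * CARD('a)"
proof -
  let ?q = "CARD('a)"
  let ?D = "artin_schreier_disc a"
  define R where "R = ?q ^ h"
  define K where "K = (fixed_field (2 * h) :: 'a alg_closure set)"
  have RR: "?q ^ (2 * h) = R * R" by (simp add: R_def mult_2 power_add)
  have cK: "card K = R * R" "finite K"
    using card_fixed_field[of "2 * h", where ?'a = 'a] h by (auto simp: K_def RR)
  have q3: "?q \<ge> 3" using odd CARD_field_ge_2[where ?'a = 'a] by (cases "?q = 2") auto
  have qR: "2 * ?q \<le> R"
  proof -
    have "2 * ?q \<le> ?q ^ 2" using q3 by (simp add: power2_eq_square)
    also have "\<dots> \<le> R" unfolding R_def using h q3 by (intro power_increasing) auto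
    finally show ?thesis .
  qed
  have oddR: "odd R" using odd by (simp add: R_def)
  obtain r where r: "R * R = 2 * r + 1" using oddR by (metis even_mult_iff oddE)
  then have rr: "(R * R - 1) div 2 = r" by simp
  obtain j where j: "R = CHAR('a alg_closure) ^ j"
    using alg_closure_frobenius(2)[of h, where ?'a = 'a] by (auto simp: R_def)
  note two = two_neq_0_finite_field(2)[OF odd]
  have two4: "(4 :: 'a alg_closure) = 2 * 2" by simp
  have four: "4 * to_ac a \<noteq> 0" unfolding two4 using two a by (metis mult_eq_0_iff to_ac_eq_0_iff)
  define Z where "Z = {y. y ^ (R * R) = y \<and> poly ?D y ^ r = -1}"
  define Z0 where "Z0 = {y. poly ?D y = 0}"
  have deg: "degree ?D \<le> 2 * ?q"
    unfolding artin_schreier_disc_def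
    by (intro degree_diff_le order_trans[OF degree_power_le_mult[of _ ?q]]) (auto simp: degree_monom_eq)
  have c0: "coeff ?D 0 \<noteq> 0"
    using four poly_artin_schreier_disc[of a 0] q3 by (simp add: poly_0_coeff_0 power_0_left)
  then have D0: "?D \<noteq> 0" by auto
  have coeffs: "coeff ?D i \<in> range to_ac" for i
  proof -
    have sr: "subring_set {p. \<forall>i. coeff p i \<in> range (to_ac :: 'a \<Rightarrow> _)}"
      by (rule subring_set_polys) (use fixed_field_subring[of 1, where ?'a = 'a] fixed_field_1[where ?'a = 'a] in simp)
    have m: "monom 1 k \<in> {p. \<forall>i. coeff p i \<in> range (to_ac :: 'a \<Rightarrow> _)}" for k
      by (auto simp: image_iff intro: exI[of _ 0] exI[of _ 1])
    have "coeff [:4 * to_ac a:] i = to_ac (if i = 0 then 4 * a else 0)" for i by (cases i) auto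
    then have "[:4 * to_ac a:] \<in> {p. \<forall>i. coeff p i \<in> range (to_ac :: 'a \<Rightarrow> _)}" by simp
    then have "?D \<in> {p. \<forall>i. coeff p i \<in> range (to_ac :: 'a \<Rightarrow> _)}"
      unfolding artin_schreier_disc_def
      by (intro subring_set_closed(1)[OF sr] subring_set_power[OF sr] m)
    then show ?thesis by simp
  qed
  have "2 * card {y. y ^ (R * R) = y \<and> poly ?D y ^ ((R * R - 1) div 2) = -1} \<le> R * R + 4 * ?q * R"
  proof (rule stepanov_count[where F = "range to_ac"])
    show "subring_set (range (to_ac :: 'a \<Rightarrow> _))"
      using fixed_field_subring[of 1, where ?'a = 'a] fixed_field_1[where ?'a = 'a] by simp
    show "u = 0 \<and> v = 0" if "c \<noteq> 0" "u\<^sup>2 = smult c (?D * v\<^sup>2)" for c u v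
      using artin_schreier_disc_not_square[OF odd a that] .
  qed (use alg_closure_frobenius(1)[where ?'a = 'a] j oddR qR c0 deg coeffs in auto)
  then have cZ: "2 * card Z \<le> R * R + 4 * ?q * R" by (simp only: Z_def rr)
  have cZ0: "card Z0 \<le> 2 * ?q" "finite Z0"
    using card_poly_roots_bound[OF D0] deg poly_roots_finite[OF D0] by (auto simp: Z0_def)
  define G where "G = K - Z - Z0"
  have ZK: "Z \<subseteq> K" by (auto simp: Z_def K_def fixed_field_def RR)
  have "card K \<le> card (G \<union> Z \<union> Z0)" using cK cZ0 ZK finite_subset by (intro card_mono) (auto simp: G_def)
  also have "\<dots> \<le> card G + card Z + card Z0"
    by (meson add_le_mono card_Un_le le_refl order_trans)
  finally have cG: "R * R \<le> card G + card Z + card Z0" using cK by simp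
  define P where "P = (\<lambda>y. {x \<in> K - {0}. y ^ ?q - y = x + to_ac a / x})"
  have two_sols: "2 \<le> card (P y)" if y: "y \<in> G" for y
  proof -
    define d where "d = poly ?D y"
    have d0: "d \<noteq> 0" using y by (auto simp: G_def Z0_def d_def)
    have yK: "y \<in> K" using y by (simp add: G_def)
    have four_in: "4 * to_ac a \<in> K"
      using fixed_field_to_ac[of "4 * a"] by (simp add: K_def)
    have dK: "d \<in> K"
      unfolding d_def poly_artin_schreier_disc
      using yK four_in by (auto simp: K_def intro!: fixed_field_closed)
    \<comment> \<open>Euler's criterion in a field of 2 r + 1 elements: d^r is 1 or -1, and y
      outside Z excludes -1. A square root z of d in the closure then lies in K, because z^(2r+1) =
      d^r z = z.\<close>
    then have "d ^ (2 * r) * d = d" unfolding K_def fixed_field_def RR r by simp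
    then have "(d ^ r)\<^sup>2 = 1" using d0 by (simp add: power_mult[symmetric] mult.commute)
    then have "d ^ r = 1 \<or> d ^ r = -1" by (simp add: power2_eq_1_iff)
    then have dr: "d ^ r = 1" using y yK by (auto simp: G_def Z_def K_def d_def fixed_field_def RR)
    obtain z where z: "z ^ 2 = d" using nth_root_exists[of 2 d] by auto
    have z0: "z \<noteq> 0" using z d0 by auto
    have "z ^ (R * R) = (z ^ 2) ^ r * z" unfolding r by (simp flip: power_mult)
    then have zK: "z \<in> K" by (simp add: z dr K_def fixed_field_def RR)
    define w where "w = y ^ ?q - y"
    have wK: "w \<in> K" unfolding w_def K_def using yK by (auto simp: K_def intro!: fixed_field_closed)
    have twoK: "2 \<in> K" using fixed_field_to_ac[of 2] by (simp add: K_def)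
    have wz: "w\<^sup>2 - 4 * to_ac a = z\<^sup>2" unfolding z d_def poly_artin_schreier_disc w_def ..
    have sol: "(w + e) / 2 \<in> P y" if e: "e \<in> K" "e\<^sup>2 = z\<^sup>2" for e
    proof -
      define x x' where "x = (w + e) / 2" and "x' = (w - e) / 2"
      have x2: "x * 2 = w + e" "x' * 2 = w - e" using two by (simp_all add: x_def x'_def)
      have "x * x' * (2 * 2) = (x * 2) * (x' * 2)" by (simp only: mult_ac)
      also have "\<dots> = w\<^sup>2 - e\<^sup>2" unfolding x2 by (simp add: power2_eq_square algebra_simps)
      also have "\<dots> = to_ac a * (2 * 2)" using wz e(2) by (simp add: two4[symmetric] algebra_simps)
      finally have xx: "x * x' = to_ac a" using two by (metis mult_cancel_right mult_eq_0_iff)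
      then have "x \<noteq> 0" using a by auto
      then have "to_ac a / x = x'" by (simp flip: xx)
      moreover have "x + x' = w"
      proof -
        have "x + x' = (w + w) / 2" unfolding x_def x'_def by (simp flip: add_divide_distrib)
        also have "w + w = w * 2" by simp
        finally show ?thesis using two by simp
      qed
      moreover have "x \<in> K"
        unfolding x_def using wK e twoK by (auto simp: K_def intro!: fixed_field_closed)
      ultimately show ?thesis using \<open>x \<noteq> 0\<close> by (simp add: P_def w_def[symmetric] x_def[symmetric])
    qed
    have "(w + z) / 2 \<noteq> (w + - z) / 2"
    proof
      assume "(w + z) / 2 = (w + - z) / 2"
      then have "w + z = w + - z" using two by simp
      then have "z * 2 = 0" by auto
      then show False using two z0 by simp
    qed
    moreover have "{(w + z) / 2, (w + - z) / 2} \<subseteq> P y"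
      using sol[of z] sol[of "- z"] zK fixed_field_closed(5)[of z "2 * h"] by (auto simp: K_def)
    then have "card {(w + z) / 2, (w + - z) / 2} \<le> card (P y)"
      using cK by (intro card_mono) (auto simp: P_def)
    ultimately show ?thesis by simp
  qed
  have "2 * card G \<le> (\<Sum>y\<in>G. card (P y))"
    using two_sols sum_bounded_below[of G 2 "\<lambda>y. card (P y)"] by (simp add: mult.commute)
  also have "\<dots> = card (Sigma G P)"
    using cK by (subst card_SigmaI) (auto simp: G_def P_def)
  also have "\<dots> \<le> card {(x, y) \<in> (K - {0}) \<times> K. y ^ ?q - y = x + to_ac a / x}"
  proof (rule card_inj_on_le)
    show "inj_on prod.swap (Sigma G P)" by simp
    show "finite {(x, y) \<in> (K - {0}) \<times> K. y ^ ?q - y = x + to_ac a / x}"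
      using cK by (intro finite_subset[OF _ finite_cartesian_product[of K K]]) auto
  qed (auto simp: G_def P_def)
  also have "\<dots> \<le> ?q * card (trace_zero_set (2 * h) a)"
    unfolding K_def using h by (intro card_artin_schreier_le) auto
  finally show ?thesis using cG cZ cZ0(1) unfolding R_def[symmetric] by linarith
qed

section \<open>The Weil bound for Kloosterman sums over the base field\<close>

lemma kloosterman_sum_one:
  fixes \<psi> :: "'a::{field,finite} \<Rightarrow> complex"
  shows "kloosterman 1 \<psi> a = (\<Sum>x\<in>UNIV - {0}. \<psi> (x + a / x))"
proof -
  have "fixed_field 1 - {0 :: 'a alg_closure} = to_ac ` (UNIV - {0})"
    unfolding fixed_field_1 by auto
  moreover have "inj_on to_ac (UNIV - {0 :: 'a})" using inj_to_ac by (auto simp: inj_on_def)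
  moreover have "ac_trace 1 x = x" for x :: "'a alg_closure" by (simp add: ac_trace_def)
  ultimately show ?thesis
    by (simp add: kloosterman_def sum.reindex lift_char_def flip: to_ac_add to_ac_divide)
qed

text \<open>
  Normalised by the square root of the field size, the sums of the tower satisfy \<open>w \<mapsto> 2 - w\<^sup>2\<close>.
  A start outside \<open>[-2, 2]\<close> would drift to \<open>-\<infinity>\<close>, while the point count keeps the sum over all
  characters bounded below.
\<close>

theorem kloosterman_bound:
  fixes \<psi> :: "'a::{field,finite} \<Rightarrow> complex"
  assumes odd: "odd CARD('a)" and psi: "additive_character \<psi>" and a: "a \<noteq> 0"
  shows "norm (\<Sum>x\<in>UNIV - {0}. \<psi> (x + a / x)) \<le> 2 * sqrt (real CARD('a))"
proof (rule ccontr)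
  let ?q = "real CARD('a)"
  assume neg: "\<not> ?thesis"
  have q: "?q \<ge> 2" using CARD_field_ge_2[where ?'a = 'a] by simp
  define k where "k = (\<lambda>j c. Re (kloosterman (2 ^ j) (\<lambda>x. \<psi> (c * x)) a))"
  define w where "w = (\<lambda>j c. k j c / sqrt ?q ^ (2 ^ j))"
  have ch: "additive_character (\<lambda>x. \<psi> (c * x))" if "c \<noteq> 0" for c
    by (rule additive_character_scale[OF psi that])
  have kr: "kloosterman (2 ^ j) (\<lambda>x. \<psi> (c * x)) a = of_real (k j c)" if "c \<noteq> 0" for j c
    unfolding k_def by (rule kloosterman_real[OF ch[OF that]])
  have sq: "sqrt ?q ^ (2 ^ Suc j) = ?q ^ (2 ^ j)" for j
    by (simp add: power_mult)
  have k_rec: "k (Suc j) c = 2 * ?q ^ (2 ^ j) - (k j c)\<^sup>2" if c: "c \<noteq> 0" for j c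
  proof -
    have "(of_real (k (Suc j) c) :: complex) = of_real (2 * ?q ^ (2 ^ j) - (k j c)\<^sup>2)"
      using kloosterman_double[OF ch[OF c] a, of "2 ^ j"] by (simp add: kr[OF c] flip: kr[OF c, of "Suc j"])
    then show ?thesis by (simp only: of_real_eq_iff)
  qed
  have w_rec: "w (Suc j) c = 2 - (w j c)\<^sup>2" if c: "c \<noteq> 0" for j c
  proof -
    have "(sqrt ?q ^ (2 ^ j))\<^sup>2 = ?q ^ (2 ^ j)" by (simp flip: power_mult add: mult.commute[of _ 2] power_mult)
    then show ?thesis
      unfolding w_def k_rec[OF c] sq power_divide using q by (simp add: diff_divide_distrib)
  qed
  have w_le: "w (Suc j) c \<le> 2" if "c \<noteq> 0" for j c using w_rec[OF that] by simp
  define \<delta> where "\<delta> = \<bar>w 0 1\<bar> - 2"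
  have "\<delta> > 0"
  proof -
    have "norm (kloosterman 1 \<psi> a) = \<bar>k 0 1\<bar>" using kr[of 1 0] by simp
    then show ?thesis
      using neg q unfolding kloosterman_sum_one \<delta>_def by (simp add: w_def field_simps)
  qed
  \<comment> \<open>Linear growth is enough. If \<bar>w\<bar> \<ge> 2 + u with u \<ge> \<delta>,
    then w^2 - 2 \<ge> 2 + 4 u, which covers the next multiple of \<delta>.\<close>
  have grow: "\<bar>w j 1\<bar> \<ge> 2 + real (j + 1) * \<delta>" for j
  proof (induction j)
    case 0 then show ?case by (simp add: \<delta>_def)
  next
    case (Suc j)
    let ?u = "real (j + 1) * \<delta>"
    have u: "?u \<ge> \<delta>" using mult_right_mono[of 1 "real (j + 1)" \<delta>] \<open>\<delta> > 0\<close> by simp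
    then have "0 \<le> 2 + ?u" using \<open>\<delta> > 0\<close> by linarith
    from power_mono[OF Suc this] have "(2 + ?u)\<^sup>2 \<le> \<bar>w j 1\<bar>\<^sup>2" .
    moreover have "(2 + ?u)\<^sup>2 = 4 + 4 * ?u + ?u\<^sup>2" by (simp add: power2_eq_square algebra_simps)
    ultimately have "(w j 1)\<^sup>2 \<ge> 4 + 4 * ?u" using zero_le_power2[of ?u] by (simp only: power2_abs)
    moreover have "real (Suc j + 1) * \<delta> = ?u + \<delta>" by (simp add: algebra_simps)
    moreover have "w (Suc j) 1 = 2 - (w j 1)\<^sup>2" by (simp add: w_rec)
    ultimately show ?case using u \<open>\<delta> > 0\<close> by linarith
  qed
  \<comment> \<open>The count gives a total of at least R^2 - 4 q R - 4 q. Here c = 0 accounts for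
    R^2 - 1 and the characters other than 0 and 1 for at most 2 q R together, by
    \<open>w_le\<close>. What remains for c = 1 is at least -(4 q R + 4 q + 2 q R) \<ge> -10 q
    R.\<close>
  have low: "w (Suc j) 1 \<ge> - 10 * ?q" if j: "j \<ge> 1" for j
  proof -
    define h where "h = (2::nat) ^ j"
    define R where "R = ?q ^ h"
    have h: "h \<ge> 2" using j self_le_power[of 2 j] by (simp add: h_def)
    have R: "R > 0" "R \<ge> ?q" using q h self_le_power[of ?q h] by (auto simp: R_def)
    have wR: "w (Suc j) c = k (Suc j) c / R" for c unfolding w_def sq R_def h_def ..
    have "kloosterman (2 * h) (\<lambda>x. \<psi> (0 * x)) a = of_nat (card (fixed_field (2 * h) - {0 :: 'a alg_closure}))"
      by (simp add: kloosterman_def lift_char_def additive_character_0[OF psi])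
    also have "card (fixed_field (2 * h) - {0 :: 'a alg_closure}) = CARD('a) ^ (2 * h) - 1"
      using card_fixed_field[of "2 * h", where ?'a = 'a] h fixed_field_0_1(1)[of "2 * h", where ?'a = 'a]
      by (simp add: card_Diff_singleton)
    finally have k0: "k (Suc j) 0 = R * R - 1"
      using CARD_field_ge_2[where ?'a = 'a]
      by (simp add: k_def h_def[symmetric] R_def of_nat_diff mult_2 power_add)
    have "(\<Sum>c\<in>UNIV. k (Suc j) c) = Re (\<Sum>c\<in>UNIV. kloosterman (2 * h) (\<lambda>x. \<psi> (c * x)) a)"
      by (simp add: k_def h_def)
    also have "\<dots> = real (CARD('a) * card (trace_zero_set (2 * h) a))"
      using sum_kloosterman[OF psi, of "2 * h" a] h by simp
    finally have tot: "(\<Sum>c\<in>UNIV. k (Suc j) c) = \<dots>" .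
    have "real (CARD('a) ^ h * CARD('a) ^ h)
        \<le> real (CARD('a) * card (trace_zero_set (2 * h) a) + 4 * CARD('a) * CARD('a) ^ h + 4 * CARD('a))"
      using card_trace_zero_lower[OF odd a h] by (simp only: of_nat_le_iff)
    then have "R * R \<le> (\<Sum>c\<in>UNIV. k (Suc j) c) + 4 * ?q * R + 4 * ?q" by (simp add: tot R_def)
    moreover have "(\<Sum>c\<in>UNIV. k (Suc j) c) = k (Suc j) 0 + (k (Suc j) 1 + (\<Sum>c\<in>UNIV - {0, 1}. k (Suc j) c))"
      by (simp add: sum.remove[of UNIV 0] sum.remove[of "UNIV - {0}" 1] insert_commute flip: Diff_insert)
    moreover have "(\<Sum>c\<in>UNIV - {0, 1}. k (Suc j) c) \<le> (\<Sum>c\<in>UNIV - {0, 1 :: 'a}. 2 * R)"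
    proof (intro sum_mono)
      fix c :: 'a assume "c \<in> UNIV - {0, 1}"
      then show "k (Suc j) c \<le> 2 * R"
        using w_le[of c j] R by (simp add: wR field_simps)
    qed
    moreover have "(\<Sum>c\<in>UNIV - {0, 1 :: 'a}. 2 * R) \<le> 2 * ?q * R"
      using R by (simp add: card_Diff_subset)
    moreover have "?q \<le> ?q * R" using q R by (simp add: mult_le_cancel_left1)
    ultimately have "k (Suc j) 1 \<ge> - 10 * ?q * R" using k0 by linarith
    then show ?thesis using R by (simp add: wR field_simps)
  qed
  obtain j :: nat where j: "real j > 10 * ?q / \<delta>" using reals_Archimedean2 by blast
  then have j1: "j \<ge> 1" using q \<open>\<delta> > 0\<close> by (cases j) (auto simp: field_simps)
  have "real j * \<delta> > 10 * ?q" using j \<open>\<delta> > 0\<close> by (simp add: field_simps)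
  moreover have "real (Suc j + 1) * \<delta> \<ge> real j * \<delta>" using \<open>\<delta> > 0\<close> by simp
  moreover note grow[of "Suc j"] low[OF j1] w_le[of 1 j]
  ultimately show False using q by simp
qed

section \<open>Gauss and Salie sums\<close>

definition nonzero_squares :: "'a::field set" where
  "nonzero_squares = (\<lambda>c. c\<^sup>2) ` (UNIV - {0})"

lemma card_nonzero_squares:
  assumes odd: "odd CARD('a::{field,finite})"
  shows "2 * card (nonzero_squares :: 'a set) = CARD('a) - 1"
proof -
  have "(\<Sum>c\<in>UNIV - {0::'a}. (1::complex)) = (\<Sum>h\<in>nonzero_squares. of_nat (card {c \<in> UNIV - {0::'a}. c\<^sup>2 = h}) * 1)"
    by (rule sum_over_fibres[where g = "\<lambda>c. c\<^sup>2" and f = "\<lambda>_. 1"]) (auto simp: nonzero_squares_def)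
  also have "\<dots> = (\<Sum>h\<in>(nonzero_squares :: 'a set). 2)"
  proof (intro sum.cong refl)
    fix h :: 'a assume "h \<in> nonzero_squares"
    then obtain c where c: "c \<noteq> 0" "h = c\<^sup>2" by (auto simp: nonzero_squares_def)
    then have "{c \<in> UNIV - {0::'a}. c\<^sup>2 = h} = {c, - c}" by (auto simp: power2_eq_iff)
    moreover have "c \<noteq> - c"
    proof
      assume "c = - c"
      then have "2 * c = 0" by (metis add.right_inverse mult_2)
      then show False using c two_neq_0_finite_field(1)[OF odd] by simp
    qed
    ultimately show "of_nat (card {c \<in> UNIV - {0::'a}. c\<^sup>2 = h}) * 1 = (2::complex)" by simp
  qed
  finally have "of_nat (CARD('a) - 1) = (of_nat (2 * card (nonzero_squares :: 'a set)) :: complex)"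
    by (simp add: card_Diff_singleton mult.commute)
  then show ?thesis by (simp only: of_nat_eq_iff)
qed

text \<open>The nonzero squares and their multiples by \<nu> are disjoint sets of (q-1)/2 elements
  each, hence exhaust the nonzero elements.\<close>

lemma nonsquare_mult_square:
  fixes \<nu> s :: "'a::{field,finite}"
  assumes odd: "odd CARD('a)" and nu: "\<nu> \<noteq> 0" "\<nu> \<notin> nonzero_squares" and s: "s \<noteq> 0" "s \<notin> nonzero_squares"
  shows "\<exists>c. c \<noteq> 0 \<and> s = \<nu> * c\<^sup>2"
proof -
  let ?H = "nonzero_squares :: 'a set"
  have "?H \<inter> (*) \<nu> ` ?H = {}"
  proof (rule ccontr)
    assume "?H \<inter> (*) \<nu> ` ?H \<noteq> {}"
    then obtain c e where "c \<noteq> 0" "e \<noteq> 0" "c\<^sup>2 = \<nu> * e\<^sup>2" by (auto simp: nonzero_squares_def)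
    then have "\<nu> = (c / e)\<^sup>2" by (simp add: power_divide)
    moreover have "c / e \<noteq> 0" using \<open>c \<noteq> 0\<close> \<open>e \<noteq> 0\<close> by simp
    ultimately show False using nu(2) by (auto simp: nonzero_squares_def)
  qed
  then have "card (?H \<union> (*) \<nu> ` ?H) = card ?H + card ?H"
    using nu by (subst card_Un_disjoint) (auto simp: card_image inj_on_def)
  also have "\<dots> = card (UNIV - {0::'a})"
    using card_nonzero_squares[OF odd] by (simp add: card_Diff_singleton)
  finally have "?H \<union> (*) \<nu> ` ?H = UNIV - {0}"
    using nu by (intro card_subset_eq) (auto simp: nonzero_squares_def)
  then have "s \<in> (*) \<nu> ` ?H" using s by blast
  then show ?thesis by (auto simp: nonzero_squares_def)
qed

text \<open>The sets of all u^2 and of all s - v^2 have (q+1)/2 elements each, so they meet.\<close>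

lemma sum_two_squares:
  fixes s :: "'a::{field,finite}"
  assumes odd: "odd CARD('a)"
  shows "\<exists>u v. s = u\<^sup>2 + v\<^sup>2"
proof -
  let ?S = "insert 0 (nonzero_squares :: 'a set)"
  have "2 * card ?S = CARD('a) + 1"
  proof -
    have "(0::'a) \<notin> nonzero_squares" by (auto simp: nonzero_squares_def)
    then show ?thesis
      using card_nonzero_squares[OF odd] CARD_field_ge_2[where ?'a = 'a] by simp
  qed
  moreover have "card ((\<lambda>x. s - x) ` ?S) = card ?S" by (rule card_image) (simp add: inj_on_def)
  moreover have "card (?S \<union> (\<lambda>x. s - x) ` ?S) \<le> CARD('a)" by (rule card_mono) auto
  ultimately have "card (?S \<inter> (\<lambda>x. s - x) ` ?S) > 0"
    using card_Un_Int[of ?S "(\<lambda>x. s - x) ` ?S"] by simp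
  then have "?S \<inter> (\<lambda>x. s - x) ` ?S \<noteq> {}" by (metis card.empty less_irrefl)
  then obtain x y where xy: "x \<in> ?S" "y \<in> ?S" "x = s - y" by blast
  have "\<exists>u. x = u\<^sup>2" if "x \<in> ?S" for x
    using that by (auto simp: nonzero_squares_def intro: exI[of _ 0])
  then obtain u v where "x = u\<^sup>2" "y = v\<^sup>2" using xy by blast
  then have "s = u\<^sup>2 + v\<^sup>2" using xy(3) by (simp add: algebra_simps)
  then show ?thesis by blast
qed

definition gauss_sum :: "('a::{field,finite} \<Rightarrow> complex) \<Rightarrow> 'a \<Rightarrow> complex" where
  "gauss_sum \<psi> s = (\<Sum>y\<in>UNIV. \<psi> (s * y\<^sup>2))"

text \<open>The value at 0 is -1 rather than the customary 0, which makes the modulus 1 everywhere;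
  the sums below range over nonzero arguments.\<close>

definition quadratic_character :: "'a::field \<Rightarrow> complex" where
  "quadratic_character s = (if s \<in> nonzero_squares then 1 else - 1)"

lemma norm_quadratic_character: "norm (quadratic_character s) = 1"
  by (simp add: quadratic_character_def)

lemma gauss_sum_scale:
  fixes s c :: "'a::{field,finite}"
  assumes "c \<noteq> 0" shows "gauss_sum \<psi> (s * c\<^sup>2) = gauss_sum \<psi> s"
  unfolding gauss_sum_def
  by (rule sum.reindex_bij_witness[of _ "\<lambda>y. y / c" "\<lambda>y. c * y"])
    (use assms in \<open>auto simp: power_mult_distrib mult.assoc\<close>)

text \<open>By scaling, the Gauss sum is constant on squares and on nonsquares. Its total over all x
  is q by orthogonality, which is also its value at x = 0, so the two constants add up to
  zero.\<close>

lemma gauss_sum_quadratic_character: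
  fixes \<psi> :: "'a::{field,finite} \<Rightarrow> complex"
  assumes odd: "odd CARD('a)" and psi: "additive_character \<psi>" and s: "s \<noteq> 0"
  shows "gauss_sum \<psi> s = quadratic_character s * gauss_sum \<psi> 1"
proof (cases "s \<in> nonzero_squares")
  case True
  then show ?thesis using gauss_sum_scale[of _ \<psi> 1] by (auto simp: quadratic_character_def nonzero_squares_def)
next
  case False
  let ?H = "nonzero_squares :: 'a set"
  have "gauss_sum \<psi> x = gauss_sum \<psi> 1" if "x \<in> ?H" for x
    using that gauss_sum_scale[of _ \<psi> 1] by (auto simp: nonzero_squares_def)
  moreover have "gauss_sum \<psi> x = gauss_sum \<psi> s" if "x \<in> (UNIV - {0}) - ?H" for x
    using nonsquare_mult_square[OF odd s False, of x] that gauss_sum_scale[of _ \<psi> s] by auto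
  moreover have H: "?H \<subseteq> UNIV - {0}" by (auto simp: nonzero_squares_def)
  then have "(\<Sum>x\<in>UNIV - {0}. gauss_sum \<psi> x) = (\<Sum>x\<in>(UNIV - {0}) - ?H. gauss_sum \<psi> x) + (\<Sum>x\<in>?H. gauss_sum \<psi> x)"
    by (intro sum.subset_diff) auto
  moreover have "card ((UNIV - {0}) - ?H) = card ?H"
    using card_nonzero_squares[OF odd] H by (simp add: card_Diff_subset card_Diff_singleton)
  ultimately have "(\<Sum>x\<in>UNIV - {0}. gauss_sum \<psi> x) = of_nat (card ?H) * (gauss_sum \<psi> s + gauss_sum \<psi> 1)"
    by (simp add: distrib_left)
  moreover have "(\<Sum>x\<in>UNIV - {0}. gauss_sum \<psi> x) = 0"
  proof -
    have "(\<Sum>x\<in>UNIV. gauss_sum \<psi> x) = (\<Sum>y\<in>UNIV. \<Sum>x\<in>UNIV. \<psi> (y\<^sup>2 * x))"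
      unfolding gauss_sum_def by (subst sum.swap) (simp add: mult.commute)
    also have "\<dots> = gauss_sum \<psi> 0"
      by (simp add: sum_additive_character[OF psi] gauss_sum_def additive_character_0[OF psi])
    finally show ?thesis by (simp add: sum_diff1)
  qed
  moreover have "1 \<in> ?H" by (auto simp: nonzero_squares_def image_iff intro: bexI[of _ 1])
  then have "card ?H \<noteq> 0" by (metis card_eq_0_iff empty_iff finite)
  ultimately have "gauss_sum \<psi> s + gauss_sum \<psi> 1 = 0" by simp
  then show ?thesis using False by (simp add: quadratic_character_def add_eq_0_iff2)
qed

lemma quadratic_character_divide:
  fixes s \<nu> :: "'a::{field,finite}"
  assumes odd: "odd CARD('a)" and "s \<noteq> 0" "\<nu> \<noteq> 0"
  shows "quadratic_character (s / \<nu>) = quadratic_character s * quadratic_character \<nu>"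
proof -
  have sq: "x / c\<^sup>2 \<in> nonzero_squares \<longleftrightarrow> x \<in> nonzero_squares" if "c \<noteq> 0" for x c :: 'a
  proof
    assume "x / c\<^sup>2 \<in> nonzero_squares"
    then obtain e where "e \<noteq> 0" "x / c\<^sup>2 = e\<^sup>2" by (auto simp: nonzero_squares_def)
    then have "x = (e * c)\<^sup>2" "e * c \<noteq> 0" using that by (auto simp: field_simps)
    then show "x \<in> nonzero_squares" by (auto simp: nonzero_squares_def)
  next
    assume "x \<in> nonzero_squares"
    then obtain e where "e \<noteq> 0" "x = e\<^sup>2" by (auto simp: nonzero_squares_def)
    then have "x / c\<^sup>2 = (e / c)\<^sup>2" "e / c \<noteq> 0" using that by (auto simp: power_divide)
    then show "x / c\<^sup>2 \<in> nonzero_squares" by (auto simp: nonzero_squares_def)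
  qed
  have inv: "1 / x \<in> nonzero_squares \<longleftrightarrow> x \<in> nonzero_squares" if "x \<noteq> 0" for x :: 'a
    using sq[OF that, of x] that by (simp add: power2_eq_square)
  show ?thesis
  proof (cases "\<nu> \<in> nonzero_squares")
    case True
    then show ?thesis using sq by (auto simp: quadratic_character_def nonzero_squares_def)
  next
    case nF: False
    show ?thesis
    proof (cases "s \<in> nonzero_squares")
      case True
      then obtain e where e: "e \<noteq> 0" "s = e\<^sup>2" by (auto simp: nonzero_squares_def)
      have "\<nu> / e\<^sup>2 \<notin> nonzero_squares" using sq[OF e(1)] nF by simp
      then have "1 / (\<nu> / e\<^sup>2) \<notin> nonzero_squares" using inv[of "\<nu> / e\<^sup>2"] e assms by simp
      then show ?thesis using True nF e by (simp add: quadratic_character_def)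
    next
      case False
      obtain c where "c \<noteq> 0" "s = \<nu> * c\<^sup>2" using nonsquare_mult_square[OF odd assms(3) nF assms(2) False] by blast
      then show ?thesis using nF False assms by (auto simp: quadratic_character_def nonzero_squares_def)
    qed
  qed
qed

lemma norm_gauss_sum:
  fixes \<psi> :: "'a::{field,finite} \<Rightarrow> complex"
  assumes odd: "odd CARD('a)" and psi: "additive_character \<psi>" and s: "s \<noteq> 0"
  shows "norm (gauss_sum \<psi> s) = sqrt (real CARD('a))"
proof -
  have "gauss_sum \<psi> s * cnj (gauss_sum \<psi> s) = (\<Sum>z\<in>UNIV. \<Sum>y\<in>UNIV. \<psi> (s * y\<^sup>2 - s * z\<^sup>2))"
    unfolding gauss_sum_def cnj_sum sum_product
    by (subst sum.swap) (simp add: additive_character_cnj[OF psi] additive_character_add[OF psi, symmetric])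
  \<comment> \<open>The substitution y = h + z makes the exponent linear in z, so that summing over
    z leaves only h = 0.\<close>
  also have "\<dots> = (\<Sum>z\<in>UNIV. \<Sum>h\<in>UNIV. \<psi> (s * h\<^sup>2) * \<psi> ((2 * s * h) * z))"
  proof (rule sum.cong[OF refl])
    fix z :: 'a
    show "(\<Sum>y\<in>UNIV. \<psi> (s * y\<^sup>2 - s * z\<^sup>2)) = (\<Sum>h\<in>UNIV. \<psi> (s * h\<^sup>2) * \<psi> ((2 * s * h) * z))"
      by (rule sum.reindex_bij_witness[of _ "\<lambda>h. h + z" "\<lambda>y. y - z"])
        (auto simp: additive_character_add[OF psi, symmetric] power2_eq_square algebra_simps)
  qed
  also have "\<dots> = (\<Sum>h\<in>UNIV. \<psi> (s * h\<^sup>2) * (\<Sum>z\<in>UNIV. \<psi> ((2 * s * h) * z)))"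
    by (subst sum.swap) (simp add: sum_distrib_left)
  also have "\<dots> = (\<Sum>h\<in>(UNIV :: 'a set). if h = 0 then of_nat CARD('a) else 0)"
    by (intro sum.cong refl)
      (use s two_neq_0_finite_field(1)[OF odd] in \<open>auto simp: sum_additive_character[OF psi] additive_character_0[OF psi]\<close>)
  also have "\<dots> = of_real (real CARD('a))" by simp
  finally have "(norm (gauss_sum \<psi> s))\<^sup>2 = real CARD('a)"
    unfolding complex_norm_square[symmetric] of_real_eq_iff .
  then show ?thesis by (metis norm_ge_zero real_sqrt_unique)
qed

text \<open>
  Multiplying by a Gauss sum and completing the square turns the sum over \<open>s\<close> into a complete
  character sum, which detects the at most two solutions of \<open>y\<^sup>2 = - \<alpha> \<nu>\<close>.
\<close>

lemma salie_bound:
  fixes \<psi> :: "'a::{field,finite} \<Rightarrow> complex"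
  assumes odd: "odd CARD('a)" and psi: "additive_character \<psi>"
  shows "norm (\<Sum>s\<in>UNIV - {0}. quadratic_character s * \<psi> (\<alpha> * s + \<beta> / s)) \<le> 2 * sqrt (real CARD('a))"
    (is "norm ?S \<le> _")
proof (cases "\<beta> = 0")
  case True
  \<comment> \<open>Without the term \<beta> / s there is no square to complete: multiplying by the
    Gauss sum already turns the sum over s into a count of the y with y^2 = -\<alpha>.\<close>
  have "gauss_sum \<psi> 1 * ?S = (\<Sum>s\<in>UNIV - {0}. \<psi> (\<alpha> * s) * gauss_sum \<psi> s)"
    unfolding sum_distrib_left
  proof (intro sum.cong refl)
    fix s :: 'a assume "s \<in> UNIV - {0}"
    then show "gauss_sum \<psi> 1 * (quadratic_character s * \<psi> (\<alpha> * s + \<beta> / s)) = \<psi> (\<alpha> * s) * gauss_sum \<psi> s"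
      using True gauss_sum_quadratic_character[OF odd psi, of s] by simp
  qed
  also have "\<dots> = (\<Sum>s\<in>UNIV. \<psi> (\<alpha> * s) * gauss_sum \<psi> s) - gauss_sum \<psi> 0"
    by (simp add: sum_diff1 additive_character_0[OF psi])
  also have "(\<Sum>s\<in>UNIV. \<psi> (\<alpha> * s) * gauss_sum \<psi> s) = (\<Sum>y\<in>UNIV. \<Sum>s\<in>UNIV. \<psi> ((\<alpha> + y\<^sup>2) * s))"
    unfolding gauss_sum_def sum_distrib_left
    by (subst sum.swap) (simp add: additive_character_add[OF psi] distrib_right mult.commute[of "_\<^sup>2"])
  also have "\<dots> = of_nat (CARD('a) * card {y::'a. \<alpha> + y\<^sup>2 = 0})"
    by (simp add: sum_additive_character[OF psi] sum.If_cases mult.commute[of "of_nat CARD('a)"])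
  also have "gauss_sum \<psi> 0 = of_nat CARD('a)" by (simp add: gauss_sum_def additive_character_0[OF psi])
  finally have e: "gauss_sum \<psi> 1 * ?S = of_nat CARD('a) * (of_nat (card {y::'a. \<alpha> + y\<^sup>2 = 0}) - 1)"
    by (simp add: right_diff_distrib)
  have "card {y::'a. \<alpha> + y\<^sup>2 = 0} \<le> 2"
  proof (cases "\<exists>y::'a. \<alpha> + y\<^sup>2 = 0")
    case T: True
    then obtain y where y: "\<alpha> + y\<^sup>2 = 0" by blast
    have "z\<^sup>2 = y\<^sup>2" if "\<alpha> + z\<^sup>2 = 0" for z
      using y that by (metis add_left_cancel)
    then have "{z. \<alpha> + z\<^sup>2 = 0} \<subseteq> {y, - y}" by (auto simp: power2_eq_iff)
    from card_mono[OF _ this] show ?thesis by (rule order_trans) (auto simp: card_insert_if)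
  qed simp
  then consider "card {y::'a. \<alpha> + y\<^sup>2 = 0} = 0" | "card {y::'a. \<alpha> + y\<^sup>2 = 0} = 1" | "card {y::'a. \<alpha> + y\<^sup>2 = 0} = 2"
    by linarith
  then have "norm (of_nat (card {y::'a. \<alpha> + y\<^sup>2 = 0}) - 1 :: complex) \<le> 1"
    by cases (simp_all only: of_nat_0 of_nat_1, simp_all)
  then have "norm (gauss_sum \<psi> 1 * ?S) \<le> real CARD('a) * 1"
    unfolding e norm_mult by (intro mult_mono) auto
  then have "sqrt (real CARD('a)) * norm ?S \<le> sqrt (real CARD('a)) * sqrt (real CARD('a))"
    by (simp add: norm_mult norm_gauss_sum[OF odd psi])
  then have "norm ?S \<le> sqrt (real CARD('a))" by (rule mult_left_le_imp_le) simp
  then show ?thesis by (smt (verit) real_sqrt_ge_zero of_nat_0_le_iff)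
next
  case False
  \<comment> \<open>With this sign, (s/\<nu>) (y + \<nu>/s)^2 + \<beta>/s = (s/\<nu>) y^2 + 2 y: the
    terms in 1/s cancel and the cross term is free of s.\<close>
  define \<nu> where "\<nu> = - \<beta>"
  have nu: "\<nu> \<noteq> 0" using False by (simp add: \<nu>_def)
  let ?A = "{y. \<alpha> + y\<^sup>2 / \<nu> = 0}"
  have cs: "\<psi> (\<beta> / s) * gauss_sum \<psi> (s / \<nu>) = (\<Sum>y\<in>UNIV. \<psi> ((s / \<nu>) * y\<^sup>2 + 2 * y))" if s: "s \<noteq> 0" for s
  proof -
    have "(s / \<nu>) * (y + \<nu> / s)\<^sup>2 = (s / \<nu>) * y\<^sup>2 + 2 * y + \<nu> / s" for y
      using s nu by (simp add: power2_eq_square field_simps)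
    then have "(s / \<nu>) * y\<^sup>2 + 2 * y = \<beta> / s + (s / \<nu>) * (y + \<nu> / s)\<^sup>2" for y
      by (simp add: \<nu>_def)
    then have "(\<Sum>y\<in>UNIV. \<psi> ((s / \<nu>) * y\<^sup>2 + 2 * y)) = \<psi> (\<beta> / s) * (\<Sum>y\<in>UNIV. \<psi> ((s / \<nu>) * (y + \<nu> / s)\<^sup>2))"
      by (simp add: additive_character_add[OF psi] sum_distrib_left)
    also have "(\<Sum>y\<in>UNIV. \<psi> ((s / \<nu>) * (y + \<nu> / s)\<^sup>2)) = gauss_sum \<psi> (s / \<nu>)"
      unfolding gauss_sum_def by (rule sum.reindex_bij_witness[of _ "\<lambda>y. y - \<nu> / s" "\<lambda>y. y + \<nu> / s"]) auto
    finally show ?thesis by simp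
  qed
  have "quadratic_character \<nu> * gauss_sum \<psi> 1 * ?S
      = (\<Sum>s\<in>UNIV - {0}. \<psi> (\<alpha> * s) * (\<psi> (\<beta> / s) * gauss_sum \<psi> (s / \<nu>)))"
    unfolding sum_distrib_left
    by (intro sum.cong refl)
      (use nu in \<open>auto simp: gauss_sum_quadratic_character[OF odd psi, of "_ / \<nu>"] quadratic_character_divide[OF odd]
        additive_character_add[OF psi]\<close>)
  also have "\<dots> = (\<Sum>s\<in>UNIV - {0}. \<Sum>y\<in>UNIV. \<psi> ((\<alpha> + y\<^sup>2 / \<nu>) * s) * \<psi> (2 * y))"
    by (intro sum.cong refl)
      (simp add: cs sum_distrib_left additive_character_add[OF psi, symmetric] algebra_simps)
  also have "\<dots> = (\<Sum>y\<in>UNIV. \<psi> (2 * y) * (\<Sum>s\<in>UNIV - {0}. \<psi> ((\<alpha> + y\<^sup>2 / \<nu>) * s)))"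
    by (subst sum.swap) (simp add: sum_distrib_left mult.commute)
  also have "\<dots> = (\<Sum>y\<in>UNIV. \<psi> (2 * y) * ((if \<alpha> + y\<^sup>2 / \<nu> = 0 then of_nat CARD('a) else 0) - 1))"
    by (simp add: sum_diff1 sum_additive_character[OF psi] additive_character_0[OF psi])
  also have "\<dots> = (\<Sum>y\<in>?A. of_nat CARD('a) * \<psi> (2 * y)) - (\<Sum>y\<in>UNIV. \<psi> (2 * y))"
    unfolding right_diff_distrib sum_subtractf
    by (simp add: if_distrib[of "\<lambda>x. _ * x"] sum.If_cases mult.commute cong: if_cong)
  also have "(\<Sum>y\<in>UNIV. \<psi> (2 * y)) = 0"
    using two_neq_0_finite_field(1)[OF odd] by (simp add: sum_additive_character[OF psi])
  finally have "norm (quadratic_character \<nu> * gauss_sum \<psi> 1 * ?S) \<le> real CARD('a) * real (card ?A)"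
    using norm_sum[of "\<lambda>y. of_nat CARD('a) * \<psi> (2 * y)" ?A]
    by (simp add: norm_mult additive_character_norm[OF psi] mult.commute)
  also have "card ?A \<le> 2"
  proof (cases "\<exists>y. y \<in> ?A")
    case True
    then obtain y where y: "\<alpha> + y\<^sup>2 / \<nu> = 0" by blast
    have "z\<^sup>2 = y\<^sup>2" if "\<alpha> + z\<^sup>2 / \<nu> = 0" for z
      using y that nu by (simp add: field_simps add_eq_0_iff)
    then have "?A \<subseteq> {y, - y}" by (auto simp: power2_eq_iff)
    then have "card ?A \<le> card {y, - y}" by (intro card_mono) auto
    then show ?thesis by (auto simp: card_insert_if split: if_splits)
  qed auto
  finally have "sqrt (real CARD('a)) * norm ?S \<le> real CARD('a) * 2"
    by (simp add: norm_mult norm_gauss_sum[OF odd psi] norm_quadratic_character)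
  also have "\<dots> = sqrt (real CARD('a)) * (2 * sqrt (real CARD('a)))" by simp
  finally have "sqrt (real CARD('a)) * norm ?S \<le> sqrt (real CARD('a)) * (2 * sqrt (real CARD('a)))" .
  then show ?thesis by (rule mult_left_le_imp_le) simp
qed

section \<open>Norm bounds for distance operators\<close>

text \<open>Absorbing \<alpha> into the character reduces to the normal form s + a/s. The case
  \<beta> = 0, where the sum is -1, is needed for frequencies at which the quadratic form
  vanishes.\<close>

lemma twisted_kloosterman_bound:
  fixes \<psi> :: "'a::{field,finite} \<Rightarrow> complex"
  assumes odd: "odd CARD('a)" and psi: "additive_character \<psi>" and al: "\<alpha> \<noteq> 0"
  shows "norm (\<Sum>s\<in>UNIV - {0}. \<psi> (\<alpha> * s + \<beta> / s)) \<le> 2 * sqrt (real CARD('a))"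
proof (cases "\<beta> = 0")
  case True
  have "norm (\<Sum>s\<in>UNIV - {0}. \<psi> (\<alpha> * s + \<beta> / s)) = 1"
    using True al by (simp add: sum_diff1 sum_additive_character[OF psi] additive_character_0[OF psi])
  moreover have "1 \<le> sqrt (real CARD('a))"
    by (rule real_sqrt_ge_one) (use CARD_field_ge_2[where ?'a = 'a] in simp)
  ultimately show ?thesis by linarith
next
  case False
  have "(\<Sum>s\<in>UNIV - {0}. \<psi> (\<alpha> * s + \<beta> / s)) = (\<Sum>s\<in>UNIV - {0}. \<psi> (\<alpha> * (s + (\<beta> / \<alpha>) / s)))"
    using al by (simp add: distrib_left)
  then show ?thesis
    using kloosterman_bound[OF odd additive_character_scale[OF psi al], of "\<beta> / \<alpha>"] False al by simp
qed

section \<open>Fourier analysis with a nondegenerate bilinear form\<close>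

lemma bilinear_formD:
  assumes "bilinear_form B"
  shows "B (x + y) z = B x z + B y z" "B x (y + z) = B x y + B x z"
    "B (c *s x) y = c * B x y" "B x (c *s y) = c * B x y"
    "B 0 y = 0" "B x 0 = 0" "B (x - y) z = B x z - B y z" "B x (y - z) = B x y - B x z"
proof -
  have r: "Vector_Spaces.linear (*s) (*) (\<lambda>y. B x y)" and l: "Vector_Spaces.linear (*s) (*) (\<lambda>x. B x y)" for x y
    using assms by (auto simp: bilinear_form_def)
  show "B (x + y) z = B x z + B y z" "B x (y + z) = B x y + B x z"
    "B (c *s x) y = c * B x y" "B x (c *s y) = c * B x y"
    "B 0 y = 0" "B x 0 = 0" "B (x - y) z = B x z - B y z" "B x (y - z) = B x y - B x z"
    using module_hom.add[OF Vector_Spaces.linear.axioms(3)[OF l]] module_hom.add[OF Vector_Spaces.linear.axioms(3)[OF r]]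
      module_hom.scale[OF Vector_Spaces.linear.axioms(3)[OF l]] module_hom.scale[OF Vector_Spaces.linear.axioms(3)[OF r]]
      module_hom.zero[OF Vector_Spaces.linear.axioms(3)[OF l]] module_hom.zero[OF Vector_Spaces.linear.axioms(3)[OF r]]
      module_hom.diff[OF Vector_Spaces.linear.axioms(3)[OF l]] module_hom.diff[OF Vector_Spaces.linear.axioms(3)[OF r]]
    by auto
qed

lemma sum_character_bilinear:
  fixes B :: "'a::{field,finite} ^ 'd::finite \<Rightarrow> 'a ^ 'd \<Rightarrow> 'a"
  assumes psi: "additive_character \<psi>" and B: "nondegenerate_bilinear_form B"
  shows "(\<Sum>m\<in>UNIV. \<psi> (B m x)) = (if x = 0 then of_nat (CARD('a) ^ CARD('d)) else 0)"
    "(\<Sum>m\<in>UNIV. \<psi> (B x m)) = (if x = 0 then of_nat (CARD('a) ^ CARD('d)) else 0)"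
proof -
  have bB: "bilinear_form B" using B by (simp add: nondegenerate_bilinear_form_def)
  note BD = bilinear_formD[OF bB]
  obtain c where c: "\<psi> c \<noteq> 1" using psi by (auto simp: additive_character_def)
  have "(\<Sum>m\<in>UNIV. \<psi> (B m x)) = 0" if "x \<noteq> 0"
  proof -
    obtain m where m: "B m x \<noteq> 0" using B \<open>x \<noteq> 0\<close> by (auto simp: nondegenerate_bilinear_form_def)
    have ne: "\<psi> (B ((c / B m x) *s m) x) \<noteq> 1" using c m by (simp add: BD)
    show ?thesis
      by (rule character_sum_eq_0[where f = "\<lambda>m. \<psi> (B m x)", OF _ _ UNIV_I ne]) (auto simp: add_subgroup_def BD additive_character_add[OF psi])
  qed
  then show "(\<Sum>m\<in>UNIV. \<psi> (B m x)) = (if x = 0 then of_nat (CARD('a) ^ CARD('d)) else 0)"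
    by (simp add: BD additive_character_0[OF psi])
  have "(\<Sum>m\<in>UNIV. \<psi> (B x m)) = 0" if "x \<noteq> 0"
  proof -
    obtain m where m: "B x m \<noteq> 0" using B \<open>x \<noteq> 0\<close> by (auto simp: nondegenerate_bilinear_form_def)
    have ne: "\<psi> (B x ((c / B x m) *s m)) \<noteq> 1" using c m by (simp add: BD)
    show ?thesis
      by (rule character_sum_eq_0[where f = "\<lambda>m. \<psi> (B x m)", OF _ _ UNIV_I ne]) (auto simp: add_subgroup_def BD additive_character_add[OF psi])
  qed
  then show "(\<Sum>m\<in>UNIV. \<psi> (B x m)) = (if x = 0 then of_nat (CARD('a) ^ CARD('d)) else 0)"
    by (simp add: BD additive_character_0[OF psi])
qed

lemma parseval:
  fixes K :: "'m::finite \<Rightarrow> 'x::finite \<Rightarrow> complex" and f :: "'x \<Rightarrow> complex"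
  assumes orth: "\<And>x y. (\<Sum>m\<in>UNIV. K m x * cnj (K m y)) = (if x = y then of_real C else 0)"
  shows "(\<Sum>m\<in>UNIV. (norm (\<Sum>x\<in>UNIV. f x * K m x))\<^sup>2) = C * (\<Sum>x\<in>UNIV. (norm (f x))\<^sup>2)"
proof -
  have "complex_of_real (\<Sum>m\<in>UNIV. (norm (\<Sum>x\<in>UNIV. f x * K m x))\<^sup>2)
      = (\<Sum>m\<in>UNIV. \<Sum>x\<in>UNIV. \<Sum>y\<in>UNIV. f x * cnj (f y) * (K m x * cnj (K m y)))"
    unfolding of_real_sum complex_norm_square cnj_sum sum_product by (simp add: mult_ac)
  also have "\<dots> = (\<Sum>x\<in>UNIV. \<Sum>y\<in>UNIV. f x * cnj (f y) * (\<Sum>m\<in>UNIV. K m x * cnj (K m y)))"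
    unfolding sum_distrib_left
    by (subst sum.swap, rule sum.cong[OF refl], subst sum.swap) (rule refl)
  also have "\<dots> = (\<Sum>x\<in>UNIV. f x * cnj (f x) * of_real C)"
    unfolding orth by (simp add: if_distrib[of "\<lambda>x. _ * x"] sum.delta cong: if_cong)
  also have "\<dots> = of_real (C * (\<Sum>x\<in>UNIV. (norm (f x))\<^sup>2))"
    unfolding of_real_mult of_real_sum complex_norm_square sum_distrib_left by (simp add: mult.commute)
  finally show ?thesis by (simp only: of_real_eq_iff)
qed

text \<open>The form itself pairs points with frequencies. For a quadratic form the pairing will be
  its polar form, so that Fourier coefficients are expressed through the same quadratic form instead
  of its dual.\<close>

lemma parseval_bilinear:
  fixes B :: "'a::{field,finite} ^ 'd::finite \<Rightarrow> 'a ^ 'd \<Rightarrow> 'a" and f :: "'a ^ 'd \<Rightarrow> complex"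
  assumes psi: "additive_character \<psi>" and B: "nondegenerate_bilinear_form B"
  shows "(\<Sum>m\<in>UNIV. (norm (\<Sum>x\<in>UNIV. f x * \<psi> (B m x)))\<^sup>2) = real CARD('a) ^ CARD('d) * (\<Sum>x\<in>UNIV. (norm (f x))\<^sup>2)"
proof (rule parseval)
  have bB: "bilinear_form B" using B by (simp add: nondegenerate_bilinear_form_def)
  fix x y :: "'a ^ 'd"
  have "(\<Sum>m\<in>UNIV. \<psi> (B m x) * cnj (\<psi> (B m y))) = (\<Sum>m\<in>UNIV. \<psi> (B m (x - y)))"
    by (simp add: additive_character_cnj[OF psi] additive_character_add[OF psi, symmetric] bilinear_formD[OF bB])
  then show "(\<Sum>m\<in>UNIV. \<psi> (B m x) * cnj (\<psi> (B m y))) = (if x = y then of_real (real CARD('a) ^ CARD('d)) else 0)"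
    by (simp add: sum_character_bilinear[OF psi B])
qed

lemma parseval_field:
  fixes f :: "'a::{field,finite} \<Rightarrow> complex"
  assumes psi: "additive_character \<psi>"
  shows "(\<Sum>m\<in>UNIV. (norm (\<Sum>x\<in>UNIV. f x * \<psi> (m * x)))\<^sup>2) = real CARD('a) * (\<Sum>x\<in>UNIV. (norm (f x))\<^sup>2)"
proof (rule parseval)
  fix x y :: 'a
  have "(\<Sum>m\<in>UNIV. \<psi> (m * x) * cnj (\<psi> (m * y))) = (\<Sum>m\<in>UNIV. \<psi> ((x - y) * m))"
    by (simp add: additive_character_cnj[OF psi] additive_character_add[OF psi, symmetric] algebra_simps)
  then show "(\<Sum>m\<in>UNIV. \<psi> (m * x) * cnj (\<psi> (m * y))) = (if x = y then of_real (real CARD('a)) else 0)"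
    by (simp add: sum_additive_character[OF psi])
qed

text \<open>The subtracted 1/q is the contribution of s = 0 to the Fourier expansion of the
  indicator.\<close>

lemma indicator_fourier:
  fixes u t :: "'a::{field,finite}"
  assumes psi: "additive_character \<psi>"
  shows "complex_of_real (of_bool (u = t) - 1 / real CARD('a))
    = (\<Sum>s\<in>UNIV - {0}. \<psi> (- (s * t)) * \<psi> (s * u)) / of_nat CARD('a)"
proof -
  have "(\<Sum>s\<in>UNIV - {0}. \<psi> (- (s * t)) * \<psi> (s * u)) = (\<Sum>s\<in>UNIV. \<psi> ((u - t) * s)) - 1"
    by (simp add: sum_diff1 additive_character_add[OF psi, symmetric] additive_character_0[OF psi] algebra_simps)
  also have "\<dots> = (if u = t then of_nat CARD('a) else 0) - 1"
    by (simp add: sum_additive_character[OF psi])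
  finally have e: "(\<Sum>s\<in>UNIV - {0}. \<psi> (- (s * t)) * \<psi> (s * u)) = \<dots>" .
  show ?thesis unfolding e by (auto simp: field_simps)
qed

text \<open>
  Averaging over dilations \<open>x \<mapsto> c x\<close> brings in a second, one-dimensional Fourier transform,
  which saves the factor \<open>q\<close> that the triangle inequality would lose.
\<close>

lemma bilinear_operator_bound:
  fixes B :: "'a::{field,finite} ^ 'd::finite \<Rightarrow> 'a ^ 'd \<Rightarrow> 'a" and f :: "'a ^ 'd \<Rightarrow> real"
  assumes B: "nondegenerate_bilinear_form B" and t: "t \<noteq> 0"
  shows "(\<Sum>x\<in>UNIV. (\<Sum>y\<in>UNIV. (of_bool (B x y = t) - 1 / real CARD('a)) * f y)\<^sup>2)
    \<le> real CARD('a) ^ CARD('d) / real CARD('a) * (\<Sum>y\<in>UNIV. (f y)\<^sup>2)"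
proof -
  obtain \<psi> :: "'a \<Rightarrow> complex" where psi: "additive_character \<psi>" using additive_character_exists by blast
  have bB: "bilinear_form B" using B by (simp add: nondegenerate_bilinear_form_def)
  let ?q = "real CARD('a)"
  have q: "?q \<ge> 2" using CARD_field_ge_2[where ?'a = 'a] by simp
  define F where "F = (\<lambda>m. \<Sum>y\<in>UNIV. complex_of_real (f y) * \<psi> (B m y))"
  define g where "g = (\<lambda>x. \<Sum>y\<in>UNIV. (of_bool (B x y = t) - 1 / ?q) * f y)"
  define S where "S = (\<Sum>x\<in>UNIV. (g x)\<^sup>2)"
  have g: "complex_of_real (g x) = (\<Sum>s\<in>UNIV - {0}. \<psi> (- (s * t)) * F (s *s x)) / of_nat CARD('a)" for x
    unfolding g_def of_real_sum of_real_mult indicator_fourier[OF psi] F_def sum_distrib_left sum_distrib_right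
      sum_divide_distrib times_divide_eq_left
    by (subst sum.swap) (simp add: bilinear_formD[OF bB] mult_ac)
  have dil: "(\<Sum>x\<in>UNIV. h (c *s x)) = (\<Sum>x\<in>UNIV. h x)" if "c \<noteq> 0" for c and h :: "'a ^ 'd \<Rightarrow> real"
    by (rule sum.reindex_bij_witness[of _ "\<lambda>x. (1 / c) *s x" "\<lambda>x. c *s x"]) (use that in auto)
  have inner: "(\<Sum>c\<in>UNIV - {0}. (g (c *s x))\<^sup>2) \<le> (\<Sum>u\<in>UNIV - {0}. (norm (F (u *s x)))\<^sup>2) / ?q" for x
  proof -
    define h where "h = (\<lambda>u. if u = 0 then 0 else F (u *s x))"
    \<comment> \<open>Setting u = s c moves the dilation from F to the character. Its frequency -t/c
      runs over all nonzero elements along with c, because t is nonzero; adding the frequency 0 then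
      gives a full Parseval sum.\<close>
    have e: "(g (c *s x))\<^sup>2 = (norm (\<Sum>u\<in>UNIV. h u * \<psi> ((- t / c) * u)))\<^sup>2 / ?q\<^sup>2" if c: "c \<noteq> 0" for c
    proof -
      have "(\<Sum>s\<in>UNIV - {0}. \<psi> (- (s * t)) * F (s *s (c *s x))) = (\<Sum>u\<in>UNIV - {0}. \<psi> (- (u / c * t)) * F (u *s x))"
        by (rule sum.reindex_bij_witness[of _ "\<lambda>u. u / c" "\<lambda>s. s * c"]) (use c in auto)
      also have "\<dots> = (\<Sum>u\<in>UNIV - {0}. h u * \<psi> ((- t / c) * u))"
        by (intro sum.cong refl) (simp add: h_def mult.commute)
      also have "\<dots> = (\<Sum>u\<in>UNIV. h u * \<psi> ((- t / c) * u))"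
        by (rule sum.mono_neutral_left) (auto simp: h_def)
      finally have "norm (complex_of_real (g (c *s x))) = norm (\<Sum>u\<in>UNIV. h u * \<psi> ((- t / c) * u)) / ?q"
        unfolding g by (simp add: norm_divide)
      then have "\<bar>g (c *s x)\<bar> = norm (\<Sum>u\<in>UNIV. h u * \<psi> ((- t / c) * u)) / ?q" by simp
      then show ?thesis by (metis power2_abs power_divide)
    qed
    have "(\<Sum>c\<in>UNIV - {0}. (g (c *s x))\<^sup>2) = (\<Sum>c\<in>UNIV - {0}. (norm (\<Sum>u\<in>UNIV. h u * \<psi> ((- t / c) * u)))\<^sup>2 / ?q\<^sup>2)"
      by (intro sum.cong refl) (use e in auto)
    also have "\<dots> = (\<Sum>v\<in>UNIV - {0}. (norm (\<Sum>u\<in>UNIV. h u * \<psi> (v * u)))\<^sup>2 / ?q\<^sup>2)"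
      by (rule sum.reindex_bij_witness[of _ "\<lambda>v. - t / v" "\<lambda>c. - t / c"]) (use t in auto)
    also have "\<dots> \<le> (\<Sum>v\<in>UNIV. (norm (\<Sum>u\<in>UNIV. h u * \<psi> (v * u)))\<^sup>2 / ?q\<^sup>2)"
      by (rule sum_mono2) auto
    also have "\<dots> = (\<Sum>u\<in>UNIV. (norm (h u))\<^sup>2) / ?q"
      unfolding sum_divide_distrib[symmetric] parseval_field[OF psi] using q by (simp add: power2_eq_square)
    also have "(\<Sum>u\<in>UNIV. (norm (h u))\<^sup>2) = (\<Sum>u\<in>UNIV - {0}. (norm (F (u *s x)))\<^sup>2)"
      by (rule sum.mono_neutral_cong_right) (auto simp: h_def)
    finally show ?thesis .
  qed
  have "(?q - 1) * S = (\<Sum>c\<in>UNIV - {0::'a}. \<Sum>x\<in>UNIV. (g (c *s x))\<^sup>2)"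
  proof -
    have "(\<Sum>c\<in>UNIV - {0::'a}. \<Sum>x\<in>UNIV. (g (c *s x))\<^sup>2) = (\<Sum>c\<in>UNIV - {0::'a}. S)"
      unfolding S_def by (intro sum.cong refl dil[where h = "\<lambda>x. (g x)\<^sup>2"]) auto
    then show ?thesis using q by (simp add: card_Diff_singleton of_nat_diff)
  qed
  also have "\<dots> = (\<Sum>x\<in>UNIV. \<Sum>c\<in>UNIV - {0}. (g (c *s x))\<^sup>2)" by (rule sum.swap)
  also have "\<dots> \<le> (\<Sum>x\<in>UNIV. (\<Sum>u\<in>UNIV - {0}. (norm (F (u *s x)))\<^sup>2) / ?q)"
    by (intro sum_mono inner)
  also have "\<dots> = (\<Sum>u\<in>UNIV - {0::'a}. \<Sum>x\<in>UNIV. (norm (F (u *s x)))\<^sup>2) / ?q"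
    unfolding sum_divide_distrib[symmetric] by (subst sum.swap) simp
  also have "(\<Sum>u\<in>UNIV - {0::'a}. \<Sum>x\<in>UNIV. (norm (F (u *s x)))\<^sup>2) = (\<Sum>u\<in>UNIV - {0::'a}. \<Sum>x\<in>UNIV. (norm (F x))\<^sup>2)"
    by (intro sum.cong refl dil[where h = "\<lambda>x. (norm (F x))\<^sup>2"]) auto
  also have "\<dots> = (?q - 1) * (\<Sum>x\<in>UNIV. (norm (F x))\<^sup>2)"
    using q by (simp add: card_Diff_singleton of_nat_diff)
  also have "(\<Sum>x\<in>UNIV. (norm (F x))\<^sup>2) = ?q ^ CARD('d) * (\<Sum>y\<in>UNIV. (f y)\<^sup>2)"
    unfolding F_def parseval_bilinear[OF psi B] by simp
  finally have "(?q - 1) * S \<le> (?q - 1) * (?q ^ CARD('d) / ?q * (\<Sum>y\<in>UNIV. (f y)\<^sup>2))" by simp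
  then have "S \<le> ?q ^ CARD('d) / ?q * (\<Sum>y\<in>UNIV. (f y)\<^sup>2)" by (rule mult_left_le_imp_le) (use q in simp)
  then show ?thesis by (simp add: S_def g_def)
qed

section \<open>Gauss sums of quadratic forms in several variables\<close>

lemma quadratic_formD:
  assumes "quadratic_form Q"
  shows "Q (c *s x) = c\<^sup>2 * Q x" "Q (x + y) = Q x + Q y + polar_form Q x y"
    "polar_form Q x y = polar_form Q y x" "bilinear_form (polar_form Q)" "Q 0 = 0"
proof -
  show *: "Q (c *s x) = c\<^sup>2 * Q x" for c x using assms by (simp add: quadratic_form_def)
  show "Q (x + y) = Q x + Q y + polar_form Q x y" by (simp add: polar_form_def)
  show "polar_form Q x y = polar_form Q y x" by (simp add: polar_form_def add.commute)
  show "bilinear_form (polar_form Q)" using assms by (simp add: quadratic_form_def)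
  show "Q 0 = 0" using *[of 0 0] by simp
qed

definition quadratic_gauss_sum :: "('a::{field,finite} \<Rightarrow> complex) \<Rightarrow> ('a ^ 'd::finite \<Rightarrow> 'a) \<Rightarrow> 'a \<Rightarrow> complex" where
  "quadratic_gauss_sum \<psi> Q s = (\<Sum>v\<in>UNIV. \<psi> (s * Q v))"

text \<open>After the shift v = h + w the exponent s Q(v) - s Q(w) is linear in w, and nondegeneracy
  of the polar form leaves only h = 0.\<close>

lemma norm_quadratic_gauss_sum:
  fixes Q :: "'a::{field,finite} ^ 'd::finite \<Rightarrow> 'a"
  assumes psi: "additive_character \<psi>" and Q: "nondegenerate_quadratic_form Q" and s: "s \<noteq> 0"
  shows "norm (quadratic_gauss_sum \<psi> Q s) = sqrt (real CARD('a) ^ CARD('d))"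
proof -
  have qQ: "quadratic_form Q" and nB: "nondegenerate_bilinear_form (polar_form Q)"
    using Q by (auto simp: nondegenerate_quadratic_form_def)
  note QD = quadratic_formD[OF qQ]
  have "quadratic_gauss_sum \<psi> Q s * cnj (quadratic_gauss_sum \<psi> Q s) = (\<Sum>w\<in>UNIV. \<Sum>v\<in>UNIV. \<psi> (s * Q v - s * Q w))"
    unfolding quadratic_gauss_sum_def cnj_sum sum_product
    by (subst sum.swap) (simp add: additive_character_cnj[OF psi] additive_character_add[OF psi, symmetric])
  also have "\<dots> = (\<Sum>w\<in>UNIV. \<Sum>h\<in>UNIV. \<psi> (s * Q h) * \<psi> (polar_form Q w (s *s h)))"
  proof (rule sum.cong[OF refl])
    fix w :: "'a ^ 'd"
    have "s * Q (h + w) - s * Q w = s * Q h + polar_form Q w (s *s h)" for h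
      by (simp add: QD(2)[of h w] QD(3)[of h w] bilinear_formD[OF QD(4)] algebra_simps)
    then have *: "\<psi> (s * Q (h + w) - s * Q w) = \<psi> (s * Q h) * \<psi> (polar_form Q w (s *s h))" for h
      by (simp add: additive_character_add[OF psi])
    show "(\<Sum>v\<in>UNIV. \<psi> (s * Q v - s * Q w)) = (\<Sum>h\<in>UNIV. \<psi> (s * Q h) * \<psi> (polar_form Q w (s *s h)))"
      unfolding *[symmetric] by (rule sum.reindex_bij_witness[of _ "\<lambda>h. h + w" "\<lambda>v. v - w"]) auto
  qed
  also have "\<dots> = (\<Sum>h\<in>UNIV. \<psi> (s * Q h) * (\<Sum>w\<in>UNIV. \<psi> (polar_form Q w (s *s h))))"
    by (subst sum.swap) (simp add: sum_distrib_left)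
  also have "\<dots> = (\<Sum>h\<in>(UNIV :: ('a ^ 'd) set). if h = 0 then of_nat (CARD('a) ^ CARD('d)) else 0)"
    by (rule sum.cong[OF refl])
      (use s in \<open>auto simp: sum_character_bilinear[OF psi nB] additive_character_0[OF psi] QD\<close>)
  also have "\<dots> = of_real (real CARD('a) ^ CARD('d))" by simp
  finally have "(norm (quadratic_gauss_sum \<psi> Q s))\<^sup>2 = real CARD('a) ^ CARD('d)"
    unfolding complex_norm_square[symmetric] of_real_eq_iff .
  then show ?thesis by (metis norm_ge_zero real_sqrt_unique)
qed

lemma quadratic_gauss_sum_scale:
  fixes Q :: "'a::{field,finite} ^ 'd::finite \<Rightarrow> 'a"
  assumes "quadratic_form Q" "c \<noteq> 0"
  shows "quadratic_gauss_sum \<psi> Q (s * c\<^sup>2) = quadratic_gauss_sum \<psi> Q s"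
  unfolding quadratic_gauss_sum_def
  by (rule sum.reindex_bij_witness[of _ "\<lambda>v. (1 / c) *s v" "\<lambda>v. c *s v"])
    (use assms in \<open>auto simp: quadratic_formD mult.assoc\<close>)

text \<open>
  For \<open>s = u\<^sup>2 + v\<^sup>2\<close> the substitution \<open>(x, y) \<mapsto> (u x + v y, u y - v x)\<close> multiplies
  \<open>Q x + Q y\<close> by \<open>s\<close>; this avoids diagonalising the form.
\<close>

lemma quadratic_gauss_sum_square:
  fixes Q :: "'a::{field,finite} ^ 'd::finite \<Rightarrow> 'a"
  assumes odd: "odd CARD('a)" and psi: "additive_character \<psi>" and Q: "quadratic_form Q" and s: "s \<noteq> 0"
  shows "(quadratic_gauss_sum \<psi> Q s)\<^sup>2 = (quadratic_gauss_sum \<psi> Q 1)\<^sup>2"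
proof -
  obtain u v where uv: "s = u\<^sup>2 + v\<^sup>2" using sum_two_squares[OF odd] by blast
  note QD = quadratic_formD[OF Q]
  note BD = bilinear_formD[OF QD(4)]
  have sq: "(quadratic_gauss_sum \<psi> Q r)\<^sup>2 = (\<Sum>(x, y)\<in>UNIV \<times> UNIV. \<psi> (r * (Q x + Q y)))" for r
    unfolding quadratic_gauss_sum_def power2_eq_square sum_product sum.cartesian_product
    by (intro sum.cong) (auto simp: distrib_left additive_character_add[OF psi])
  have rot: "Q (u *s x + v *s y) + Q (u *s y + (- v) *s x) = s * (Q x + Q y)" for x y
  proof -
    have "Q (a *s z + b *s w) = a\<^sup>2 * Q z + b\<^sup>2 * Q w + a * b * polar_form Q z w" for a b z w
      by (simp add: QD(2)[of "a *s z"] QD(1) BD(3,4))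
    then show ?thesis
      by (simp only: QD(3)[of y x] uv) (simp add: algebra_simps)
  qed
  define T where "T = (\<lambda>(x, y). (u *s x + v *s y, u *s y + (- v) *s x) :: ('a ^ 'd) \<times> ('a ^ 'd))"
  \<comment> \<open>The inverse substitution is the transposed one divided by u^2 + v^2 = s. It
    yields injectivity, which on a finite set is bijectivity.\<close>
  have inv: "(1 / s) *s (u *s (u *s x + v *s y) + (- v) *s (u *s y + (- v) *s x)) = x"
    "(1 / s) *s (u *s (u *s y + (- v) *s x) + v *s (u *s x + v *s y)) = y" for x y :: "'a ^ 'd"
  proof -
    have "u * (u * a + v * b) + (- v) * (u * b + (- v) * a) = s * a"
      "u * (u * b + (- v) * a) + v * (u * a + v * b) = s * b" for a b
      by (simp_all add: uv power2_eq_square algebra_simps)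
    then show "(1 / s) *s (u *s (u *s x + v *s y) + (- v) *s (u *s y + (- v) *s x)) = x"
      "(1 / s) *s (u *s (u *s y + (- v) *s x) + v *s (u *s x + v *s y)) = y"
      unfolding vec_eq_iff vector_add_component vector_smult_component using s by auto
  qed
  have "inj T"
  proof (rule injI)
    fix p r :: "('a ^ 'd) \<times> ('a ^ 'd)"
    assume e: "T p = T r"
    obtain x y x' y' where pr: "p = (x, y)" "r = (x', y')" by (cases p, cases r)
    from pr e have "u *s x + v *s y = u *s x' + v *s y'" "u *s y + (- v) *s x = u *s y' + (- v) *s x'"
      by (auto simp only: T_def prod.case prod.inject)
    then have "x = x'" "y = y'" by (metis inv)+
    then show "p = r" using pr by simp
  qed
  then have "bij_betw T UNIV UNIV" by (simp add: bij_def finite_UNIV_inj_surj)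
  moreover have "(\<lambda>(x, y). \<psi> (1 * (Q x + Q y))) (T p) = (\<lambda>(x, y). \<psi> (s * (Q x + Q y))) p" for p
    by (cases p) (simp only: T_def prod.case rot mult_1_left)
  ultimately show ?thesis
    using sum.reindex_bij_betw[of T UNIV UNIV "\<lambda>(x, y). \<psi> (1 * (Q x + Q y))"]
    unfolding sq UNIV_Times_UNIV by (simp only:)
qed

text \<open>The Gauss sum G satisfies G(s) = \<plusminus> G(1) and is constant on square classes, so
  it is either constant on nonzero s or G(1) times the quadratic character. The first alternative
  leads to a Kloosterman sum and the second to a Salie sum. Both obey the same bound, so the proof
  can leave open which one occurs.\<close>

lemma quadratic_kernel_bound:
  fixes Q :: "'a::{field,finite} ^ 'd::finite \<Rightarrow> 'a"
  assumes odd: "odd CARD('a)" and psi: "additive_character \<psi>" and Q: "nondegenerate_quadratic_form Q" and t: "t \<noteq> 0"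
  shows "norm (\<Sum>s\<in>UNIV - {0}. \<psi> (- (s * t) - c / s) * quadratic_gauss_sum \<psi> Q s)
    \<le> sqrt (real CARD('a) ^ CARD('d)) * (2 * sqrt (real CARD('a)))"
proof -
  have qQ: "quadratic_form Q" using Q by (auto simp: nondegenerate_quadratic_form_def)
  let ?G = "quadratic_gauss_sum \<psi> Q"
  note scale = quadratic_gauss_sum_scale[OF qQ]
  have pm: "?G s = ?G 1 \<or> ?G s = - ?G 1" if "s \<noteq> 0" for s
    using quadratic_gauss_sum_square[OF odd psi qQ that] by (simp add: power2_eq_iff)
  have sq: "?G s = ?G 1" if "s \<in> nonzero_squares" for s
    using that scale[of _ _ 1] by (auto simp: nonzero_squares_def)
  have "(\<forall>s\<in>UNIV - {0}. ?G s = ?G 1) \<or> (\<forall>s\<in>UNIV - {0}. ?G s = quadratic_character s * ?G 1)"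
  proof (cases "\<exists>\<nu>. \<nu> \<noteq> 0 \<and> ?G \<nu> \<noteq> ?G 1")
    case True
    then obtain \<nu> where nu: "\<nu> \<noteq> 0" "?G \<nu> \<noteq> ?G 1" by blast
    then have n2: "\<nu> \<notin> nonzero_squares" using sq by blast
    have "?G s = - ?G 1" if s: "s \<noteq> 0" "s \<notin> nonzero_squares" for s
      using nonsquare_mult_square[OF odd nu(1) n2 s] scale[of _ _ \<nu>] pm[OF nu(1)] nu(2) by auto
    then show ?thesis using sq by (auto simp: quadratic_character_def)
  qed auto
  then have alt: "norm (\<Sum>s\<in>UNIV - {0}. \<psi> (- (s * t) - c / s) * ?G s) = norm (?G 1) * norm (\<Sum>s\<in>UNIV - {0}. \<psi> (- t * s + (- c) / s))
    \<or> norm (\<Sum>s\<in>UNIV - {0}. \<psi> (- (s * t) - c / s) * ?G s)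
      = norm (?G 1) * norm (\<Sum>s\<in>UNIV - {0}. quadratic_character s * \<psi> (- t * s + (- c) / s))"
    unfolding norm_mult[symmetric] sum_distrib_left
  proof (elim disj_forward)
    assume e: "\<forall>s\<in>UNIV - {0}. ?G s = ?G 1"
    show "norm (\<Sum>s\<in>UNIV - {0}. \<psi> (- (s * t) - c / s) * ?G s) = norm (\<Sum>s\<in>UNIV - {0}. ?G 1 * \<psi> (- t * s + (- c) / s))"
    proof (intro arg_cong[where f = norm] sum.cong refl)
      fix s :: 'a assume "s \<in> UNIV - {0}"
      then have es: "?G s = ?G 1" using e by blast
      show "\<psi> (- (s * t) - c / s) * ?G s = ?G 1 * \<psi> (- t * s + (- c) / s)"
        unfolding es by (simp add: mult.commute)
    qed
  next
    assume e: "\<forall>s\<in>UNIV - {0}. ?G s = quadratic_character s * ?G 1"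
    show "norm (\<Sum>s\<in>UNIV - {0}. \<psi> (- (s * t) - c / s) * ?G s)
      = norm (\<Sum>s\<in>UNIV - {0}. ?G 1 * (quadratic_character s * \<psi> (- t * s + (- c) / s)))"
    proof (intro arg_cong[where f = norm] sum.cong refl)
      fix s :: 'a assume "s \<in> UNIV - {0}"
      then have es: "?G s = quadratic_character s * ?G 1" using e by blast
      show "\<psi> (- (s * t) - c / s) * ?G s = ?G 1 * (quadratic_character s * \<psi> (- t * s + (- c) / s))"
        unfolding es by (simp add: mult_ac)
    qed
  qed
  have gn: "norm (?G 1) = sqrt (real CARD('a) ^ CARD('d))"
    by (rule norm_quadratic_gauss_sum[OF psi Q]) simp
  have k1: "norm (\<Sum>s\<in>UNIV - {0}. \<psi> (- t * s + (- c) / s)) \<le> 2 * sqrt (real CARD('a))"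
    using t by (intro twisted_kloosterman_bound[OF odd psi]) simp
  have k2: "norm (\<Sum>s\<in>UNIV - {0}. quadratic_character s * \<psi> (- t * s + (- c) / s)) \<le> 2 * sqrt (real CARD('a))"
    by (rule salie_bound[OF odd psi])
  have "norm (?G 1) * norm (\<Sum>s\<in>UNIV - {0}. \<psi> (- t * s + (- c) / s)) \<le> norm (?G 1) * (2 * sqrt (real CARD('a)))"
    "norm (?G 1) * norm (\<Sum>s\<in>UNIV - {0}. quadratic_character s * \<psi> (- t * s + (- c) / s)) \<le> norm (?G 1) * (2 * sqrt (real CARD('a)))"
    by (intro mult_left_mono k1 k2 norm_ge_zero)+
  with alt show ?thesis unfolding gn[symmetric] by linarith
qed

text \<open>The operator is convolution by r, so its norm is controlled by the largest Fourier
  coefficient H m. Completing the square with the polar form gives s Q(v + m/s) = s Q(v) + B(m,v) +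
  Q(m)/s, which makes H m a kernel sum with c = Q m.\<close>

lemma quadratic_operator_bound:
  fixes Q :: "'a::{field,finite} ^ 'd::finite \<Rightarrow> 'a" and f :: "'a ^ 'd \<Rightarrow> real"
  assumes odd: "odd CARD('a)" and Q: "nondegenerate_quadratic_form Q" and t: "t \<noteq> 0"
  shows "(\<Sum>x\<in>UNIV. (\<Sum>y\<in>UNIV. (of_bool (Q (x - y) = t) - 1 / real CARD('a)) * f y)\<^sup>2)
    \<le> 4 * real CARD('a) ^ CARD('d) / real CARD('a) * (\<Sum>y\<in>UNIV. (f y)\<^sup>2)"
proof -
  obtain \<psi> :: "'a \<Rightarrow> complex" where psi: "additive_character \<psi>" using additive_character_exists by blast
  have qQ: "quadratic_form Q" and nB: "nondegenerate_bilinear_form (polar_form Q)"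
    using Q by (auto simp: nondegenerate_quadratic_form_def)
  note QD = quadratic_formD[OF qQ]
  note BD = bilinear_formD[OF QD(4)]
  let ?q = "real CARD('a)"
  let ?N = "?q ^ CARD('d)"
  let ?B = "polar_form Q"
  have q: "?q \<ge> 2" using CARD_field_ge_2[where ?'a = 'a] by simp
  define r where "r = (\<lambda>v. of_bool (Q v = t) - 1 / ?q)"
  define g where "g = (\<lambda>x. \<Sum>y\<in>UNIV. r (x - y) * f y)"
  define F where "F = (\<lambda>m. \<Sum>y\<in>UNIV. complex_of_real (f y) * \<psi> (?B m y))"
  define H where "H = (\<lambda>m. \<Sum>v\<in>UNIV. complex_of_real (r v) * \<psi> (?B m v))"
  have conv: "(\<Sum>x\<in>UNIV. complex_of_real (g x) * \<psi> (?B m x)) = H m * F m" for m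
  proof -
    have "(\<Sum>x\<in>UNIV. complex_of_real (g x) * \<psi> (?B m x))
        = (\<Sum>y\<in>UNIV. \<Sum>x\<in>UNIV. complex_of_real (r (x - y)) * \<psi> (?B m (x - y)) * (complex_of_real (f y) * \<psi> (?B m y)))"
      unfolding g_def of_real_sum sum_distrib_right
      by (subst sum.swap) (simp add: mult_ac BD additive_character_add[OF psi, symmetric])
    also have "\<dots> = (\<Sum>y\<in>UNIV. \<Sum>v\<in>UNIV. complex_of_real (r v) * \<psi> (?B m v) * (complex_of_real (f y) * \<psi> (?B m y)))"
    proof (rule sum.cong[OF refl])
      fix y :: "'a ^ 'd"
      show "(\<Sum>x\<in>UNIV. complex_of_real (r (x - y)) * \<psi> (?B m (x - y)) * (complex_of_real (f y) * \<psi> (?B m y)))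
        = (\<Sum>v\<in>UNIV. complex_of_real (r v) * \<psi> (?B m v) * (complex_of_real (f y) * \<psi> (?B m y)))"
        by (rule sum.reindex_bij_witness[of _ "\<lambda>v. v + y" "\<lambda>x. x - y"]) auto
    qed
    also have "\<dots> = H m * F m" unfolding H_def F_def sum_product by (rule sum.swap)
    finally show ?thesis .
  qed
  have H: "(norm (H m))\<^sup>2 \<le> 4 * ?N / ?q" for m
  proof -
    have cs: "(\<Sum>v\<in>UNIV. \<psi> (s * Q v) * \<psi> (?B m v)) = \<psi> (- (Q m / s)) * quadratic_gauss_sum \<psi> Q s" if s: "s \<noteq> 0" for s
    proof -
      have "s * Q (v + (1 / s) *s m) = s * Q v + ?B m v + Q m / s" for v
        using s by (simp add: QD(1) QD(2)[of v] BD QD(3)[of v m] power2_eq_square field_simps)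
      then have "s * Q v + ?B m v = - (Q m / s) + s * Q (v + (1 / s) *s m)" for v by simp
      then have "(\<Sum>v\<in>UNIV. \<psi> (s * Q v) * \<psi> (?B m v)) = \<psi> (- (Q m / s)) * (\<Sum>v\<in>UNIV. \<psi> (s * Q (v + (1 / s) *s m)))"
        unfolding additive_character_add[OF psi, symmetric] sum_distrib_left by (simp only:)
      also have "(\<Sum>v\<in>UNIV. \<psi> (s * Q (v + (1 / s) *s m))) = quadratic_gauss_sum \<psi> Q s"
        unfolding quadratic_gauss_sum_def
        by (rule sum.reindex_bij_witness[of _ "\<lambda>v. v - (1 / s) *s m" "\<lambda>v. v + (1 / s) *s m"]) auto
      finally show ?thesis .
    qed
    have "H m = (\<Sum>s\<in>UNIV - {0}. \<psi> (- (s * t)) * (\<Sum>v\<in>UNIV. \<psi> (s * Q v) * \<psi> (?B m v))) / of_nat CARD('a)"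
      unfolding H_def r_def indicator_fourier[OF psi] sum_distrib_left sum_distrib_right sum_divide_distrib times_divide_eq_left
      by (subst sum.swap) (simp add: mult_ac)
    also have "(\<Sum>s\<in>UNIV - {0}. \<psi> (- (s * t)) * (\<Sum>v\<in>UNIV. \<psi> (s * Q v) * \<psi> (?B m v)))
      = (\<Sum>s\<in>UNIV - {0}. \<psi> (- (s * t) - Q m / s) * quadratic_gauss_sum \<psi> Q s)"
      by (rule sum.cong[OF refl]) (simp add: cs additive_character_add[OF psi, of _ "- (Q m / _)", simplified])
    finally have "norm (H m) \<le> sqrt ?N * (2 * sqrt ?q) / ?q"
      using quadratic_kernel_bound[OF odd psi Q t, of "Q m"] q by (simp add: norm_divide divide_right_mono)
    then have "(norm (H m))\<^sup>2 \<le> (sqrt ?N * (2 * sqrt ?q) / ?q)\<^sup>2" by (intro power_mono) auto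
    also have "\<dots> = 4 * ?N / ?q" using q by (simp add: power_divide power_mult_distrib) (simp add: power2_eq_square)
    finally show ?thesis .
  qed
  have "?N * (\<Sum>x\<in>UNIV. (g x)\<^sup>2) = (\<Sum>m\<in>UNIV. (norm (\<Sum>x\<in>UNIV. complex_of_real (g x) * \<psi> (?B m x)))\<^sup>2)"
    unfolding parseval_bilinear[OF psi nB] by simp
  also have "\<dots> = (\<Sum>m\<in>UNIV. (norm (H m))\<^sup>2 * (norm (F m))\<^sup>2)"
    unfolding conv norm_mult power_mult_distrib ..
  also have "\<dots> \<le> (\<Sum>m\<in>UNIV. 4 * ?N / ?q * (norm (F m))\<^sup>2)"
    by (intro sum_mono mult_right_mono H) auto
  also have "\<dots> = 4 * ?N / ?q * (?N * (\<Sum>y\<in>UNIV. (f y)\<^sup>2))"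
    unfolding sum_distrib_left[symmetric] F_def parseval_bilinear[OF psi nB] by simp
  finally have "?N * (\<Sum>x\<in>UNIV. (g x)\<^sup>2) \<le> ?N * (4 * ?N / ?q * (\<Sum>y\<in>UNIV. (f y)\<^sup>2))"
    by (simp only: mult_ac)
  then have "(\<Sum>x\<in>UNIV. (g x)\<^sup>2) \<le> 4 * ?N / ?q * (\<Sum>y\<in>UNIV. (f y)\<^sup>2)"
    by (rule mult_left_le_imp_le) (use q in simp)
  then show ?thesis by (simp add: g_def r_def)
qed

lemma distance_operator_bound:
  fixes \<phi> :: "'a::{field,finite} ^ 'd::finite \<Rightarrow> 'a ^ 'd \<Rightarrow> 'a" and f :: "'a ^ 'd \<Rightarrow> real"
  assumes odd: "odd CARD('a)" and phi: "distance_type \<phi>" and t: "t \<noteq> 0"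
  shows "(\<Sum>x\<in>UNIV. (\<Sum>y\<in>UNIV. (of_bool (\<phi> x y = t) - 1 / real CARD('a)) * f y)\<^sup>2)
    \<le> 4 * real CARD('a) ^ CARD('d) / real CARD('a) * (\<Sum>y\<in>UNIV. (f y)\<^sup>2)"
  using phi unfolding distance_type_def
proof
  assume B: "nondegenerate_bilinear_form \<phi>"
  have "real CARD('a) ^ CARD('d) / real CARD('a) * (\<Sum>y\<in>UNIV. (f y)\<^sup>2) \<ge> 0"
    by (intro mult_nonneg_nonneg divide_nonneg_nonneg sum_nonneg) auto
  then show ?thesis using bilinear_operator_bound[OF B t, of f] by simp
next
  assume "\<exists>Q. nondegenerate_quadratic_form Q \<and> (\<forall>x y. \<phi> x y = Q (x - y))"
  then obtain Q where "nondegenerate_quadratic_form Q" "\<And>x y. \<phi> x y = Q (x - y)" by blast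
  then show ?thesis using quadratic_operator_bound[OF odd _ t, of Q f] by simp
qed

section \<open>Traces of powers and closed walks\<close>

lemma funpow_norm_bound:
  fixes S :: "'b::real_normed_vector \<Rightarrow> 'b"
  assumes "\<And>f. norm (S f) \<le> \<rho> * norm f" "\<rho> \<ge> 0"
  shows "norm ((S ^^ j) f) \<le> \<rho> ^ j * norm f"
proof (induction j)
  case (Suc j)
  have "norm ((S ^^ Suc j) f) \<le> \<rho> * norm ((S ^^ j) f)" using assms(1) by simp
  also have "\<dots> \<le> \<rho> * (\<rho> ^ j * norm f)" by (rule mult_left_mono[OF Suc assms(2)])
  finally show ?case by (simp add: mult.assoc)
qed simp

lemma linear_funpow:
  fixes S :: "'b::real_vector \<Rightarrow> 'b"
  assumes "linear S" shows "linear (S ^^ j)"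
  by (induction j) (simp_all only: funpow.simps linear_id linear_compose assms)

lemma matrix_vector_mult_component:
  fixes A :: "'a::semiring_1 ^ 'n ^ 'm"
  shows "(A *v f) $ x = (\<Sum>y\<in>UNIV. A $ x $ y * f $ y)"
  by (simp add: matrix_vector_mult_def)

definition operator_trace :: "(real ^ 'v \<Rightarrow> real ^ 'v) \<Rightarrow> real" where
  "operator_trace T = (\<Sum>x\<in>UNIV. T (axis x 1) $ x)"

text \<open>
  Every term of the telescoping sum for \<open>T\<^sup>n - S\<^sup>n\<close> contains one rank-one factor, which turns its
  trace into an inner product with \<open>w\<close>.
\<close>

lemma trace_power_rank_one_perturbation:
  fixes T S :: "real ^ 'v::finite \<Rightarrow> real ^ 'v" and w :: "real ^ 'v"
  assumes T: "linear T" and S: "linear S"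
    and TS: "\<And>f. T f = S f + (\<kappa> * (w \<bullet> f)) *\<^sub>R w"
    and S_bound: "\<And>f. norm (S f) \<le> \<rho> * norm f" and \<rho>: "\<rho> \<ge> 0" and \<kappa>: "\<kappa> \<ge> 0"
    and a: "a = \<kappa> * (norm w)\<^sup>2" and n: "n \<ge> 1"
  shows "\<bar>operator_trace (T ^^ n) - operator_trace (S ^^ n) - a ^ n\<bar> \<le> (a + \<rho>) ^ n - \<rho> ^ n - a ^ n"
proof -
  have a0: "a \<ge> 0" using a \<kappa> by simp
  have T_bound: "norm (T f) \<le> (a + \<rho>) * norm f" for f
  proof -
    have "norm ((\<kappa> * (w \<bullet> f)) *\<^sub>R w) = \<kappa> * \<bar>w \<bullet> f\<bar> * norm w" using \<kappa> by (simp add: abs_mult)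
    also have "\<dots> \<le> \<kappa> * (norm w * norm f) * norm w"
      using \<kappa> Cauchy_Schwarz_ineq2[of w f] by (intro mult_right_mono mult_left_mono) auto
    also have "\<dots> = a * norm f" by (simp add: a power2_eq_square)
    finally show ?thesis
      unfolding TS using norm_triangle_ineq[of "S f" "(\<kappa> * (w \<bullet> f)) *\<^sub>R w"] S_bound[of f]
      by (simp add: distrib_right)
  qed
  \<comment> \<open>The telescoping is ordered with S acting on f and T acting on w, so each
    correction is a scalar functional of f times a vector independent of f.\<close>
  have expand: "(T ^^ n) f = (S ^^ n) f + (\<Sum>k<n. (\<kappa> * (w \<bullet> (S ^^ (n - Suc k)) f)) *\<^sub>R (T ^^ k) w)" for n f
  proof (induction n arbitrary: f)
    case (Suc n)
    have "(T ^^ Suc n) f = (T ^^ n) (T f)" by (simp add: funpow_swap1)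
    also have "\<dots> = (T ^^ n) (S f) + (\<kappa> * (w \<bullet> f)) *\<^sub>R (T ^^ n) w"
      using linear_funpow[OF T, of n] by (simp add: TS linear_add linear_scale)
    also have "(T ^^ n) (S f) = (S ^^ Suc n) f + (\<Sum>k<n. (\<kappa> * (w \<bullet> (S ^^ (Suc n - Suc k)) f)) *\<^sub>R (T ^^ k) w)"
    proof -
      have "(S ^^ (n - Suc k)) (S f) = (S ^^ (Suc n - Suc k)) f" if "k < n" for k
      proof -
        have "Suc n - Suc k = Suc (n - Suc k)" using that by simp
        then show ?thesis by (simp add: funpow_swap1)
      qed
      then show ?thesis unfolding Suc.IH by (simp add: funpow_swap1)
    qed
    finally show ?case by simp
  qed simp
  have contract: "(\<Sum>x\<in>UNIV. (w \<bullet> (S ^^ j) (axis x 1)) * g $ x) = w \<bullet> (S ^^ j) g" for j g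
  proof -
    have "g = (\<Sum>x\<in>UNIV. (g $ x) *\<^sub>R axis x 1)"
      by (simp add: vec_eq_iff axis_def if_distrib[of "\<lambda>z. _ * z"] cong: if_cong)
    then have "(S ^^ j) g = (\<Sum>x\<in>UNIV. (g $ x) *\<^sub>R (S ^^ j) (axis x 1))"
      using linear_funpow[OF S, of j] by (metis (no_types, lifting) linear_scale linear_sum sum.cong)
    then show ?thesis by (simp add: inner_sum_right mult.commute)
  qed
  have tr: "operator_trace (T ^^ n) - operator_trace (S ^^ n) = (\<Sum>k<n. \<kappa> * (w \<bullet> (S ^^ (n - Suc k)) ((T ^^ k) w)))"
  proof -
    have "operator_trace (T ^^ n) - operator_trace (S ^^ n)
        = (\<Sum>x\<in>UNIV. \<Sum>k<n. \<kappa> * ((w \<bullet> (S ^^ (n - Suc k)) (axis x 1)) * (T ^^ k) w $ x))"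
      unfolding operator_trace_def expand[of n] by (simp add: sum.distrib mult.assoc)
    also have "\<dots> = (\<Sum>k<n. \<kappa> * (\<Sum>x\<in>UNIV. (w \<bullet> (S ^^ (n - Suc k)) (axis x 1)) * (T ^^ k) w $ x))"
      unfolding sum_distrib_left by (rule sum.swap)
    also have "\<dots> = (\<Sum>k<n. \<kappa> * (w \<bullet> (S ^^ (n - Suc k)) ((T ^^ k) w)))"
      by (simp only: contract)
    finally show ?thesis .
  qed
  \<comment> \<open>The vector w is nearly an eigenvector: T w = a w + S w.\<close>
  have Tw: "norm ((T ^^ k) w - (a ^ k) *\<^sub>R w) \<le> ((a + \<rho>) ^ k - a ^ k) * norm w" for k
  proof (induction k)
    case (Suc k)
    have "T w = S w + a *\<^sub>R w" by (simp add: TS a power2_norm_eq_inner)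
    then have "(T ^^ Suc k) w - (a ^ Suc k) *\<^sub>R w = T ((T ^^ k) w - (a ^ k) *\<^sub>R w) + (a ^ k) *\<^sub>R S w"
      using T by (simp add: linear_diff linear_scale algebra_simps)
    also have "norm \<dots> \<le> (a + \<rho>) * norm ((T ^^ k) w - (a ^ k) *\<^sub>R w) + a ^ k * (\<rho> * norm w)"
      using a0 by (intro norm_triangle_mono T_bound) (simp add: mult_left_mono[OF S_bound])
    also have "\<dots> \<le> (a + \<rho>) * (((a + \<rho>) ^ k - a ^ k) * norm w) + a ^ k * (\<rho> * norm w)"
      using a0 \<rho> by (intro add_right_mono mult_left_mono Suc) auto
    also have "\<dots> = ((a + \<rho>) ^ Suc k - a ^ Suc k) * norm w" by (simp add: algebra_simps)
    finally show ?case .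
  qed simp
  obtain m where m: "n = Suc m" using n by (cases n) auto
  define b where "b = (\<lambda>k. \<kappa> * (w \<bullet> (S ^^ (n - Suc k)) ((T ^^ k) w)))"
  have small: "\<bar>b k\<bar> \<le> a * (\<rho> ^ (n - Suc k) * (a + \<rho>) ^ k)" for k
  proof -
    have "norm ((S ^^ (n - Suc k)) ((T ^^ k) w)) \<le> \<rho> ^ (n - Suc k) * norm ((T ^^ k) w)"
      by (rule funpow_norm_bound[OF S_bound \<rho>])
    also have "\<dots> \<le> \<rho> ^ (n - Suc k) * ((a + \<rho>) ^ k * norm w)"
      using a0 \<rho> by (intro mult_left_mono funpow_norm_bound T_bound) auto
    finally have "norm w * norm ((S ^^ (n - Suc k)) ((T ^^ k) w)) \<le> norm w * (\<rho> ^ (n - Suc k) * ((a + \<rho>) ^ k * norm w))"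
      by (rule mult_left_mono) simp
    then have "\<bar>w \<bullet> (S ^^ (n - Suc k)) ((T ^^ k) w)\<bar> \<le> norm w * (\<rho> ^ (n - Suc k) * ((a + \<rho>) ^ k * norm w))"
      using Cauchy_Schwarz_ineq2 order_trans by blast
    from mult_left_mono[OF this \<kappa>] show ?thesis
      using \<kappa> by (simp add: b_def abs_mult a power2_eq_square mult_ac)
  qed
  \<comment> \<open>The summand k = n - 1 is the only one with no leading power of S, and it carries
    the main term a^n.\<close>
  have main: "\<bar>b m - a ^ n\<bar> \<le> a * (a + \<rho>) ^ m - a ^ n"
  proof -
    have "b m - a ^ n = \<kappa> * (w \<bullet> ((T ^^ m) w - (a ^ m) *\<^sub>R w))"
      by (simp add: b_def m inner_diff_right right_diff_distrib a power2_norm_eq_inner mult_ac)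
    also have "\<bar>\<dots>\<bar> \<le> \<kappa> * (norm w * (((a + \<rho>) ^ m - a ^ m) * norm w))"
      unfolding abs_mult using \<kappa> order_trans[OF Cauchy_Schwarz_ineq2[of w "(T ^^ m) w - (a ^ m) *\<^sub>R w"] mult_left_mono[OF Tw[of m]]]
      by (simp add: mult_left_mono)
    also have "\<dots> = a * ((a + \<rho>) ^ m - a ^ m)" by (simp add: a power2_eq_square mult_ac)
    finally show ?thesis by (simp add: m right_diff_distrib)
  qed
  have "operator_trace (T ^^ n) - operator_trace (S ^^ n) - a ^ n = (\<Sum>k<m. b k) + (b m - a ^ n)"
    unfolding tr b_def[symmetric] by (simp add: m)
  also have "\<bar>\<dots>\<bar> \<le> (\<Sum>k<m. \<bar>b k\<bar>) + \<bar>b m - a ^ n\<bar>"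
    using abs_triangle_ineq[of "\<Sum>k<m. b k"] sum_abs[of b "{..<m}"] by (smt (verit))
  also have "\<dots> \<le> (\<Sum>k<m. a * (\<rho> ^ (n - Suc k) * (a + \<rho>) ^ k)) + (a * (a + \<rho>) ^ m - a ^ n)"
    by (intro add_mono sum_mono small main)
  also have "\<dots> = (\<Sum>k<n. a * (\<rho> ^ (n - Suc k) * (a + \<rho>) ^ k)) - a ^ n" by (simp add: m)
  \<comment> \<open>Since a = (a + \<rho>) - \<rho>, this is the factorisation of a difference of
    n-th powers.\<close>
  also have "(\<Sum>k<n. a * (\<rho> ^ (n - Suc k) * (a + \<rho>) ^ k)) = (a + \<rho>) ^ n - \<rho> ^ n"
    unfolding sum_distrib_left[symmetric] power_diff_sumr2 by simp
  finally show ?thesis by simp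
qed

text \<open>The diagonal entry of R^(m+2) at x is the inner product of row x with R^m applied to
  column x. Measuring that row and column by their Euclidean norms avoids the factor equal to the
  dimension, which a bound of each entry by \<rho>^(m+2) would cost.\<close>

lemma trace_power_hilbert_schmidt:
  fixes R :: "real ^ 'v::finite ^ 'v"
  assumes R_bound: "\<And>f. norm (R *v f) \<le> \<rho> * norm f" and \<rho>: "\<rho> \<ge> 0"
  shows "\<bar>operator_trace ((*v) R ^^ (m + 2))\<bar> \<le> \<rho> ^ m * (\<Sum>x\<in>UNIV. \<Sum>y\<in>UNIV. (R $ x $ y)\<^sup>2)"
proof -
  have rows: "(norm (R $ x))\<^sup>2 = (\<Sum>y\<in>UNIV. (R $ x $ y)\<^sup>2)" for x
    unfolding power2_norm_eq_inner inner_vec_def by (simp add: power2_eq_square)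
  have cols: "(norm (R *v axis x 1))\<^sup>2 = (\<Sum>y\<in>UNIV. (R $ y $ x)\<^sup>2)" for x
    unfolding power2_norm_eq_inner inner_vec_def
    by (simp add: power2_eq_square matrix_vector_mult_def axis_def if_distrib[of "\<lambda>z. _ * z"] cong: if_cong)
  have "\<bar>((*v) R ^^ (m + 2)) (axis x 1) $ x\<bar> \<le> \<rho> ^ m * (((norm (R $ x))\<^sup>2 + (norm (R *v axis x 1))\<^sup>2) / 2)" for x
  proof -
    have "((*v) R ^^ (m + 2)) (axis x 1) $ x = R $ x \<bullet> ((*v) R ^^ m) (R *v axis x 1)"
    proof -
      have "((*v) R ^^ (m + 2)) (axis x 1) = R *v (((*v) R ^^ m) (R *v axis x 1))" by (simp add: funpow_swap1)
      then show ?thesis by (simp add: matrix_vector_mult_component inner_vec_def)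
    qed
    also have "\<bar>\<dots>\<bar> \<le> norm (R $ x) * norm (((*v) R ^^ m) (R *v axis x 1))" by (rule Cauchy_Schwarz_ineq2)
    also have "\<dots> \<le> norm (R $ x) * (\<rho> ^ m * norm (R *v axis x 1))"
      by (intro mult_left_mono funpow_norm_bound R_bound \<rho>) auto
    also have "\<dots> = \<rho> ^ m * (norm (R $ x) * norm (R *v axis x 1))" by simp
    also have "\<dots> \<le> \<rho> ^ m * (((norm (R $ x))\<^sup>2 + (norm (R *v axis x 1))\<^sup>2) / 2)"
      using \<rho> sum_squares_bound[of "norm (R $ x)" "norm (R *v axis x 1)"] by (intro mult_left_mono) auto
    finally show ?thesis .
  qed
  then have "\<bar>operator_trace ((*v) R ^^ (m + 2))\<bar> \<le> (\<Sum>x\<in>UNIV. \<rho> ^ m * (((norm (R $ x))\<^sup>2 + (norm (R *v axis x 1))\<^sup>2) / 2))"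
    unfolding operator_trace_def by (intro order_trans[OF sum_abs] sum_mono)
  also have "\<dots> = \<rho> ^ m * (((\<Sum>x\<in>UNIV. \<Sum>y\<in>UNIV. (R $ x $ y)\<^sup>2) + (\<Sum>x\<in>UNIV. \<Sum>y\<in>UNIV. (R $ y $ x)\<^sup>2)) / 2)"
    unfolding rows cols sum_distrib_left[symmetric] sum_divide_distrib[symmetric] sum.distrib ..
  also have "(\<Sum>x\<in>UNIV. \<Sum>y\<in>UNIV. (R $ y $ x)\<^sup>2) = (\<Sum>x\<in>UNIV. \<Sum>y\<in>UNIV. (R $ x $ y)\<^sup>2)" by (rule sum.swap)
  also have "\<rho> ^ m * ((z + z) / 2) = \<rho> ^ m * z" for z by simp
  finally show ?thesis .
qed

section \<open>Closed walks and the trace of the adjacency matrix\<close>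

fun walks :: "('v \<Rightarrow> 'v \<Rightarrow> bool) \<Rightarrow> nat \<Rightarrow> 'v \<Rightarrow> 'v \<Rightarrow> 'v list set" where
  "walks adj 0 x z = (if x = z then {[]} else {})"
| "walks adj (Suc n) x z = (\<Union>y\<in>{y. adj x y}. (#) y ` walks adj n y z)"

text \<open>A walk is stored without its starting vertex, so a walk of n steps is a list of length n
  and step i goes from entry i of \<open>x # ys\<close> to entry i of \<open>ys\<close>.\<close>

lemma walks_iff:
  "ys \<in> walks adj n x z \<longleftrightarrow> length ys = n \<and> last (x # ys) = z \<and> (\<forall>i<n. adj ((x # ys) ! i) (ys ! i))"
proof (induction n arbitrary: x ys)
  case (Suc n)
  show ?case
  proof (cases ys)
    case (Cons y ys')
    have "ys \<in> walks adj (Suc n) x z \<longleftrightarrow> adj x y \<and> ys' \<in> walks adj n y z" by (auto simp: Cons)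
    also have "\<dots> \<longleftrightarrow> length ys = Suc n \<and> last (x # ys) = z \<and> (\<forall>i<Suc n. adj ((x # ys) ! i) (ys ! i))"
      unfolding Suc.IH All_less_Suc2 by (auto simp: Cons)
    finally show ?thesis .
  qed auto
qed auto

lemma finite_walks: "finite (walks adj n x (z::'v::finite))"
  by (induction n arbitrary: x) auto

lemma matrix_power_walks:
  fixes adj :: "'v::finite \<Rightarrow> 'v \<Rightarrow> bool"
  shows "(((*v) (\<chi> x y. of_bool (adj x y))) ^^ n) (axis z 1) $ x = real (card (walks adj n x z))"
proof (induction n arbitrary: x)
  case 0
  then show ?case by (simp add: axis_def)
next
  case (Suc n)
  have "card (walks adj (Suc n) x z) = (\<Sum>y\<in>{y. adj x y}. card ((#) y ` walks adj n y z))"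
    unfolding walks.simps by (subst card_UN_disjoint) (auto simp: finite_walks)
  also have "real \<dots> = (\<Sum>y\<in>{y. adj x y}. (((*v) (\<chi> x y. of_bool (adj x y))) ^^ n) (axis z 1) $ y)"
    by (simp add: Suc card_image)
  also have "\<dots> = (\<Sum>y\<in>UNIV. of_bool (adj x y) * (((*v) (\<chi> x y. of_bool (adj x y))) ^^ n) (axis z 1) $ y)"
    by (rule sum.mono_neutral_cong_left) auto
  finally show ?case by (simp add: matrix_vector_mult_component)
qed

lemma cycle_count_trace:
  fixes \<phi> :: "'a::{field,finite} ^ 'd::finite \<Rightarrow> 'a ^ 'd \<Rightarrow> 'a"
  assumes n: "n \<ge> 1"
  shows "real (cycle_count \<phi> t E n)
    = operator_trace ((*v) (\<chi> x y. of_bool (x \<in> E \<and> y \<in> E \<and> \<phi> x y = t)) ^^ n)"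
proof -
  define adj where "adj = (\<lambda>x y. x \<in> E \<and> y \<in> E \<and> \<phi> x y = t)"
  \<comment> \<open>Rotation moves the starting vertex to the end, where it closes the walk; the
    index \<open>Suc i mod n\<close> becomes the plain index i of the rotated list.\<close>
  have "bij_betw (\<lambda>xs. (hd xs, rotate1 xs)) (cycle_embeddings \<phi> t E n) (Sigma UNIV (\<lambda>x. walks adj n x x))"
  proof (rule bij_betwI[where g = "\<lambda>(x, ys). x # butlast ys"])
    show "(\<lambda>xs. (hd xs, rotate1 xs)) \<in> cycle_embeddings \<phi> t E n \<rightarrow> Sigma UNIV (\<lambda>x. walks adj n x x)"
    proof (intro funcsetI SigmaI UNIV_I)
      fix xs assume xs: "xs \<in> cycle_embeddings \<phi> t E n"
      then have len: "length xs = n" and E: "set xs \<subseteq> E" and ph: "\<And>i. i < n \<Longrightarrow> \<phi> (xs ! i) (xs ! (Suc i mod n)) = t"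
        by (auto simp: cycle_embeddings_def)
      have ne: "xs \<noteq> []" using len n by auto
      have cons: "hd xs # rotate1 xs = xs @ [hd xs]" using ne by (cases xs) auto
      show "rotate1 xs \<in> walks adj n (hd xs) (hd xs)"
        unfolding walks_iff cons using len E ph n
        by (auto simp: nth_append nth_rotate1 adj_def subset_iff)
    qed
    show "(\<lambda>(x, ys). x # butlast ys) \<in> Sigma UNIV (\<lambda>x. walks adj n x x) \<rightarrow> cycle_embeddings \<phi> t E n"
    proof (rule funcsetI)
      fix p assume "p \<in> Sigma UNIV (\<lambda>x. walks adj n x x)"
      then obtain x ys where p: "p = (x, ys)" and "ys \<in> walks adj n x x" by auto
      then have len: "length ys = n" and la: "last (x # ys) = x" and ad: "\<And>i. i < n \<Longrightarrow> adj ((x # ys) ! i) (ys ! i)"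
        by (auto simp: walks_iff)
      have ne: "ys \<noteq> []" using len n by auto
      then have app: "butlast ys @ [x] = ys" using la by (metis append_butlast_last_id last_ConsR)
      define xs where "xs = x # butlast ys"
      have lx: "length xs = n" using len n by (simp add: xs_def)
      have rot: "rotate1 xs = ys" using app by (simp add: xs_def)
      have xy: "x # ys = xs @ [x]" using app by (simp add: xs_def)
      have "adj (xs ! i) (xs ! (Suc i mod n))" if "i < n" for i
      proof -
        have "adj ((xs @ [x]) ! i) (rotate1 xs ! i)" using ad[OF that] by (simp only: xy rot)
        then show ?thesis using that lx by (simp add: nth_append nth_rotate1)
      qed
      then show "(\<lambda>(x, ys). x # butlast ys) p \<in> cycle_embeddings \<phi> t E n"
        unfolding p prod.case using lx by (auto simp: cycle_embeddings_def adj_def in_set_conv_nth simp flip: xs_def)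
    qed
    show "(\<lambda>(x, ys). x # butlast ys) (hd xs, rotate1 xs) = xs" if "xs \<in> cycle_embeddings \<phi> t E n" for xs
      using that n by (cases xs) (auto simp: cycle_embeddings_def)
    show "(\<lambda>xs. (hd xs, rotate1 xs)) ((\<lambda>(x, ys). x # butlast ys) p) = p" if "p \<in> Sigma UNIV (\<lambda>x. walks adj n x x)" for p
    proof -
      obtain x ys where p: "p = (x, ys)" by force
      then have "length ys = n" "last (x # ys) = x" using that by (auto simp: walks_iff)
      then have "butlast ys @ [x] = ys" using n by (metis append_butlast_last_id last_ConsR list.size(3) not_one_le_zero)
      then show ?thesis by (simp add: p)
    qed
  qed
  then have "cycle_count \<phi> t E n = card (Sigma UNIV (\<lambda>x. walks adj n x x))"
    by (simp add: cycle_count_def bij_betw_same_card)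
  also have "\<dots> = (\<Sum>x\<in>UNIV. card (walks adj n x x))" by (simp add: card_SigmaI finite_walks)
  finally show ?thesis
    unfolding operator_trace_def using matrix_power_walks[where adj = adj and n = n] by (simp add: adj_def)
qed

section \<open>Counting cycles\<close>

text \<open>Restricting to E first sets f to zero outside E and finally drops coordinates of the
  result; neither increases a norm.\<close>

lemma restricted_matrix_norm_bound:
  fixes \<phi> :: "'a::{field,finite} ^ 'd::finite \<Rightarrow> 'a ^ 'd \<Rightarrow> 'a"
  assumes odd: "odd CARD('a)" and phi: "distance_type \<phi>" and t: "t \<noteq> 0"
  shows "norm ((\<chi> x y. of_bool (x \<in> E \<and> y \<in> E) * (of_bool (\<phi> x y = t) - 1 / real CARD('a))) *v f)
    \<le> 2 * sqrt (real CARD('a) ^ CARD('d) / real CARD('a)) * norm f" (is "norm (?R *v f) \<le> ?\<rho> * norm f")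
proof -
  let ?r = "\<lambda>x y. of_bool (\<phi> x y = t) - 1 / real CARD('a)"
  define h where "h = (\<lambda>y. of_bool (y \<in> E) * f $ y)"
  have sq: "(norm g)\<^sup>2 = (\<Sum>x\<in>UNIV. (g $ x)\<^sup>2)" for g :: "real ^ ('a ^ 'd)"
    unfolding power2_norm_eq_inner inner_vec_def by (simp add: power2_eq_square)
  have "(?R *v f) $ x = of_bool (x \<in> E) * (\<Sum>y\<in>UNIV. ?r x y * h y)" for x
    unfolding matrix_vector_mult_component sum_distrib_left by (intro sum.cong) (auto simp: h_def)
  then have "(norm (?R *v f))\<^sup>2 = (\<Sum>x\<in>UNIV. (of_bool (x \<in> E) * (\<Sum>y\<in>UNIV. ?r x y * h y))\<^sup>2)"
    by (simp only: sq)
  also have "\<dots> \<le> (\<Sum>x\<in>UNIV. (\<Sum>y\<in>UNIV. ?r x y * h y)\<^sup>2)"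
    by (rule sum_mono) auto
  also have "\<dots> \<le> 4 * real CARD('a) ^ CARD('d) / real CARD('a) * (\<Sum>y\<in>UNIV. (h y)\<^sup>2)"
    by (rule distance_operator_bound[OF odd phi t])
  also have "\<dots> \<le> 4 * real CARD('a) ^ CARD('d) / real CARD('a) * (\<Sum>y\<in>UNIV. (f $ y)\<^sup>2)"
    by (intro mult_left_mono sum_mono) (auto simp: h_def)
  also have "\<dots> = (?\<rho> * norm f)\<^sup>2"
    by (simp add: power_mult_distrib sq)
  finally show ?thesis by (rule power2_le_imp_le) simp
qed

lemma cycle_count_estimate:
  fixes \<phi> :: "'a::{field,finite} ^ 'd::finite \<Rightarrow> 'a ^ 'd \<Rightarrow> 'a"
  assumes odd: "odd CARD('a)" and phi: "distance_type \<phi>" and t: "t \<noteq> 0" and n: "n \<ge> 2"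
    and a: "a = real (card E) / real CARD('a)"
    and \<rho>: "\<rho> = 2 * sqrt (real CARD('a) ^ CARD('d) / real CARD('a))"
  shows "\<bar>real (cycle_count \<phi> t E n) - a ^ n\<bar>
    \<le> (a + \<rho>) ^ n - \<rho> ^ n - a ^ n + \<rho> ^ (n - 2) * (real CARD('a) * a * (a + \<rho>))"
proof -
  let ?q = "real CARD('a)"
  have q: "?q \<ge> 2" using CARD_field_ge_2[where ?'a = 'a] by simp
  define M :: "real ^ ('a ^ 'd) ^ ('a ^ 'd)" where "M = (\<chi> x y. of_bool (x \<in> E \<and> y \<in> E \<and> \<phi> x y = t))"
  define R :: "real ^ ('a ^ 'd) ^ ('a ^ 'd)"
    where "R = (\<chi> x y. of_bool (x \<in> E \<and> y \<in> E) * (of_bool (\<phi> x y = t) - 1 / ?q))"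
  define w :: "real ^ ('a ^ 'd)" where "w = (\<chi> x. of_bool (x \<in> E))"
  have \<rho>0: "\<rho> \<ge> 0" by (simp add: \<rho>)
  have R_bound: "norm (R *v f) \<le> \<rho> * norm f" for f
    unfolding R_def \<rho> by (rule restricted_matrix_norm_bound[OF odd phi t])
  have w_inner: "w \<bullet> f = (\<Sum>y\<in>E. f $ y)" for f
    unfolding inner_vec_def by (rule sum.mono_neutral_cong_right) (auto simp: w_def)
  have ww: "(norm w)\<^sup>2 = real (card E)"
    unfolding power2_norm_eq_inner w_inner by (simp add: w_def)
  have MR: "M *v f = R *v f + (1 / ?q * (w \<bullet> f)) *\<^sub>R w" for f
  proof -
    have "w \<bullet> f = (\<Sum>y\<in>UNIV. w $ y * f $ y)" by (simp add: inner_vec_def)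
    moreover have "M $ x $ y = R $ x $ y + 1 / ?q * w $ y * w $ x" for x y
      by (auto simp: M_def R_def w_def)
    ultimately show ?thesis
      by (simp add: vec_eq_iff matrix_vector_mult_component algebra_simps sum.distrib sum_distrib_left sum_divide_distrib)
  qed
  have tr: "\<bar>operator_trace ((*v) M ^^ n) - operator_trace ((*v) R ^^ n) - a ^ n\<bar> \<le> (a + \<rho>) ^ n - \<rho> ^ n - a ^ n"
    by (rule trace_power_rank_one_perturbation[OF _ _ MR R_bound \<rho>0])
      (use n in \<open>auto simp: ww a matrix_vector_mul_linear\<close>)
  \<comment> \<open>On E \<times> E the entries of R are 1 - 1/q or -1/q, so their squares are (1 -
    2/q) M + 1/q^2. The Hilbert-Schmidt norm is thus controlled by the number of related pairs,
    which is at most (a + \<rho>) \<bar>E\<bar> by the norm bound again.\<close>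
  have HS: "(\<Sum>x\<in>UNIV. \<Sum>y\<in>UNIV. (R $ x $ y)\<^sup>2) \<le> ?q * a * (a + \<rho>)"
  proof -
    let ?k = "real (card E)"
    have "R $ x $ y ^ 2 = (1 - 2 / ?q) * (w $ x * (M $ x $ y * w $ y)) + (1 / ?q)\<^sup>2 * (w $ x * w $ y)" for x y
      by (auto simp: R_def M_def w_def power2_eq_square algebra_simps)
    then have "(\<Sum>x\<in>UNIV. \<Sum>y\<in>UNIV. (R $ x $ y)\<^sup>2) = (1 - 2 / ?q) * (w \<bullet> (M *v w)) + (1 / ?q)\<^sup>2 * (?k * ?k)"
    proof -
      assume e: "\<And>x y. R $ x $ y ^ 2 = (1 - 2 / ?q) * (w $ x * (M $ x $ y * w $ y)) + (1 / ?q)\<^sup>2 * (w $ x * w $ y)"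
      have "(\<Sum>x\<in>UNIV. \<Sum>y\<in>UNIV. w $ x * (M $ x $ y * w $ y)) = w \<bullet> (M *v w)"
        by (simp add: inner_vec_def matrix_vector_mult_component sum_distrib_left)
      moreover have "(\<Sum>x\<in>UNIV. w $ x) = ?k"
        unfolding w_def by (simp add: of_bool_def sum.If_cases)
      then have "(\<Sum>x\<in>UNIV. \<Sum>y\<in>UNIV. w $ x * w $ y) = ?k * ?k"
        unfolding sum_product[symmetric] by simp
      ultimately show ?thesis
        unfolding e sum.distrib sum_distrib_left[symmetric] by simp
    qed
    also have "w \<bullet> (M *v w) \<le> (a + \<rho>) * ?k"
    proof -
      have "w \<bullet> (M *v w) = w \<bullet> (R *v w) + a * ?k"
        by (simp add: MR inner_add_right power2_norm_eq_inner[symmetric] ww a)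
      moreover have "w \<bullet> (R *v w) \<le> norm w * (\<rho> * norm w)"
        using order_trans[OF norm_cauchy_schwarz mult_left_mono[OF R_bound norm_ge_zero]] .
      moreover have "norm w * (\<rho> * norm w) = \<rho> * ?k" by (simp add: ww[symmetric] power2_eq_square)
      ultimately show ?thesis by (simp add: distrib_right)
    qed
    then have "(1 - 2 / ?q) * (w \<bullet> (M *v w)) + (1 / ?q)\<^sup>2 * (?k * ?k) \<le> (1 - 2 / ?q) * ((a + \<rho>) * ?k) + (1 / ?q)\<^sup>2 * (?k * ?k)"
      using q by (intro add_right_mono mult_left_mono) auto
    \<comment> \<open>The constant part sums to a^2, which is paid for by the discarded share 2 a (a
      + \<rho>) of the pairs.\<close>
    also have "\<dots> \<le> (a + \<rho>) * ?k"
    proof -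
      have ak: "?k = ?q * a" using q by (simp add: a)
      have "a \<ge> 0" by (simp add: a)
      have "(1 - 2 / ?q) * ((a + \<rho>) * ?k) + (1 / ?q)\<^sup>2 * (?k * ?k) = (a + \<rho>) * ?k - 2 * (a + \<rho>) * a + a * a"
        unfolding ak using q by (simp add: field_simps power2_eq_square)
      also have "\<dots> \<le> (a + \<rho>) * ?k"
        using \<open>a \<ge> 0\<close> \<rho>0 mult_nonneg_nonneg[of a a] mult_nonneg_nonneg[of \<rho> a] by (simp add: algebra_simps)
      finally show ?thesis .
    qed
    also have "(a + \<rho>) * ?k = ?q * a * (a + \<rho>)" using q by (simp add: a)
    finally show ?thesis by simp
  qed
  have "\<bar>operator_trace ((*v) R ^^ n)\<bar> \<le> \<rho> ^ (n - 2) * (\<Sum>x\<in>UNIV. \<Sum>y\<in>UNIV. (R $ x $ y)\<^sup>2)"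
  proof -
    have "n - 2 + 2 = n" using n by simp
    from trace_power_hilbert_schmidt[OF R_bound \<rho>0, of "n - 2", unfolded this] show ?thesis .
  qed
  also have "\<dots> \<le> \<rho> ^ (n - 2) * (?q * a * (a + \<rho>))"
    by (intro mult_left_mono HS zero_le_power \<rho>0)
  finally have "\<bar>operator_trace ((*v) R ^^ n)\<bar> \<le> \<dots>" .
  moreover have "real (cycle_count \<phi> t E n) = operator_trace ((*v) M ^^ n)"
    unfolding M_def using n by (intro cycle_count_trace) simp
  ultimately show ?thesis using tr by linarith
qed

section \<open>Elementary inequalities for the relative error\<close>

lemma one_plus_power_bound:
  fixes \<epsilon> :: real
  assumes "\<epsilon> \<ge> 0" "real n * \<epsilon> \<le> 1 / 3"
  shows "(1 + \<epsilon>) ^ n \<le> 1 + 4 / 3 * (real n * \<epsilon>)"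
proof -
  define z where "z = real n * \<epsilon>"
  have z: "0 \<le> z" "z \<le> 1 / 3" using assms by (auto simp: z_def)
  have "(1 + \<epsilon>) ^ n \<le> exp \<epsilon> ^ n" using assms by (intro power_mono exp_ge_add_one_self) auto
  also have "\<dots> = exp z" by (simp add: z_def exp_of_nat_mult)
  also have "\<dots> \<le> 1 + z + z\<^sup>2" using z by (intro exp_bound) auto
  also have "z\<^sup>2 \<le> 1 / 3 * z" unfolding power2_eq_square using z by (intro mult_right_mono) auto
  finally show ?thesis unfolding z_def[symmetric] by linarith
qed

text \<open>
  Here \<open>x\<close> stands for \<open>q\<^bsup>(d+1)/2\<^esup> / \<bar>E\<bar>\<close>, so that \<open>\<rho> = 2 x a\<close> and
  \<open>q\<^bsup>d+2\<^esup> / \<bar>E\<bar>\<^sup>2 = q x\<^sup>2\<close>.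
\<close>

lemma relative_error_bounds:
  fixes q x G :: real and n :: nat
  assumes q: "q \<ge> 1" and x: "x \<ge> 0" and G: "G \<ge> 0" and n: "n \<ge> 4"
    and small: "G + 8 * (q * x\<^sup>2) + (24 + 12 * real (n div 2)) * x \<le> 1"
    and err: "err = (1 + 2 * x) ^ n - (2 * x) ^ n - 1 + (2 * x) ^ (n - 2) * (q * (1 + 2 * x))"
  shows "n \<ge> 6 \<Longrightarrow> err \<le> G + 8 * x\<^sup>2 + (24 + 12 * real (n div 2)) * x"
    and "n = 4 \<Longrightarrow> err \<le> G + 8 * (q * x\<^sup>2) + 28 * x"
    and "n = 5 \<Longrightarrow> err \<le> G + 8 * (sqrt q * x\<^sup>2) + 32 * x"
proof -
  \<comment> \<open>Hence 24 + 12 \<lfloor>n/2\<rfloor> \<ge> 18 + 6 n. The smallness hypothesis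
    then yields 6 n x \<le> 1, which is the condition n (2 x) \<le> 1/3 of the exponential
    estimate.\<close>
  have n2: "12 * real (n div 2) \<ge> 6 * real n - 6"
  proof -
    have "n \<le> 2 * (n div 2) + 1" by presburger
    then have "real n \<le> real (2 * (n div 2) + 1)" by (simp only: of_nat_le_iff)
    then show ?thesis by simp
  qed
  have qx: "q * x\<^sup>2 \<ge> 0" using q by simp
  have "(18 + 6 * real n) * x \<le> (24 + 12 * real (n div 2)) * x"
    using n2 x by (intro mult_right_mono) auto
  then have nx: "(18 + 6 * real n) * x \<le> (24 + 12 * real (n div 2)) * x" "(18 + 6 * real n) * x \<le> 1"
    using small G qx by auto
  have "(18 + 6 * real n) * x = 18 * x + 6 * (real n * x)" by (simp add: algebra_simps)
  moreover have "real n * x \<ge> 4 * x" using n x by (intro mult_right_mono) auto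
  ultimately have nx3: "real n * (2 * x) \<le> 1 / 3" and x3: "2 * x \<le> 1 / 3" using nx(2) x by auto
  have y: "q * x\<^sup>2 \<le> 1 / 8"
  proof -
    have "(24 + 12 * real (n div 2)) * x \<ge> 0" using x by simp
    then show ?thesis using small G by linarith
  qed
  have pow: "(1 + 2 * x) ^ n - 1 \<le> 8 / 3 * (real n * x)"
    using one_plus_power_bound[of "2 * x" n] x nx3 by simp
  have tail: "(2 * x) ^ (n - 2) * (q * (1 + 2 * x)) \<le> (2 * x) ^ (n - 2) * (q * (4 / 3))"
    using x x3 q by (intro mult_left_mono) auto
  have neg: "(2 * x) ^ n \<ge> 0" using x by simp
  have e0: "err \<le> 8 / 3 * (real n * x) + (2 * x) ^ (n - 2) * (q * (4 / 3))"
    unfolding err using pow tail neg by linarith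
  show "err \<le> G + 8 * x\<^sup>2 + (24 + 12 * real (n div 2)) * x" if n6: "n \<ge> 6"
  proof -
    \<comment> \<open>Four powers of x allow one factor q x^2 \<le> 1/8 to be spent, which removes q
      from the tail: 16 * (4/3) / 8 = 8/3.\<close>
    have "(2 * x) ^ (n - 2) \<le> (2 * x) ^ 4" using n6 x x3 by (intro power_decreasing) auto
    then have "(2 * x) ^ (n - 2) * (q * (4 / 3)) \<le> (2 * x) ^ 4 * (q * (4 / 3))"
      using q by (intro mult_right_mono) auto
    also have "\<dots> = 64 / 3 * x\<^sup>2 * (q * x\<^sup>2)" by (simp add: power4_eq_xxxx power2_eq_square)
    also have "\<dots> \<le> 64 / 3 * x\<^sup>2 * (1 / 8)" using y by (intro mult_left_mono) auto
    finally have "(2 * x) ^ (n - 2) * (q * (4 / 3)) \<le> 8 / 3 * x\<^sup>2" by simp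
    moreover have "8 / 3 * (real n * x) \<le> (18 + 6 * real n) * x"
      using x by (simp add: algebra_simps)
    ultimately show ?thesis using e0 nx(1) G zero_le_power2[of x] by linarith
  qed
  show "err \<le> G + 8 * (q * x\<^sup>2) + 28 * x" if n4: "n = 4"
  proof -
    have "(2 * x) ^ (n - 2) * (q * (4 / 3)) = 16 / 3 * (q * x\<^sup>2)" by (simp add: n4 power2_eq_square)
    moreover have "real n * x = 4 * x" using n4 by simp
    ultimately show ?thesis using e0 qx G x by linarith
  qed
  show "err \<le> G + 8 * (sqrt q * x\<^sup>2) + 32 * x" if n5: "n = 5"
  proof -
    \<comment> \<open>The tail is of order q x^3, one power of x short of the case n \<ge> 6. Only x
      \<surd>q \<le> 1/2 can be spent, which leaves \<surd>q x^2.\<close>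
    have s: "sqrt q * sqrt q = q" using q by simp
    have e: "(x * sqrt q)\<^sup>2 = q * x\<^sup>2" using q by (simp add: power_mult_distrib)
    have "(x * sqrt q)\<^sup>2 \<le> (1 / 2)\<^sup>2" unfolding e using y by (simp add: power_divide)
    then have sx: "x * sqrt q \<le> 1 / 2" by (rule power2_le_imp_le) simp
    have "(2 * x) ^ (n - 2) * (q * (4 / 3)) = 32 / 3 * (x ^ 3 * q)" by (simp add: n5 power3_eq_cube)
    also have "x ^ 3 * q = (sqrt q * x\<^sup>2) * (x * sqrt q)"
    proof -
      have "(sqrt q * x\<^sup>2) * (x * sqrt q) = x ^ 3 * (sqrt q * sqrt q)"
        by (simp only: power3_eq_cube power2_eq_square mult_ac)
      then show ?thesis unfolding s by simp
    qed
    also have "32 / 3 * \<dots> \<le> 32 / 3 * ((sqrt q * x\<^sup>2) * (1 / 2))" using sx q by (intro mult_left_mono) auto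
    finally have "(2 * x) ^ (n - 2) * (q * (4 / 3)) \<le> 16 / 3 * (sqrt q * x\<^sup>2)" by simp
    moreover have "sqrt q * x\<^sup>2 \<ge> 0" using q by simp
    moreover have "real n * x = 5 * x" using n5 by simp
    ultimately show ?thesis using e0 G x by linarith
  qed
qed

theorem theorem6p1:
  fixes \<phi> :: "'a::{field,finite} ^ 'd::finite \<Rightarrow> 'a ^ 'd \<Rightarrow> 'a"
    and t :: 'a
    and E :: "('a ^ 'd) set"
    and q d n :: nat
    and \<gamma> :: real
  assumes q: "q = CARD('a)" and "odd q"
    and d: "d = CARD('d)" and "d \<ge> 2"
    and "distance_type \<phi>"
    and "t \<noteq> 0"
    and "E \<noteq> {}"
    and \<gamma>: "\<gamma> = gamma_exponent d"
    and "n \<ge> 4"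
    and "12 * real q powr \<gamma> + 8 * (real q ^ (d + 2) / real (card E) ^ 2)
           + (24 + 12 * real (n div 2)) * (real q powr ((real d + 1) / 2) / real (card E)) \<le> 1"
  shows "(n \<ge> 6 \<longrightarrow>
            \<bar>real (cycle_count \<phi> t E n) - real (card E) ^ n / real q ^ n\<bar>
              \<le> real (card E) ^ n / real q ^ n *
                 (12 * real q powr \<gamma> + 8 * (real q ^ (d + 1) / real (card E) ^ 2)
                  + (24 + 12 * real (n div 2)) * (real q powr ((real d + 1) / 2) / real (card E))))
       \<and> (n = 4 \<longrightarrow>
            \<bar>real (cycle_count \<phi> t E 4) - real (card E) ^ 4 / real q ^ 4\<bar>
              \<le> real (card E) ^ 4 / real q ^ 4 *
                 (12 * real q powr \<gamma> + 8 * (real q ^ (d + 2) / real (card E) ^ 2)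
                  + 28 * (real q powr ((real d + 1) / 2) / real (card E))))
       \<and> (n = 5 \<longrightarrow>
            \<bar>real (cycle_count \<phi> t E 5) - real (card E) ^ 5 / real q ^ 5\<bar>
              \<le> real (card E) ^ 5 / real q ^ 5 *
                 (12 * real q powr \<gamma> + 8 * (real q powr ((2 * real d + 3) / 2) / real (card E) ^ 2)
                  + 32 * (real q powr ((real d + 1) / 2) / real (card E))))"
proof -
  define e where "e = real (card E)"
  have e: "e > 0" using \<open>E \<noteq> {}\<close> by (simp add: e_def card_gt_0_iff)
  have q1: "real q \<ge> 1" using CARD_field_ge_2[where ?'a = 'a] q by simp
  define x where "x = real q powr ((real d + 1) / 2) / e"
  define a where "a = e / real q"
  define \<rho> where "\<rho> = 2 * sqrt (real q ^ d / real q)"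
  define G where "G = 12 * real q powr \<gamma>"
  define err where "err = (1 + 2 * x) ^ n - (2 * x) ^ n - 1 + (2 * x) ^ (n - 2) * (real q * (1 + 2 * x))"
  have x0: "x \<ge> 0" using e by (simp add: x_def)
  have a0: "a > 0" using e q1 by (simp add: a_def)
  have half: "real q powr ((real d + 1) / 2) = sqrt (real q ^ (d + 1))"
  proof -
    have "real q powr ((real d + 1) / 2) = (real q powr real (d + 1)) powr (1 / 2)"
      by (simp add: powr_powr add.commute)
    then show ?thesis using q1 by (simp add: powr_realpow powr_half_sqrt del: of_nat_add of_nat_Suc)
  qed
  have x2: "x\<^sup>2 = real q ^ (d + 1) / e\<^sup>2" using q1 by (simp add: x_def half power_divide)
  have y: "real q ^ (d + 2) / e\<^sup>2 = real q * x\<^sup>2" by (simp add: x2)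
  have y5: "real q powr ((2 * real d + 3) / 2) / e\<^sup>2 = sqrt (real q) * x\<^sup>2"
  proof -
    have "(2 * real d + 3) / 2 = real (d + 1) + 1 / 2" by simp
    then have "real q powr ((2 * real d + 3) / 2) = real q powr real (d + 1) * real q powr (1 / 2)"
      by (simp only: powr_add)
    also have "\<dots> = real q ^ (d + 1) * sqrt (real q)"
      using q1 by (simp only: powr_realpow powr_half_sqrt)
    finally show ?thesis by (simp add: x2)
  qed
  \<comment> \<open>Both x a and \<rho> / 2 equal q^((d-1)/2).\<close>
  have \<rho>: "\<rho> = 2 * x * a"
  proof -
    have "sqrt (real q ^ d / real q) = sqrt (real q ^ (d + 1) / (real q)\<^sup>2)" using q1 by (simp add: power2_eq_square)
    also have "\<dots> = sqrt (real q ^ (d + 1)) / real q" using q1 by (simp add: real_sqrt_divide)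
    finally show ?thesis using e by (simp add: \<rho>_def x_def a_def half)
  qed
  have an: "e ^ k / real q ^ k = a ^ k" for k by (simp add: a_def power_divide)
  have "\<bar>real (cycle_count \<phi> t E n) - a ^ n\<bar>
      \<le> (a + \<rho>) ^ n - \<rho> ^ n - a ^ n + \<rho> ^ (n - 2) * (real q * a * (a + \<rho>))"
    unfolding q
    by (rule cycle_count_estimate) (use assms in \<open>auto simp: a_def \<rho>_def e_def\<close>)
  \<comment> \<open>With \<rho> proportional to a, every term is homogeneous of degree n in a,
    including the Hilbert-Schmidt term.\<close>
  also have "\<dots> = a ^ n * err"
  proof -
    have ap: "a + \<rho> = a * (1 + 2 * x)" by (simp add: \<rho> algebra_simps)
    have "n = n - 2 + 2" using \<open>n \<ge> 4\<close> by simp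
    then have an2: "a ^ n = a ^ (n - 2) * (a * a)" by (metis power_add power2_eq_square)
    have "\<rho> ^ (n - 2) * (real q * a * (a + \<rho>)) = a ^ n * ((2 * x) ^ (n - 2) * (real q * (1 + 2 * x)))"
      unfolding ap an2 unfolding \<rho> power_mult_distrib by (simp only: mult_ac)
    moreover have "(a + \<rho>) ^ n = a ^ n * (1 + 2 * x) ^ n" unfolding ap power_mult_distrib ..
    moreover have "\<rho> ^ n = a ^ n * (2 * x) ^ n" unfolding \<rho> power_mult_distrib by (simp only: mult_ac)
    ultimately show ?thesis by (simp only: err_def right_diff_distrib distrib_left mult_1_right)
  qed
  finally have main: "\<bar>real (cycle_count \<phi> t E n) - a ^ n\<bar> \<le> a ^ n * err" .
  have small: "G + 8 * (real q * x\<^sup>2) + (24 + 12 * real (n div 2)) * x \<le> 1"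
    using assms(10) unfolding G_def e_def[symmetric] y x_def[symmetric] by simp
  have "G \<ge> 0" by (simp add: G_def)
  note bounds = relative_error_bounds[OF q1 x0 this \<open>n \<ge> 4\<close> small err_def]
  have scale: "\<bar>real (cycle_count \<phi> t E n) - a ^ n\<bar> \<le> a ^ n * c" if "err \<le> c" for c
    by (rule order_trans[OF main mult_left_mono[OF that]]) (use a0 in simp)
  show ?thesis
    unfolding e_def[symmetric] x_def[symmetric] y y5 x2[symmetric] G_def[symmetric] an
    using scale[OF bounds(1)] scale[OF bounds(2)] scale[OF bounds(3)] by auto
qed

end
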